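(* Let $\mathcal{X}(\mathbf{\Sigma})$ be the toric Deligne-Mumford stack associated to a stacky fan $\mathbf{\Sigma}=(N,\Sigma,\beta)$, and let $\beta^\vee:\mathbb{Z}^n\to N^\vee$ be the Gale dual of $\beta:\mathbb{Z}^n\to N$. Then $Pic(\mathcal{X}(\mathbf{\Sigma}))\cong N^{\vee}$.
   Context: Everything is over $\mathbb{C}$. A stacky fan $\mathbf{\Sigma}=(N,\Sigma,\beta)$ consists of: a finitely generated abelian group $N$ of rank $d$, with $\overline N=N/\text{torsion}$ and quotient map $b\mapsto\overline b$; a simplicial fan $\Sigma$ in $N\otimes\mathbb{Q}$ with rays $\rho_1,\dots,\rho_n$; and a map $\beta:\mathbb{Z}^n\to N$, $e_i\mapsto b_i$, with finite cokernel and such that $\overline b_i$ generates $\rho_i$. Gale dual: choose a free resolution $0\to\mathbb{Z}^r\xrightarrow{Q}\mathbb{Z}^{d+r}\to N\to0$ and a lift $B:\mathbb{Z}^n\to\mathbb{Z}^{d+r}$ of $\beta$; then $N^\vee=(\mathbb{Z}^{n+r})^\star/\mathrm{Im}([B,Q]^\star)$ and $\beta^\vee:(\mathbb{Z}^n)^\star\to N^\vee$ is the inclusion into $(\mathbb{Z}^{n+r})^\star$ followed by the quotient map. Let $G=\mathrm{Hom}_{\mathbb{Z}}(N^\vee,\mathbb{C}^* )$, $\alpha:G\to(\mathbb{C}^* )^n$ the map obtained from $\beta^\vee$ by $\mathrm{Hom}_{\mathbb{Z}}(-,\mathbb{C}^* )$, $J_\Sigma=\langle\prod_{\rho_i\nsubseteq\sigma}z_i:\sigma\in\Sigma\rangle$,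 $Z=\mathbb{A}^n\setminus\mathbb{V}(J_\Sigma)$; $\mathcal{X}(\mathbf{\Sigma})=[Z/G]$ with $G$ acting through $\alpha$. $Pic(\mathcal{X}(\mathbf{\Sigma}))$ is the group of isomorphism classes of line bundles on $\mathcal{X}(\mathbf{\Sigma})$, i.e. of $G$-equivariant line bundles on $Z$. *)

theory Defs
  imports Complex_Main "HOL-Algebra.Free_Abelian_Groups" "HOL-Algebra.Group_Action"
    "HOL-Algebra.Ideal"
begin

section \<open>Stacky fans\<close>

text \<open>Abelian groups are multiplicatively written HOL-Algebra groups. The standard basis vector
  \<open>e_i\<close> of \<open>Z^m\<close> is \<open>frag_of i\<close>, with indices running from \<open>0\<close> to \<open>m - 1\<close>.\<close>

abbreviation Zfree :: "nat \<Rightarrow> (nat \<Rightarrow>\<^sub>0 int) monoid" where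
  "Zfree m \<equiv> free_Abelian_group {..<m}"

definition rat_group :: "rat monoid" where
  "rat_group = \<lparr>carrier = UNIV, monoid.mult = (+), one = 0\<rparr>"

definition torsion :: "('a, 'm) monoid_scheme \<Rightarrow> 'a set" where
  "torsion N = {x \<in> carrier N. \<exists>k::nat. 0 < k \<and> x [^]\<^bsub>N\<^esub> k = \<one>\<^bsub>N\<^esub>}"

definition fg_abelian_group_of_rank :: "('a, 'm) monoid_scheme \<Rightarrow> nat \<Rightarrow> bool" where
  "fg_abelian_group_of_rank N d \<longleftrightarrow>
     comm_group N \<and>
     (\<exists>S. finite S \<and> S \<subseteq> carrier N \<and> generate N S = carrier N) \<and>
     N Mod torsion N \<cong> Zfree d"

text \<open>The tensor product of \<open>N\<close> with the rationals over the integers: the free abelian group on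
  \<open>N \<times> \<rat>\<close> modulo biadditivity.\<close>

definition tensor_relations :: "('a, 'm) monoid_scheme \<Rightarrow> ('a \<times> rat \<Rightarrow>\<^sub>0 int) set" where
  "tensor_relations N = generate (free_Abelian_group (carrier N \<times> UNIV))
     ({frag_of (a \<otimes>\<^bsub>N\<^esub> b, q) - frag_of (a, q) - frag_of (b, q) | a b q.
         a \<in> carrier N \<and> b \<in> carrier N} \<union>
      {frag_of (a, q + q') - frag_of (a, q) - frag_of (a, q') | a q q'. a \<in> carrier N})"

definition NQ :: "('a, 'm) monoid_scheme \<Rightarrow> ('a \<times> rat \<Rightarrow>\<^sub>0 int) set monoid" where
  "NQ N = free_Abelian_group (carrier N \<times> UNIV) Mod tensor_relations N"

definition pure_tensor :: "('a, 'm) monoid_scheme \<Rightarrow> 'a \<Rightarrow> rat \<Rightarrow> ('a \<times> rat \<Rightarrow>\<^sub>0 int) set" where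
  "pure_tensor N b q =
     tensor_relations N #>\<^bsub>free_Abelian_group (carrier N \<times> UNIV)\<^esub> frag_of (b, q)"

text \<open>The rational linear combination of the elements \<open>b \<otimes> 1\<close> with coefficients \<open>c b\<close>.\<close>

definition lin_comb ::
    "('a, 'm) monoid_scheme \<Rightarrow> 'a set \<Rightarrow> ('a \<Rightarrow> rat) \<Rightarrow> ('a \<times> rat \<Rightarrow>\<^sub>0 int) set" where
  "lin_comb N S c = finprod (NQ N) (\<lambda>b. pure_tensor N b (c b)) S"

definition cone_of :: "('a, 'm) monoid_scheme \<Rightarrow> 'a set \<Rightarrow> ('a \<times> rat \<Rightarrow>\<^sub>0 int) set set" where
  "cone_of N S = {lin_comb N S c | c. \<forall>b\<in>S. 0 \<le> c b}"

definition lin_indep :: "('a, 'm) monoid_scheme \<Rightarrow> 'a set \<Rightarrow> bool" where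
  "lin_indep N S \<longleftrightarrow> finite S \<and> S \<subseteq> carrier N \<and>
     (\<forall>c. lin_comb N S c = \<one>\<^bsub>NQ N\<^esub> \<longrightarrow> (\<forall>b\<in>S. c b = 0))"

text \<open>No generality is lost by taking the generators of a rational cone in \<open>N\<close>: every element of
  the tensor product is a positive rational multiple of some \<open>b \<otimes> 1\<close>. Simplicial cones are
  automatically strongly convex.\<close>

definition simplicial_cone ::
    "('a, 'm) monoid_scheme \<Rightarrow> ('a \<times> rat \<Rightarrow>\<^sub>0 int) set set \<Rightarrow> bool" where
  "simplicial_cone N \<sigma> \<longleftrightarrow> (\<exists>S. lin_indep N S \<and> \<sigma> = cone_of N S)"

text \<open>Additive maps between rational vector spaces are linear, so the \<open>m\<close> below ranges over the
  dual vector space.\<close>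

definition face_of_cone ::
    "('a, 'm) monoid_scheme \<Rightarrow> ('a \<times> rat \<Rightarrow>\<^sub>0 int) set set \<Rightarrow> ('a \<times> rat \<Rightarrow>\<^sub>0 int) set set \<Rightarrow> bool" where
  "face_of_cone N \<tau> \<sigma> \<longleftrightarrow>
     (\<exists>m \<in> hom (NQ N) rat_group. (\<forall>x\<in>\<sigma>. 0 \<le> m x) \<and> \<tau> = {x \<in> \<sigma>. m x = 0})"

definition simplicial_fan ::
    "('a, 'm) monoid_scheme \<Rightarrow> ('a \<times> rat \<Rightarrow>\<^sub>0 int) set set set \<Rightarrow> bool" where
  "simplicial_fan N \<Sigma> \<longleftrightarrow> finite \<Sigma> \<and> \<Sigma> \<noteq> {} \<and>
     (\<forall>\<sigma>\<in>\<Sigma>. simplicial_cone N \<sigma>) \<and>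
     (\<forall>\<sigma>\<in>\<Sigma>. \<forall>\<tau>. face_of_cone N \<tau> \<sigma> \<longrightarrow> \<tau> \<in> \<Sigma>) \<and>
     (\<forall>\<sigma>\<in>\<Sigma>. \<forall>\<tau>\<in>\<Sigma>. face_of_cone N (\<sigma> \<inter> \<tau>) \<sigma> \<and> face_of_cone N (\<sigma> \<inter> \<tau>) \<tau>)"

definition fan_rays ::
    "('a, 'm) monoid_scheme \<Rightarrow> ('a \<times> rat \<Rightarrow>\<^sub>0 int) set set set \<Rightarrow> ('a \<times> rat \<Rightarrow>\<^sub>0 int) set set set" where
  "fan_rays N \<Sigma> = {\<sigma> \<in> \<Sigma>. \<exists>b. lin_indep N {b} \<and> \<sigma> = cone_of N {b}}"

text \<open>\<open>stacky_ray N \<beta> i\<close> is the ray \<open>\<rho>_i\<close> generated by \<open>b_i\<close>; the image \<open>b_i \<otimes> 1\<close> depends only on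
  the class of \<open>b_i\<close> modulo torsion.\<close>

definition stacky_ray ::
    "('a, 'm) monoid_scheme \<Rightarrow> ((nat \<Rightarrow>\<^sub>0 int) \<Rightarrow> 'a) \<Rightarrow> nat \<Rightarrow> ('a \<times> rat \<Rightarrow>\<^sub>0 int) set set" where
  "stacky_ray N \<beta> i = cone_of N {\<beta> (frag_of i)}"

definition stacky_fan ::
    "('a, 'm) monoid_scheme \<Rightarrow> nat \<Rightarrow> nat \<Rightarrow> ('a \<times> rat \<Rightarrow>\<^sub>0 int) set set set \<Rightarrow>
     ((nat \<Rightarrow>\<^sub>0 int) \<Rightarrow> 'a) \<Rightarrow> bool" where
  "stacky_fan N d n \<Sigma> \<beta> \<longleftrightarrow>
     fg_abelian_group_of_rank N d \<and>
     simplicial_fan N \<Sigma> \<and>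
     \<beta> \<in> hom (Zfree n) N \<and>
     finite (carrier (N Mod (\<beta> ` carrier (Zfree n)))) \<and>
     bij_betw (stacky_ray N \<beta>) {..<n} (fan_rays N \<Sigma>)"


section \<open>Gale duality\<close>

definition hom_group ::
    "('a, 'm) monoid_scheme \<Rightarrow> ('b, 'k) monoid_scheme \<Rightarrow> ('a \<Rightarrow> 'b) monoid" where
  "hom_group A B =
     \<lparr>carrier = hom A B \<inter> extensional (carrier A),
      monoid.mult = (\<lambda>f g. \<lambda>x\<in>carrier A. f x \<otimes>\<^bsub>B\<^esub> g x),
      one = (\<lambda>x\<in>carrier A. \<one>\<^bsub>B\<^esub>)\<rparr>"

abbreviation dual_group :: "('a, 'm) monoid_scheme \<Rightarrow> ('a \<Rightarrow> int) monoid" where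
  "dual_group A \<equiv> hom_group A integer_group"

text \<open>\<open>0 \<rightarrow> Z^r \<rightarrow> Z^(d+r) \<rightarrow> N \<rightarrow> 0\<close> with maps \<open>Q\<close> and \<open>p\<close>.\<close>

definition free_resolution ::
    "('a, 'm) monoid_scheme \<Rightarrow> nat \<Rightarrow> nat \<Rightarrow> ((nat \<Rightarrow>\<^sub>0 int) \<Rightarrow> (nat \<Rightarrow>\<^sub>0 int)) \<Rightarrow>
     ((nat \<Rightarrow>\<^sub>0 int) \<Rightarrow> 'a) \<Rightarrow> bool" where
  "free_resolution N d r Q p \<longleftrightarrow>
     Q \<in> hom (Zfree r) (Zfree (d + r)) \<and>
     p \<in> hom (Zfree (d + r)) N \<and>
     inj_on Q (carrier (Zfree r)) \<and>
     Q ` carrier (Zfree r) = kernel (Zfree (d + r)) N p \<and>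
     p ` carrier (Zfree (d + r)) = carrier N"

definition is_lift ::
    "nat \<Rightarrow> nat \<Rightarrow> ((nat \<Rightarrow>\<^sub>0 int) \<Rightarrow> 'a) \<Rightarrow> ((nat \<Rightarrow>\<^sub>0 int) \<Rightarrow> 'a) \<Rightarrow>
     ((nat \<Rightarrow>\<^sub>0 int) \<Rightarrow> (nat \<Rightarrow>\<^sub>0 int)) \<Rightarrow> bool" where
  "is_lift n m p \<beta> B \<longleftrightarrow>
     B \<in> hom (Zfree n) (Zfree m) \<and> (\<forall>x \<in> carrier (Zfree n). p (B x) = \<beta> x)"

text \<open>\<open>Z^(n+r)\<close> is taken as \<open>Z^n \<times> Z^r\<close>. The subgroup below is the image of \<open>[B,Q]\<^sup>*\<close>, where
  \<open>[B,Q](x,y) = B x + Q y\<close>; here \<open>m = d + r\<close>.\<close>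

definition BQ_dual_image ::
    "nat \<Rightarrow> nat \<Rightarrow> nat \<Rightarrow> ((nat \<Rightarrow>\<^sub>0 int) \<Rightarrow> (nat \<Rightarrow>\<^sub>0 int)) \<Rightarrow> ((nat \<Rightarrow>\<^sub>0 int) \<Rightarrow> (nat \<Rightarrow>\<^sub>0 int)) \<Rightarrow>
     ((nat \<Rightarrow>\<^sub>0 int) \<times> (nat \<Rightarrow>\<^sub>0 int) \<Rightarrow> int) set" where
  "BQ_dual_image n r m B Q =
     (\<lambda>\<phi>. \<lambda>(x, y) \<in> carrier (Zfree n \<times>\<times> Zfree r). \<phi> (B x \<otimes>\<^bsub>Zfree m\<^esub> Q y)) `
       carrier (dual_group (Zfree m))"

definition gale_dual ::
    "nat \<Rightarrow> nat \<Rightarrow> nat \<Rightarrow> ((nat \<Rightarrow>\<^sub>0 int) \<Rightarrow> (nat \<Rightarrow>\<^sub>0 int)) \<Rightarrow> ((nat \<Rightarrow>\<^sub>0 int) \<Rightarrow> (nat \<Rightarrow>\<^sub>0 int)) \<Rightarrow>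
     ((nat \<Rightarrow>\<^sub>0 int) \<times> (nat \<Rightarrow>\<^sub>0 int) \<Rightarrow> int) set monoid" where
  "gale_dual n r m B Q = dual_group (Zfree n \<times>\<times> Zfree r) Mod BQ_dual_image n r m B Q"

definition gale_dual_map ::
    "nat \<Rightarrow> nat \<Rightarrow> nat \<Rightarrow> ((nat \<Rightarrow>\<^sub>0 int) \<Rightarrow> (nat \<Rightarrow>\<^sub>0 int)) \<Rightarrow> ((nat \<Rightarrow>\<^sub>0 int) \<Rightarrow> (nat \<Rightarrow>\<^sub>0 int)) \<Rightarrow>
     ((nat \<Rightarrow>\<^sub>0 int) \<Rightarrow> int) \<Rightarrow> ((nat \<Rightarrow>\<^sub>0 int) \<times> (nat \<Rightarrow>\<^sub>0 int) \<Rightarrow> int) set" where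
  "gale_dual_map n r m B Q \<xi> =
     BQ_dual_image n r m B Q #>\<^bsub>dual_group (Zfree n \<times>\<times> Zfree r)\<^esub>
       (\<lambda>(x, y) \<in> carrier (Zfree n \<times>\<times> Zfree r). \<xi> x)"

definition dual_basis :: "nat \<Rightarrow> nat \<Rightarrow> (nat \<Rightarrow>\<^sub>0 int) \<Rightarrow> int" where
  "dual_basis n i = (\<lambda>x \<in> carrier (Zfree n). Poly_Mapping.lookup x i)"


section \<open>Varieties as sets with coordinate functions\<close>

text \<open>A (classical, complex) quasi-affine variety is a set \<open>X\<close> of points together with a set \<open>C\<close> of
  coordinate functions. Only the restrictions of the functions to \<open>X\<close> matter in what follows.\<close>

inductive_set poly_funs :: "('x \<Rightarrow> complex) set \<Rightarrow> ('x \<Rightarrow> complex) set"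
  for C :: "('x \<Rightarrow> complex) set" where
  const: "(\<lambda>_. a) \<in> poly_funs C"
| coord: "f \<in> C \<Longrightarrow> f \<in> poly_funs C"
| add: "f \<in> poly_funs C \<Longrightarrow> g \<in> poly_funs C \<Longrightarrow> (\<lambda>x. f x + g x) \<in> poly_funs C"
| mult: "f \<in> poly_funs C \<Longrightarrow> g \<in> poly_funs C \<Longrightarrow> (\<lambda>x. f x * g x) \<in> poly_funs C"

definition poly_fun_ring :: "('x \<Rightarrow> complex) set \<Rightarrow> ('x \<Rightarrow> complex) ring" where
  "poly_fun_ring C =
     \<lparr>carrier = poly_funs C, monoid.mult = (\<lambda>f g x. f x * g x), one = (\<lambda>_. 1),
      ring.zero = (\<lambda>_. 0), ring.add = (\<lambda>f g x. f x + g x)\<rparr>"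

definition vanishing_locus :: "'x set \<Rightarrow> ('x \<Rightarrow> complex) set \<Rightarrow> 'x set" where
  "vanishing_locus X J = {x \<in> X. \<forall>f\<in>J. f x = 0}"

definition zariski_open :: "'x set \<Rightarrow> ('x \<Rightarrow> complex) set \<Rightarrow> 'x set \<Rightarrow> bool" where
  "zariski_open X C U \<longleftrightarrow> (\<exists>S \<subseteq> poly_funs C. U = X - vanishing_locus X S)"

definition regular_on ::
    "'x set \<Rightarrow> ('x \<Rightarrow> complex) set \<Rightarrow> 'x set \<Rightarrow> ('x \<Rightarrow> complex) \<Rightarrow> bool" where
  "regular_on X C U f \<longleftrightarrow>
     (\<forall>x\<in>U. \<exists>W. zariski_open X C W \<and> x \<in> W \<and> W \<subseteq> U \<and>
        (\<exists>p \<in> poly_funs C. \<exists>q \<in> poly_funs C. \<forall>y\<in>W. q y \<noteq> 0 \<and> f y = p y / q y))"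

definition prod_coords ::
    "('x \<Rightarrow> complex) set \<Rightarrow> ('y \<Rightarrow> complex) set \<Rightarrow> ('x \<times> 'y \<Rightarrow> complex) set" where
  "prod_coords C D = {\<lambda>w. f (fst w) | f. f \<in> C} \<union> {\<lambda>w. f (snd w) | f. f \<in> D}"


section \<open>Equivariant line bundles\<close>

text \<open>An algebraic group \<open>grp\<close> with coordinate functions \<open>grp_coords\<close> acting on the variety
  \<open>(points, coords)\<close>.\<close>

record ('g, 'x) gvariety =
  points :: "'x set"
  coords :: "('x \<Rightarrow> complex) set"
  grp :: "'g monoid"
  grp_coords :: "('g \<Rightarrow> complex) set"
  action :: "'g \<Rightarrow> 'x \<Rightarrow> 'x"

text \<open>A geometric line bundle: a chart \<open>(U, \<phi>)\<close> stands for the local trivialization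
  \<open>e \<mapsto> (proj e, \<phi> e)\<close> from \<open>proj -` U\<close> to \<open>U \<times> \<complex>\<close>. The linear structure of the fibres is the one
  transported by the charts, hence not a separate component.\<close>

record ('g, 'x, 'e) line_bundle =
  total :: "'e set"
  proj :: "'e \<Rightarrow> 'x"
  charts :: "('x set \<times> ('e \<Rightarrow> complex)) set"
  bundle_action :: "'g \<Rightarrow> 'e \<Rightarrow> 'e"

definition is_line_bundle :: "('g, 'x) gvariety \<Rightarrow> ('g, 'x, 'e) line_bundle \<Rightarrow> bool" where
  "is_line_bundle X L \<longleftrightarrow>
     proj L ` total L \<subseteq> points X \<and>
     points X = (\<Union>(U, \<phi>) \<in> charts L. U) \<and>
     (\<forall>(U, \<phi>) \<in> charts L. zariski_open (points X) (coords X) U \<and>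
        bij_betw (\<lambda>e. (proj L e, \<phi> e)) {e \<in> total L. proj L e \<in> U} (U \<times> UNIV)) \<and>
     (\<forall>(U, \<phi>) \<in> charts L. \<forall>(V, \<psi>) \<in> charts L.
        \<exists>f. regular_on (points X) (coords X) (U \<inter> V) f \<and>
            (\<forall>e \<in> total L. proj L e \<in> U \<inter> V \<longrightarrow> \<psi> e = f (proj L e) * \<phi> e))"

text \<open>An equivariant structure is a lift of the group action to the total space which is linear on
  the fibres and algebraic, i.e. given in charts by regular functions on open subsets of the product
  of the group and the base.\<close>

definition is_equivariant_line_bundle ::
    "('g, 'x) gvariety \<Rightarrow> ('g, 'x, 'e) line_bundle \<Rightarrow> bool" where
  "is_equivariant_line_bundle X L \<longleftrightarrow>
     is_line_bundle X L \<and>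
     group_action (grp X) (total L) (bundle_action L) \<and>
     (\<forall>g \<in> carrier (grp X). \<forall>e \<in> total L. proj L (bundle_action L g e) = action X g (proj L e)) \<and>
     (\<forall>(U, \<phi>) \<in> charts L. \<forall>(V, \<psi>) \<in> charts L.
        \<exists>a. regular_on (carrier (grp X) \<times> points X) (prod_coords (grp_coords X) (coords X))
              {(g, x). g \<in> carrier (grp X) \<and> x \<in> U \<and> action X g x \<in> V} a \<and>
            (\<forall>g \<in> carrier (grp X). \<forall>e \<in> total L.
               proj L e \<in> U \<and> action X g (proj L e) \<in> V \<longrightarrow>
               \<psi> (bundle_action L g e) = a (g, proj L e) * \<phi> e))"

definition bundle_iso ::
    "('g, 'x) gvariety \<Rightarrow> ('g, 'x, 'e) line_bundle \<Rightarrow> ('g, 'x, 'f) line_bundle \<Rightarrow>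
     ('e \<Rightarrow> 'f) \<Rightarrow> bool" where
  "bundle_iso X L M F \<longleftrightarrow>
     bij_betw F (total L) (total M) \<and>
     (\<forall>e \<in> total L. proj M (F e) = proj L e) \<and>
     (\<forall>(U, \<phi>) \<in> charts L. \<forall>(V, \<psi>) \<in> charts M.
        \<exists>f. regular_on (points X) (coords X) (U \<inter> V) f \<and>
            (\<forall>e \<in> total L. proj L e \<in> U \<inter> V \<longrightarrow> \<psi> (F e) = f (proj L e) * \<phi> e)) \<and>
     (\<forall>g \<in> carrier (grp X). \<forall>e \<in> total L.
        F (bundle_action L g e) = bundle_action M g (F e))"

definition bundles_isomorphic ::
    "('g, 'x) gvariety \<Rightarrow> ('g, 'x, 'e) line_bundle \<Rightarrow> ('g, 'x, 'f) line_bundle \<Rightarrow> bool" where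
  "bundles_isomorphic X L M \<longleftrightarrow> (\<exists>F. bundle_iso X L M F)"

text \<open>\<open>K\<close> is a tensor product of \<open>L\<close> and \<open>M\<close> via the pairing \<open>T\<close>: a fibrewise bilinear, nowhere
  degenerate, regular and equivariant map from the fibre product of \<open>L\<close> and \<open>M\<close> to \<open>K\<close>. As the
  fibres are lines, such a pairing is the same as an isomorphism of \<open>L \<otimes> M\<close> with \<open>K\<close>.\<close>

definition tensor_pairing ::
    "('g, 'x) gvariety \<Rightarrow> ('g, 'x, 'e) line_bundle \<Rightarrow> ('g, 'x, 'f) line_bundle \<Rightarrow>
     ('g, 'x, 'h) line_bundle \<Rightarrow> ('e \<Rightarrow> 'f \<Rightarrow> 'h) \<Rightarrow> bool" where
  "tensor_pairing X L M K T \<longleftrightarrow>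
     (\<forall>e \<in> total L. \<forall>e' \<in> total M. proj L e = proj M e' \<longrightarrow>
        T e e' \<in> total K \<and> proj K (T e e') = proj L e) \<and>
     (\<forall>(U, \<phi>) \<in> charts L. \<forall>(V, \<psi>) \<in> charts M. \<forall>(W, \<chi>) \<in> charts K.
        \<exists>f. regular_on (points X) (coords X) (U \<inter> V \<inter> W) f \<and> (\<forall>x \<in> U \<inter> V \<inter> W. f x \<noteq> 0) \<and>
            (\<forall>e \<in> total L. \<forall>e' \<in> total M. proj L e = proj M e' \<and> proj L e \<in> U \<inter> V \<inter> W \<longrightarrow>
               \<chi> (T e e') = f (proj L e) * \<phi> e * \<psi> e')) \<and>
     (\<forall>g \<in> carrier (grp X). \<forall>e \<in> total L. \<forall>e' \<in> total M. proj L e = proj M e' \<longrightarrow>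
        T (bundle_action L g e) (bundle_action M g e') = bundle_action K g (T e e'))"

text \<open>As HOL has no type of all sets, the line bundles that make up the Picard group have their total
  space inside the type \<open>'x \<times> complex\<close>; lemma \<open>equivariant_line_bundle_transport\<close> below shows
  that up to isomorphism this is no restriction.\<close>

definition line_bundles :: "('g, 'x) gvariety \<Rightarrow> ('g, 'x, 'x \<times> complex) line_bundle set" where
  "line_bundles X = {L. is_equivariant_line_bundle X L}"

definition trivial_bundle :: "('g, 'x) gvariety \<Rightarrow> ('g, 'x, 'x \<times> complex) line_bundle" where
  "trivial_bundle X =
     \<lparr>total = points X \<times> UNIV, proj = fst, charts = {(points X, snd)},
      bundle_action = (\<lambda>g. \<lambda>(x, c) \<in> points X \<times> UNIV. (action X g x, c))\<rparr>"

definition iso_class ::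
    "('g, 'x) gvariety \<Rightarrow> ('g, 'x, 'x \<times> complex) line_bundle \<Rightarrow>
     ('g, 'x, 'x \<times> complex) line_bundle set" where
  "iso_class X L = {M \<in> line_bundles X. bundles_isomorphic X L M}"

definition Pic :: "('g, 'x) gvariety \<Rightarrow> ('g, 'x, 'x \<times> complex) line_bundle set monoid" where
  "Pic X =
     \<lparr>carrier = iso_class X ` line_bundles X,
      monoid.mult = (\<lambda>\<L> \<M>. {K \<in> line_bundles X. \<exists>L\<in>\<L>. \<exists>M\<in>\<M>. \<exists>T. tensor_pairing X L M K T}),
      one = iso_class X (trivial_bundle X)\<rparr>"

lemma equivariant_line_bundle_transport:
  fixes X :: "('g, 'x) gvariety" and L :: "('g, 'x, 'e) line_bundle"
  assumes L: "is_equivariant_line_bundle X L"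
  shows "\<exists>M \<in> line_bundles X. bundles_isomorphic X L M"
proof -
  define k where "k z = (SOME c. c \<in> charts L \<and> z \<in> fst c)" for z
  define F where "F e = (proj L e, snd (k (proj L e)) e)" for e
  define T where "T = total L"
  define H where "H = inv_into T F"
  define M :: "('g, 'x, 'x \<times> complex) line_bundle" where
    "M = \<lparr>total = F ` T, proj = fst, charts = (\<lambda>(U, \<phi>). (U, \<phi> \<circ> H)) ` charts L,
          bundle_action = (\<lambda>g. \<lambda>m \<in> F ` T. F (bundle_action L g (H m)))\<rparr>"
  have lb: "is_line_bundle X L" and ga: "group_action (grp X) T (bundle_action L)"
    and pa: "\<And>g e. g \<in> carrier (grp X) \<Longrightarrow> e \<in> T \<Longrightarrow>
               proj L (bundle_action L g e) = action X g (proj L e)"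
    using L by (auto simp: is_equivariant_line_bundle_def T_def)
  have pts: "proj L e \<in> points X" if "e \<in> T" for e
    using lb that by (auto simp: is_line_bundle_def T_def)
  have cover: "points X = (\<Union>(U, \<phi>) \<in> charts L. U)"
    using lb by (simp add: is_line_bundle_def)
  have chart: "zariski_open (points X) (coords X) U"
      "bij_betw (\<lambda>e. (proj L e, \<phi> e)) {e \<in> T. proj L e \<in> U} (U \<times> UNIV)"
    if "(U, \<phi>) \<in> charts L" for U \<phi>
    using lb that by (auto simp: is_line_bundle_def T_def)
  have trans: "\<exists>f. regular_on (points X) (coords X) (U \<inter> V) f \<and>
            (\<forall>e \<in> T. proj L e \<in> U \<inter> V \<longrightarrow> \<psi> e = f (proj L e) * \<phi> e)"
    if "(U, \<phi>) \<in> charts L" "(V, \<psi>) \<in> charts L" for U \<phi> V \<psi>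
  proof -
    have "\<forall>(U, \<phi>) \<in> charts L. \<forall>(V, \<psi>) \<in> charts L.
        \<exists>f. regular_on (points X) (coords X) (U \<inter> V) f \<and>
            (\<forall>e \<in> T. proj L e \<in> U \<inter> V \<longrightarrow> \<psi> e = f (proj L e) * \<phi> e)"
      using lb unfolding is_line_bundle_def T_def by (elim conjE)
    from bspec[OF bspec[OF this that(1), unfolded prod.case] that(2), unfolded prod.case]
    show ?thesis .
  qed
  have acts: "\<exists>a. regular_on (carrier (grp X) \<times> points X) (prod_coords (grp_coords X) (coords X))
              {(g, x). g \<in> carrier (grp X) \<and> x \<in> U \<and> action X g x \<in> V} a \<and>
            (\<forall>g \<in> carrier (grp X). \<forall>e \<in> T.
               proj L e \<in> U \<and> action X g (proj L e) \<in> V \<longrightarrow>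
               \<psi> (bundle_action L g e) = a (g, proj L e) * \<phi> e)"
    if "(U, \<phi>) \<in> charts L" "(V, \<psi>) \<in> charts L" for U \<phi> V \<psi>
  proof -
    have "\<forall>(U, \<phi>) \<in> charts L. \<forall>(V, \<psi>) \<in> charts L.
        \<exists>a. regular_on (carrier (grp X) \<times> points X) (prod_coords (grp_coords X) (coords X))
              {(g, x). g \<in> carrier (grp X) \<and> x \<in> U \<and> action X g x \<in> V} a \<and>
            (\<forall>g \<in> carrier (grp X). \<forall>e \<in> T.
               proj L e \<in> U \<and> action X g (proj L e) \<in> V \<longrightarrow>
               \<psi> (bundle_action L g e) = a (g, proj L e) * \<phi> e)"
      using L unfolding is_equivariant_line_bundle_def T_def by (elim conjE)
    from bspec[OF bspec[OF this that(1), unfolded prod.case] that(2), unfolded prod.case]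
    show ?thesis .
  qed
  have k: "k z \<in> charts L \<and> z \<in> fst (k z)" if "z \<in> points X" for z
  proof -
    have "\<exists>c. c \<in> charts L \<and> z \<in> fst c" using that cover by force
    then show ?thesis unfolding k_def by (rule someI_ex)
  qed
  have inj: "inj_on F T"
  proof (rule inj_onI)
    fix e e' assume e: "e \<in> T" "e' \<in> T" and eq: "F e = F e'"
    obtain U \<phi> where c: "k (proj L e) = (U, \<phi>)" by fastforce
    have UC: "(U, \<phi>) \<in> charts L" "proj L e \<in> U" using k[OF pts[OF e(1)]] c by auto
    have "proj L e' = proj L e" "\<phi> e' = \<phi> e" using eq c by (auto simp: F_def)
    then show "e = e'"
      using chart(2)[OF UC(1)] UC(2) e unfolding bij_betw_def inj_on_def by auto
  qed
  have HF [simp]: "H (F e) = e" if "e \<in> T" for e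
    using inj that by (simp add: H_def)
  have fstF [simp]: "fst (F e) = proj L e" for e by (simp add: F_def)
  have act: "bundle_action L g e \<in> T" if "g \<in> carrier (grp X)" "e \<in> T" for g e
    using group_action.element_image[OF ga that(1) that(2) refl] .
  have Msel [simp]: "total M = F ` T" "proj M = fst"
      "charts M = (\<lambda>(U, \<phi>). (U, \<phi> \<circ> H)) ` charts L"
      "bundle_action M = (\<lambda>g. \<lambda>m \<in> F ` T. F (bundle_action L g (H m)))"
    by (simp_all add: M_def)
  have bij: "bij_betw (\<lambda>m. (fst m, (\<phi> \<circ> H) m)) {m \<in> F ` T. fst m \<in> U} (U \<times> UNIV)"
    if "(U, \<phi>) \<in> charts L" for U \<phi>
  proof -
    have "bij_betw F {e \<in> T. proj L e \<in> U} {m \<in> F ` T. fst m \<in> U}"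
      using inj by (auto simp: bij_betw_def inj_on_def)
    moreover have "bij_betw ((\<lambda>m. (fst m, (\<phi> \<circ> H) m)) \<circ> F) {e \<in> T. proj L e \<in> U} (U \<times> UNIV)"
      using chart(2)[OF that] by (subst bij_betw_cong[of _ _ "\<lambda>e. (proj L e, \<phi> e)"]) auto
    ultimately show ?thesis by (simp add: bij_betw_comp_iff)
  qed
  have Mlb: "is_line_bundle X M"
    unfolding is_line_bundle_def
  proof (intro conjI)
    show "proj M ` total M \<subseteq> points X" using pts by auto
    show "points X = (\<Union>(U, \<phi>) \<in> charts M. U)" by (simp add: cover split_beta)
    show "\<forall>(U, \<phi>) \<in> charts M. zariski_open (points X) (coords X) U \<and>
        bij_betw (\<lambda>e. (proj M e, \<phi> e)) {e \<in> total M. proj M e \<in> U} (U \<times> UNIV)"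
      using chart(1) bij by auto
    show "\<forall>(U, \<phi>) \<in> charts M. \<forall>(V, \<psi>) \<in> charts M.
        \<exists>f. regular_on (points X) (coords X) (U \<inter> V) f \<and>
            (\<forall>e \<in> total M. proj M e \<in> U \<inter> V \<longrightarrow> \<psi> e = f (proj M e) * \<phi> e)"
      using trans by (simp add: split_beta)
  qed
  have grpG: "group (grp X)" using ga by (simp add: group_action_def group_hom_def)
  have "group_action (grp X) (F ` T) (bundle_action M)"
    unfolding group_action_def group_hom_def group_hom_axioms_def
  proof (intro conjI homI)
    show "group (grp X)" by (rule grpG)
    show "group (BijGroup (F ` T))" by (rule group_BijGroup)
    have bijT: "bij_betw (bundle_action L g) T T" if "g \<in> carrier (grp X)" for g
      using group_action.bij_prop0[OF ga that] by (simp add: Bij_def)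
    show B: "bundle_action M g \<in> carrier (BijGroup (F ` T))" if "g \<in> carrier (grp X)" for g
    proof -
      have "bij_betw (F \<circ> (bundle_action L g \<circ> H)) (F ` T) (F ` T)"
        using inj bijT[OF that]
        by (intro bij_betw_trans[of _ _ T] bij_betw_trans[of H _ T])
           (auto simp: H_def bij_betw_inv_into inj_on_imp_bij_betw)
      then have "bij_betw (bundle_action M g) (F ` T) (F ` T)"
        by (subst bij_betw_cong[of _ _ "F \<circ> (bundle_action L g \<circ> H)"]) auto
      then show ?thesis by (simp add: BijGroup_def Bij_def)
    qed
    show "bundle_action M (g \<otimes>\<^bsub>grp X\<^esub> h) =
        bundle_action M g \<otimes>\<^bsub>BijGroup (F ` T)\<^esub> bundle_action M h"
      if gh: "g \<in> carrier (grp X)" "h \<in> carrier (grp X)" for g h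
    proof -
      have "bundle_action L (g \<otimes>\<^bsub>grp X\<^esub> h) e = bundle_action L g (bundle_action L h e)"
        if "e \<in> T" for e
        using group_action.composition_rule[OF ga that gh] .
      then show ?thesis
        using B[OF gh(1)] B[OF gh(2)] act[OF gh(2)]
        by (auto simp: BijGroup_def compose_def fun_eq_iff restrict_def inj_on_eq_iff[OF inj])
    qed
  qed
  then have "is_equivariant_line_bundle X M"
    unfolding is_equivariant_line_bundle_def
  proof (intro conjI)
    show "\<forall>(U, \<phi>) \<in> charts M. \<forall>(V, \<psi>) \<in> charts M.
        \<exists>a. regular_on (carrier (grp X) \<times> points X) (prod_coords (grp_coords X) (coords X))
              {(g, x). g \<in> carrier (grp X) \<and> x \<in> U \<and> action X g x \<in> V} a \<and>
            (\<forall>g \<in> carrier (grp X). \<forall>e \<in> total M.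
               proj M e \<in> U \<and> action X g (proj M e) \<in> V \<longrightarrow>
               \<psi> (bundle_action M g e) = a (g, proj M e) * \<phi> e)"
      using acts act by (simp add: split_beta)
  qed (use Mlb act pa in auto)
  moreover have "bundle_iso X L M F"
    unfolding bundle_iso_def
  proof (intro conjI)
    show "bij_betw F (total L) (total M)" using inj by (simp add: T_def inj_on_imp_bij_betw)
    show "\<forall>(U, \<phi>) \<in> charts L. \<forall>(V, \<psi>) \<in> charts M.
        \<exists>f. regular_on (points X) (coords X) (U \<inter> V) f \<and>
            (\<forall>e \<in> total L. proj L e \<in> U \<inter> V \<longrightarrow> \<psi> (F e) = f (proj L e) * \<phi> e)"
      using trans by (simp add: split_beta flip: T_def)
  qed (auto simp flip: T_def)
  ultimately show ?thesis by (auto simp: line_bundles_def bundles_isomorphic_def)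
qed

lemma cring_poly_fun_ring: "cring (poly_fun_ring C)"
proof -
  have uminus: "(\<lambda>x. - f x) \<in> poly_funs C" if "f \<in> poly_funs C" for f
    using poly_funs.mult[OF poly_funs.const[of "-1"] that] by simp
  have A: "abelian_group (poly_fun_ring C)"
  proof (rule abelian_groupI)
    fix f assume "f \<in> carrier (poly_fun_ring C)"
    then show "\<exists>g\<in>carrier (poly_fun_ring C). g \<oplus>\<^bsub>poly_fun_ring C\<^esub> f = \<zero>\<^bsub>poly_fun_ring C\<^esub>"
      using uminus[of f] by (intro bexI[of _ "\<lambda>x. - f x"]) (auto simp: poly_fun_ring_def)
  qed (auto simp: poly_fun_ring_def algebra_simps intro: poly_funs.intros)
  have M: "Group.comm_monoid (poly_fun_ring C)"
    by (rule comm_monoidI) (auto simp: poly_fun_ring_def algebra_simps intro: poly_funs.intros)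
  show ?thesis
    by (rule cringI[OF A M]) (auto simp: poly_fun_ring_def algebra_simps)
qed


section \<open>The toric Deligne-Mumford stack\<close>

definition affine_space :: "nat \<Rightarrow> (nat \<Rightarrow> complex) set" where
  "affine_space n = {..<n} \<rightarrow>\<^sub>E UNIV"

definition affine_coords :: "nat \<Rightarrow> ((nat \<Rightarrow> complex) \<Rightarrow> complex) set" where
  "affine_coords n = {\<lambda>z. z i | i. i < n}"

definition J_ideal ::
    "('a, 'm) monoid_scheme \<Rightarrow> nat \<Rightarrow> ('a \<times> rat \<Rightarrow>\<^sub>0 int) set set set \<Rightarrow>
     ((nat \<Rightarrow>\<^sub>0 int) \<Rightarrow> 'a) \<Rightarrow> ((nat \<Rightarrow> complex) \<Rightarrow> complex) set" where
  "J_ideal N n \<Sigma> \<beta> = Idl\<^bsub>poly_fun_ring (affine_coords n)\<^esub>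
     {\<lambda>z. \<Prod>i \<in> {i. i < n \<and> \<not> stacky_ray N \<beta> i \<subseteq> \<sigma>}. z i | \<sigma>. \<sigma> \<in> \<Sigma>}"

definition Z_variety ::
    "('a, 'm) monoid_scheme \<Rightarrow> nat \<Rightarrow> ('a \<times> rat \<Rightarrow>\<^sub>0 int) set set set \<Rightarrow>
     ((nat \<Rightarrow>\<^sub>0 int) \<Rightarrow> 'a) \<Rightarrow> (nat \<Rightarrow> complex) set" where
  "Z_variety N n \<Sigma> \<beta> = affine_space n - vanishing_locus (affine_space n) (J_ideal N n \<Sigma> \<beta>)"

definition complex_units :: "complex monoid" where
  "complex_units = \<lparr>carrier = - {0}, monoid.mult = (*), one = 1\<rparr>"

definition stack_group ::
    "nat \<Rightarrow> nat \<Rightarrow> nat \<Rightarrow> ((nat \<Rightarrow>\<^sub>0 int) \<Rightarrow> (nat \<Rightarrow>\<^sub>0 int)) \<Rightarrow> ((nat \<Rightarrow>\<^sub>0 int) \<Rightarrow> (nat \<Rightarrow>\<^sub>0 int)) \<Rightarrow>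
     (((nat \<Rightarrow>\<^sub>0 int) \<times> (nat \<Rightarrow>\<^sub>0 int) \<Rightarrow> int) set \<Rightarrow> complex) monoid" where
  "stack_group n r m B Q = hom_group (gale_dual n r m B Q) complex_units"

text \<open>\<open>\<alpha>\<close> is precomposition with \<open>\<beta>\<^sup>\<or>\<close>, where \<open>Hom((Z^n)\<^sup>*, \<complex>\<^sup>*)\<close> is identified with \<open>(\<complex>\<^sup>*)^n\<close>
  by evaluation on the dual basis.\<close>

definition alpha ::
    "nat \<Rightarrow> nat \<Rightarrow> nat \<Rightarrow> ((nat \<Rightarrow>\<^sub>0 int) \<Rightarrow> (nat \<Rightarrow>\<^sub>0 int)) \<Rightarrow> ((nat \<Rightarrow>\<^sub>0 int) \<Rightarrow> (nat \<Rightarrow>\<^sub>0 int)) \<Rightarrow>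
     (((nat \<Rightarrow>\<^sub>0 int) \<times> (nat \<Rightarrow>\<^sub>0 int) \<Rightarrow> int) set \<Rightarrow> complex) \<Rightarrow> nat \<Rightarrow> complex" where
  "alpha n r m B Q g = (\<lambda>i \<in> {..<n}. g (gale_dual_map n r m B Q (dual_basis n i)))"

text \<open>\<open>G = Hom(N\<^sup>\<or>, \<complex>\<^sup>*)\<close> is the spectrum of the group algebra of \<open>N\<^sup>\<or>\<close>, so its coordinate
  functions are the evaluations at the elements of \<open>N\<^sup>\<or>\<close>.\<close>

definition toric_stack ::
    "('a, 'm) monoid_scheme \<Rightarrow> nat \<Rightarrow> nat \<Rightarrow> ('a \<times> rat \<Rightarrow>\<^sub>0 int) set set set \<Rightarrow>
     ((nat \<Rightarrow>\<^sub>0 int) \<Rightarrow> 'a) \<Rightarrow> nat \<Rightarrow>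
     ((nat \<Rightarrow>\<^sub>0 int) \<Rightarrow> (nat \<Rightarrow>\<^sub>0 int)) \<Rightarrow> ((nat \<Rightarrow>\<^sub>0 int) \<Rightarrow> (nat \<Rightarrow>\<^sub>0 int)) \<Rightarrow>
     (((nat \<Rightarrow>\<^sub>0 int) \<times> (nat \<Rightarrow>\<^sub>0 int) \<Rightarrow> int) set \<Rightarrow> complex, nat \<Rightarrow> complex) gvariety" where
  "toric_stack N d n \<Sigma> \<beta> r B Q =
     \<lparr>points = Z_variety N n \<Sigma> \<beta>,
      coords = affine_coords n,
      grp = stack_group n r (d + r) B Q,
      grp_coords = {\<lambda>g. g u | u. u \<in> carrier (gale_dual n r (d + r) B Q)},
      action = (\<lambda>g z. \<lambda>i \<in> {..<n}. alpha n r (d + r) B Q g i * z i)\<rparr>"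

end

theory Submission
  imports Defs "HOL-Computational_Algebra.Fundamental_Theorem_Algebra"
begin

text \<open>The variety \<open>Z\<close> is the complement of a closed set of codimension at least two in affine
  space, since it contains every point with at most one vanishing coordinate. As the polynomial ring
  is factorial, every line bundle on \<open>Z\<close> is trivial, and the nowhere vanishing regular functions on
  \<open>Z\<close> are constant. So a \<open>G\<close>-equivariant line bundle has a nowhere vanishing section, unique up to a
  scalar, on which \<open>G\<close> acts through a regular character, and this character determines the bundle up
  to isomorphism. Finally the regular characters of \<open>G = Hom(N\<^sup>\<or>, \<complex>\<^sup>*)\<close> are exactly the evaluations
  at the elements of \<open>N\<^sup>\<or>\<close>: they separate these elements since \<open>\<complex>\<^sup>*\<close> is divisible, and there are no
  others since distinct characters are linearly independent.\<close>

section \<open>Polynomials over a factorial ring\<close>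

text \<open>Line bundles on \<open>Z\<close> are trivialized without divisors or cohomology. A
  cocycle is a coboundary on some principal open set g \<noteq> 0, and the prime factors of g are
  removed one at a time by multiplying the trivialization with a power of the prime. Two facts make
  this work. By unique factorization, a regular function on an open set is one fraction in lowest
  terms whose denominator has no zeros there, so that zeros and poles show in single polynomials. By
  the Nullstellensatz for hypersurfaces, a polynomial that vanishes wherever a prime w vanishes is
  divisible by w; hence w = 0 is irreducible, and two charts that meet it meet each other on it.
  This is one place where the fundamental theorem of algebra enters; the units are the other:
  coordinate lines through points of the torus stay in \<open>Z\<close>, and a polynomial without
  zeros on \<open>Z\<close> is constant along them. On the side of the group,
  \<open>gale_dual\<close> may have torsion and \<open>G\<close> may be disconnected. Characters are
  therefore treated for arbitrary abelian groups.\<close>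

definition is_subring :: "'a::comm_ring_1 set \<Rightarrow> bool" where
  "is_subring R \<longleftrightarrow> 1 \<in> R \<and> (\<forall>a\<in>R. \<forall>b\<in>R. a + b \<in> R \<and> a * b \<in> R \<and> - a \<in> R)"

text \<open>The cofactor has to lie in \<open>R\<close>: a divisor or a unit of the ambient ring
  need not be one of \<open>R\<close>.\<close>

definition dvd_in :: "'a::comm_ring_1 set \<Rightarrow> 'a \<Rightarrow> 'a \<Rightarrow> bool" where
  "dvd_in R a b \<longleftrightarrow> (\<exists>c\<in>R. b = a * c)"

definition prime_in :: "'a::comm_ring_1 set \<Rightarrow> 'a \<Rightarrow> bool" where
  "prime_in R p \<longleftrightarrow> p \<in> R \<and> p \<noteq> 0 \<and> \<not> dvd_in R p 1 \<and>
     (\<forall>a\<in>R. \<forall>b\<in>R. dvd_in R p (a * b) \<longrightarrow> dvd_in R p a \<or> dvd_in R p b)"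

text \<open>The number \<open>k\<close> of prime factors serves as an induction measure, since
  cancelling a prime lowers it by one.\<close>

inductive prime_product :: "'a::comm_ring_1 set \<Rightarrow> nat \<Rightarrow> 'a \<Rightarrow> bool" for R where
  unit: "u \<in> R \<Longrightarrow> dvd_in R u 1 \<Longrightarrow> prime_product R 0 u"
| step: "prime_product R k f \<Longrightarrow> prime_in R p \<Longrightarrow> prime_product R (Suc k) (p * f)"

text \<open>Existence of the factorizations is enough: factorizations into primes, as opposed to
  irreducible elements, are automatically unique up to units.\<close>

definition is_ufd :: "'a::comm_ring_1 set \<Rightarrow> bool" where
  "is_ufd R \<longleftrightarrow> is_subring R \<and> (\<forall>f\<in>R. f \<noteq> 0 \<longrightarrow> (\<exists>k. prime_product R k f))"

lemma subringD:
  assumes "is_subring R"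
  shows subring_one: "1 \<in> R" and subring_zero: "0 \<in> R"
    and subring_add: "a \<in> R \<Longrightarrow> b \<in> R \<Longrightarrow> a + b \<in> R"
    and subring_mult: "a \<in> R \<Longrightarrow> b \<in> R \<Longrightarrow> a * b \<in> R"
    and subring_uminus: "a \<in> R \<Longrightarrow> - a \<in> R"
    and subring_diff: "a \<in> R \<Longrightarrow> b \<in> R \<Longrightarrow> a - b \<in> R"
proof -
  show one: "1 \<in> R" using assms by (simp add: is_subring_def)
  show um: "\<And>a. a \<in> R \<Longrightarrow> - a \<in> R" using assms by (simp add: is_subring_def)
  show ad: "\<And>a b. a \<in> R \<Longrightarrow> b \<in> R \<Longrightarrow> a + b \<in> R" using assms by (simp add: is_subring_def)
  show "a \<in> R \<Longrightarrow> b \<in> R \<Longrightarrow> a * b \<in> R" using assms by (simp add: is_subring_def)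
  show "0 \<in> R" using ad[OF one um[OF one]] by simp
  show "a \<in> R \<Longrightarrow> b \<in> R \<Longrightarrow> a - b \<in> R" using ad[OF _ um] by force
qed

lemma subring_sum: "is_subring R \<Longrightarrow> (\<And>i. i \<in> I \<Longrightarrow> f i \<in> R) \<Longrightarrow> sum f I \<in> R"
  by (induction I rule: infinite_finite_induct) (auto simp: subringD)

lemma subring_power: "is_subring R \<Longrightarrow> a \<in> R \<Longrightarrow> a ^ k \<in> R"
  by (induction k) (auto simp: subringD)

lemma dvd_inI: "c \<in> R \<Longrightarrow> b = a * c \<Longrightarrow> dvd_in R a b"
  by (auto simp: dvd_in_def)

lemma dvd_in_trans: "is_subring R \<Longrightarrow> dvd_in R a b \<Longrightarrow> dvd_in R b c \<Longrightarrow> dvd_in R a c"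
  unfolding dvd_in_def by (metis mult.assoc subring_mult)

lemma dvd_in_mult: "is_subring R \<Longrightarrow> dvd_in R a b \<Longrightarrow> c \<in> R \<Longrightarrow> dvd_in R a (b * c)"
  unfolding dvd_in_def by (metis mult.assoc subring_mult)

lemma dvd_in_mult2: "is_subring R \<Longrightarrow> dvd_in R a b \<Longrightarrow> c \<in> R \<Longrightarrow> dvd_in R a (c * b)"
  using dvd_in_mult by (metis mult.commute)

lemma dvd_in_diff: "is_subring R \<Longrightarrow> dvd_in R a b \<Longrightarrow> dvd_in R a c \<Longrightarrow> dvd_in R a (b - c)"
  unfolding dvd_in_def by (metis right_diff_distrib subring_diff)

lemma dvd_in_sum:
  "is_subring R \<Longrightarrow> (\<And>i. i \<in> I \<Longrightarrow> dvd_in R a (f i)) \<Longrightarrow> dvd_in R a (sum f I)"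
proof (induction I rule: infinite_finite_induct)
  case (insert x F)
  then obtain c d where "c \<in> R" "f x = a * c" "d \<in> R" "sum f F = a * d"
    by (auto simp: dvd_in_def) metis
  then show ?case using insert by (intro dvd_inI[of "c + d"]) (auto simp: algebra_simps subringD)
qed (auto intro: dvd_inI[of 0] simp: subringD)

lemma prime_product_in: "is_subring R \<Longrightarrow> prime_product R k f \<Longrightarrow> f \<in> R"
  by (rotate_tac, induction rule: prime_product.induct) (auto simp: prime_in_def subringD)

lemma prime_product_nonzero:
  fixes f :: "'a::idom"
  shows "prime_product R k f \<Longrightarrow> f \<noteq> 0"
  by (induction rule: prime_product.induct) (auto simp: prime_in_def dvd_in_def)

lemma prime_product_unit_mult:
  "prime_product R k f \<Longrightarrow> is_subring R \<Longrightarrow> u \<in> R \<Longrightarrow> dvd_in R u 1 \<Longrightarrow> prime_product R k (u * f)"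
proof (induction rule: prime_product.induct)
  case (unit v)
  then obtain a b where "a \<in> R" "b \<in> R" "1 = u * a" "1 = v * b" by (auto simp: dvd_in_def)
  then have "1 = (u * v) * (a * b)" by (metis mult.assoc mult.left_commute mult_1)
  then show ?case using unit \<open>a \<in> R\<close> \<open>b \<in> R\<close>
    by (intro prime_product.unit) (auto intro: dvd_inI[of "a * b"] simp: subringD)
next
  case (step k f p)
  then show ?case by (metis mult.left_commute prime_product.step)
qed

lemma prime_product_mult:
  "prime_product R k f \<Longrightarrow> is_subring R \<Longrightarrow> prime_product R j g \<Longrightarrow> prime_product R (k + j) (f * g)"
proof (induction rule: prime_product.induct)
  case (step k f p)
  then show ?case using prime_product.step[of R "k + j" "f * g" p] by (simp add: mult.assoc)
qed (auto simp: prime_product_unit_mult)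

lemma prime_not_dvd_unit:
  "is_subring R \<Longrightarrow> prime_in R p \<Longrightarrow> dvd_in R u 1 \<Longrightarrow> \<not> dvd_in R p u"
  using dvd_in_trans prime_in_def by blast

text \<open>With q = p * c, primality of \<open>q\<close> makes it a divisor of \<open>p\<close> or
  of \<open>c\<close>. The first makes \<open>c\<close> a unit, and the second would make
  \<open>p\<close> one.\<close>

lemma prime_dvd_prime:
  fixes p :: "'a::idom"
  assumes R: "is_subring R" and p: "prime_in R p" and q: "prime_in R q" and "dvd_in R p q"
  shows "\<exists>u\<in>R. dvd_in R u 1 \<and> q = p * u"
proof -
  obtain c where c: "c \<in> R" "q = p * c" using assms by (auto simp: dvd_in_def)
  have "dvd_in R q (p * c)" using c R by (auto intro!: dvd_inI[of 1] simp: subringD)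
  then have "dvd_in R q p \<or> dvd_in R q c" using q p c by (auto simp: prime_in_def)
  then show ?thesis
  proof
    assume "dvd_in R q p"
    then obtain d where d: "d \<in> R" "p = q * d" by (auto simp: dvd_in_def)
    then have "p * 1 = p * (c * d)" using c by (metis mult.assoc mult.right_neutral)
    then have "1 = c * d" using p unfolding prime_in_def by (metis mult_left_cancel)
    then show ?thesis using c d by (intro bexI[of _ c] conjI dvd_inI[of d]) auto
  next
    assume "dvd_in R q c"
    then obtain d where d: "d \<in> R" "c = q * d" by (auto simp: dvd_in_def)
    then have "q * 1 = q * (p * d)" using c by (metis mult.left_commute mult.right_neutral)
    then have "1 = p * d" using q unfolding prime_in_def by (metis mult_left_cancel)
    then show ?thesis using p d by (auto simp: prime_in_def intro: dvd_inI)
  qed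
qed

text \<open>The part of unique factorization on which the later descents rest: a prime divisor is
  associated to one of the factors, and cancelling it lowers the count by exactly one.\<close>

lemma prime_product_dvd:
  fixes f :: "'a::idom"
  assumes "prime_product R k f" and R: "is_subring R" and p: "prime_in R p" and "dvd_in R p f"
  shows "\<exists>j g. k = Suc j \<and> f = p * g \<and> prime_product R j g"
  using assms(1,4)
proof (induction rule: prime_product.induct)
  case (unit u)
  then show ?case using prime_not_dvd_unit[OF R p] by blast
next
  case (step k f q)
  have fR: "f \<in> R" using R prime_product_in step by auto
  have "dvd_in R p q \<or> dvd_in R p f" using step p fR by (auto simp: prime_in_def)
  then show ?case
  proof
    assume "dvd_in R p q"
    then obtain u where "u \<in> R" "dvd_in R u 1" "q = p * u" using prime_dvd_prime R p step by blast
    then show ?thesis using prime_product_unit_mult[OF step(1) R]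
      by (intro exI[of _ k] exI[of _ "u * f"]) (simp add: mult.assoc)
  next
    assume "dvd_in R p f"
    then obtain j g where "k = Suc j" "f = p * g" "prime_product R j g" using step by auto
    then show ?thesis using prime_product.step[OF _ step(2)]
      by (intro exI[of _ k] exI[of _ "q * g"]) (auto simp: mult_ac)
  qed
qed

lemma ufd_nonunit_prime:
  assumes R: "is_ufd R" and "f \<in> R" "f \<noteq> 0" "\<not> dvd_in R f 1"
  shows "\<exists>p. prime_in R p \<and> dvd_in R p f"
proof -
  obtain k where "prime_product R k f" using assms by (auto simp: is_ufd_def)
  then show ?thesis using assms(4)
  proof (cases rule: prime_product.cases)
    case (step k f p)
    then show ?thesis using R prime_product_in[of R k f]
      by (auto simp: is_ufd_def intro!: exI[of _ p] dvd_inI)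
  qed auto
qed

section \<open>Gauss's lemma and pseudo-division\<close>

definition polys_over :: "'a::comm_ring_1 set \<Rightarrow> 'a poly set" where
  "polys_over R = {f. \<forall>i. coeff f i \<in> R}"

lemma polys_over_subring:
  assumes R: "is_subring R" shows "is_subring (polys_over R)"
proof -
  have "coeff (1::'a poly) i \<in> R" for i
    by (cases i) (auto simp: R subringD)
  then have "1 \<in> polys_over R" unfolding polys_over_def by blast
  then show ?thesis unfolding is_subring_def[of "polys_over R"]
    by (auto simp: polys_over_def R subringD coeff_mult intro!: subring_sum)
qed

lemma smult_polys_over: "is_subring R \<Longrightarrow> r \<in> R \<Longrightarrow> f \<in> polys_over R \<Longrightarrow> smult r f \<in> polys_over R"
  by (auto simp: polys_over_def subringD)

lemma const_polys_over: "is_subring R \<Longrightarrow> [:r:] \<in> polys_over R \<longleftrightarrow> r \<in> R"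
  by (auto simp: polys_over_def coeff_pCons subringD split: nat.splits)

lemma monom_polys_over: "is_subring R \<Longrightarrow> r \<in> R \<Longrightarrow> monom r k \<in> polys_over R"
  by (auto simp: polys_over_def subringD)

lemma lead_coeff_polys_over: "f \<in> polys_over R \<Longrightarrow> lead_coeff f \<in> R"
  by (auto simp: polys_over_def)

lemma const_dvd_in:
  fixes p :: "'a::idom"
  assumes R: "is_subring R" and "p \<in> R"
  shows "dvd_in (polys_over R) [:p:] f \<longleftrightarrow> (\<forall>i. dvd_in R p (coeff f i))"
proof
  assume "dvd_in (polys_over R) [:p:] f"
  then show "\<forall>i. dvd_in R p (coeff f i)" by (auto simp: dvd_in_def polys_over_def)
next
  assume H: "\<forall>i. dvd_in R p (coeff f i)"
  then obtain c where c: "\<And>i. c i \<in> R" "\<And>i. coeff f i = p * c i" unfolding dvd_in_def by metis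
  define g where "g = (\<Sum>i\<le>degree f. monom (c i) i)"
  have "g \<in> polys_over R" unfolding g_def
    by (intro subring_sum polys_over_subring monom_polys_over R c)
  moreover have "f = [:p:] * g"
    unfolding g_def by (subst poly_as_sum_of_monoms[of f, symmetric])
      (simp add: c(2) smult_monom sum_distrib_left)
  ultimately show "dvd_in (polys_over R) [:p:] f" by (rule dvd_inI)
qed

text \<open>Gauss's argument: if \<open>i\<close> and \<open>j\<close> are the first positions at
  which the coefficients of the two factors are not divisible by \<open>p\<close>, then the
  coefficient of the product at i + j is congruent modulo \<open>p\<close> to the product of these
  two.\<close>

lemma prime_in_polys_over:
  fixes p :: "'a::idom"
  assumes R: "is_subring R" and p: "prime_in R p"
  shows "prime_in (polys_over R) [:p:]"
proof -
  let ?S = "polys_over R"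
  have pR: "p \<in> R" using p by (simp add: prime_in_def)
  have "dvd_in ?S [:p:] a \<or> dvd_in ?S [:p:] b"
    if ab: "a \<in> ?S" "b \<in> ?S" "dvd_in ?S [:p:] (a * b)" for a b
  proof (rule ccontr)
    assume "\<not> ?thesis"
    then have ex: "\<exists>i. \<not> dvd_in R p (coeff a i)" "\<exists>i. \<not> dvd_in R p (coeff b i)"
      using const_dvd_in[OF R pR] by auto
    define i where "i = (LEAST i. \<not> dvd_in R p (coeff a i))"
    define j where "j = (LEAST i. \<not> dvd_in R p (coeff b i))"
    have i: "\<not> dvd_in R p (coeff a i)" "\<And>k. k < i \<Longrightarrow> dvd_in R p (coeff a k)"
      unfolding i_def using LeastI_ex[OF ex(1)] not_less_Least by blast+
    have j: "\<not> dvd_in R p (coeff b j)" "\<And>k. k < j \<Longrightarrow> dvd_in R p (coeff b k)"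
      unfolding j_def using LeastI_ex[OF ex(2)] not_less_Least by blast+
    have inR: "coeff a k \<in> R" "coeff b k \<in> R" for k using ab by (auto simp: polys_over_def)
    have 1: "dvd_in R p (coeff (a * b) (i + j))" using ab const_dvd_in[OF R pR] by auto
    have 2: "dvd_in R p (\<Sum>k\<in>{..i+j}-{i}. coeff a k * coeff b (i + j - k))"
    proof (rule dvd_in_sum[OF R])
      fix k assume k: "k \<in> {..i+j} - {i}"
      show "dvd_in R p (coeff a k * coeff b (i + j - k))"
      proof (cases "k < i")
        case True
        then show ?thesis using i(2) dvd_in_mult[OF R] inR by auto
      next
        case False
        then have "i + j - k < j" using k by auto
        then show ?thesis using j(2) dvd_in_mult2[OF R] inR by auto
      qed
    qed
    have "coeff (a * b) (i + j) =
        (\<Sum>k\<in>{..i+j}-{i}. coeff a k * coeff b (i + j - k)) + coeff a i * coeff b j"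
      unfolding coeff_mult by (subst sum.remove[of _ i]) auto
    then have "dvd_in R p (coeff a i * coeff b j)"
      using dvd_in_diff[OF R 1 2] by simp
    then show False using p i(1) j(1) inR by (auto simp: prime_in_def)
  qed
  moreover have "\<not> dvd_in ?S [:p:] 1"
    using const_dvd_in[OF R pR, of 1] p by (auto simp: prime_in_def dest!: spec[of _ 0])
  ultimately show ?thesis using p R by (auto simp: prime_in_def const_polys_over)
qed

lemma prime_product_polys_over:
  fixes f :: "'a::idom"
  assumes R: "is_subring R" and "prime_product R k f"
  shows "prime_product (polys_over R) k [:f:]"
  using assms(2)
proof (induction rule: prime_product.induct)
  case (unit u)
  then obtain c where "c \<in> R" "1 = u * c" by (auto simp: dvd_in_def)
  then show ?case using unit R
    by (intro prime_product.unit dvd_inI[of "[:c:]"]) (auto simp: const_polys_over one_pCons mult.commute)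
next
  case (step k f p)
  then show ?case using prime_product.step[OF step(3) prime_in_polys_over[OF R step(2)]]
    by (simp add: mult.commute)
qed

text \<open>Multiplying by the leading coefficient of \<open>m\<close> at each step replaces
  division in the fraction field, so that everything stays over \<open>R\<close>.\<close>

lemma pseudo_division:
  fixes m :: "'a::idom poly"
  assumes R: "is_subring R" and m: "m \<in> polys_over R" "m \<noteq> 0"
  shows "f \<in> polys_over R \<Longrightarrow> \<exists>l\<in>R. l \<noteq> 0 \<and> (\<exists>q\<in>polys_over R. \<exists>r\<in>polys_over R.
           smult l f = q * m + r \<and> (r = 0 \<or> degree r < degree m))"
proof (induction "degree f" arbitrary: f rule: less_induct)
  case less
  note S = polys_over_subring[OF R]
  show ?case
  proof (cases "f = 0 \<or> degree f < degree m")
    case True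
    then show ?thesis using less R S
      by (intro bexI[of _ 1] conjI bexI[of _ 0] bexI[of _ f]) (auto simp: subringD)
  next
    case False
    define t where "t = monom (lead_coeff f) (degree f - degree m)"
    \<comment> \<open>Both terms have the same leading term, so the difference has smaller degree or
      is zero.\<close>
    define g where "g = smult (lead_coeff m) f - t * m"
    have lc: "lead_coeff m \<in> R" "lead_coeff f \<in> R" "lead_coeff m \<noteq> 0"
      using less m lead_coeff_polys_over by auto
    have tS: "t \<in> polys_over R" unfolding t_def using monom_polys_over[OF R] lc by auto
    have gS: "g \<in> polys_over R"
      unfolding g_def using S tS less m lc by (auto simp: subringD smult_polys_over R)
    have tm: "t * m \<noteq> 0" "degree (t * m) = degree f"
      using False m by (auto simp: t_def degree_mult_eq degree_monom_eq monom_eq_0_iff)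
    have "degree g \<le> degree f" unfolding g_def
      by (rule degree_diff_le) (auto simp: tm degree_smult_le)
    moreover have "coeff g (degree f) = 0"
    proof -
      have "coeff (t * m) (degree f) = lead_coeff t * lead_coeff m"
        using tm(2) lead_coeff_mult[of t m] by simp
      then show ?thesis by (simp add: g_def t_def degree_monom_eq False)
        (metis False lead_coeff_monom mult.commute leading_coeff_0_iff degree_monom_eq)
    qed
    ultimately have "g = 0 \<or> degree g < degree f"
      by (metis eq_zero_or_degree_less)
    then have "\<exists>l\<in>R. l \<noteq> 0 \<and> (\<exists>q\<in>polys_over R. \<exists>r\<in>polys_over R.
           smult l g = q * m + r \<and> (r = 0 \<or> degree r < degree m))"
    proof
      assume "g = 0"
      then show ?thesis using R S by (intro bexI[of _ 1] conjI bexI[of _ 0]) (auto simp: subringD)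
    next
      assume "degree g < degree f"
      then show ?thesis using less gS by blast
    qed
    then obtain l q r where *: "l \<in> R" "l \<noteq> 0" "q \<in> polys_over R" "r \<in> polys_over R"
      "smult l g = q * m + r" "r = 0 \<or> degree r < degree m" by blast
    have "smult (l * lead_coeff m) f = (q + smult l t) * m + r"
      using *(5) by (simp add: g_def smult_diff_right algebra_simps)
    then show ?thesis using * lc R S tS
      by (intro bexI[of _ "l * lead_coeff m"] conjI bexI[of _ "q + smult l t"] bexI[of _ r])
        (auto simp: subringD smult_polys_over)
  qed
qed

text \<open>Content 1, tested by primes so that no greatest common divisor has to be chosen.\<close>

definition primitive_over :: "'a::idom set \<Rightarrow> 'a poly \<Rightarrow> bool" where
  "primitive_over R f \<longleftrightarrow> (\<forall>p. prime_in R p \<longrightarrow> \<not> dvd_in (polys_over R) [:p:] f)"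

text \<open>For \<open>f\<close> of positive degree over a factorial \<open>R\<close>, this is
  irreducibility over the fraction field, expressed without that field.\<close>

definition indecomposable_over :: "'a::idom set \<Rightarrow> 'a poly \<Rightarrow> bool" where
  "indecomposable_over R f \<longleftrightarrow>
     (\<forall>g\<in>polys_over R. \<forall>h\<in>polys_over R. f = g * h \<longrightarrow> degree f \<le> degree g \<or> degree f \<le> degree h)"

text \<open>Each prime of \<open>l\<close> divides \<open>q\<close> or \<open>m\<close> by
  \<open>prime_in_polys_over\<close> and is cancelled there. Only constants leave \<open>m\<close>,
  so \<open>m'\<close> keeps its degree. In this way a factorization over the fraction field
  descends to \<open>R\<close>.\<close>

lemma cancel_const_factor:
  fixes f :: "'a::idom poly"
  assumes "prime_product R k l" and R: "is_subring R" and f: "f \<in> polys_over R"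
  shows "q \<in> polys_over R \<Longrightarrow> m \<in> polys_over R \<Longrightarrow> smult l f = q * m \<Longrightarrow>
    \<exists>q'\<in>polys_over R. \<exists>m'\<in>polys_over R. \<exists>c\<in>R. c \<noteq> 0 \<and> m = smult c m' \<and> f = q' * m'"
  using assms(1)
proof (induction arbitrary: q m rule: prime_product.induct)
  case (unit u)
  then obtain v where v: "v \<in> R" "u * v = 1" by (auto simp: dvd_in_def)
  have "f = smult v (smult u f)" using v by (simp add: mult.commute)
  also have "\<dots> = smult v q * m" using unit by simp
  finally show ?case using unit v R
    by (intro bexI[of _ "smult v q"] bexI[of _ m] bexI[of _ 1])
      (auto simp: subringD smult_polys_over)
next
  case (step k l p)
  note S = polys_over_subring[OF R]
  have p: "p \<noteq> 0" "p \<in> R" using step by (auto simp: prime_in_def)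
  have lf: "smult l f \<in> polys_over R"
    using smult_polys_over[OF R prime_product_in[OF R step(1)] f] .
  have eq: "[:p:] * smult l f = q * m" using step by (simp add: mult.commute)
  then have "dvd_in (polys_over R) [:p:] (q * m)" using lf by (auto intro: dvd_inI)
  then have "dvd_in (polys_over R) [:p:] q \<or> dvd_in (polys_over R) [:p:] m"
    using prime_in_polys_over[OF R step(2)] step by (auto simp: prime_in_def)
  then show ?case
  proof
    assume "dvd_in (polys_over R) [:p:] q"
    then obtain q' where q': "q' \<in> polys_over R" "q = [:p:] * q'" by (auto simp: dvd_in_def)
    then have "[:p:] * smult l f = [:p:] * (q' * m)" using eq by simp
    then have "smult l f = q' * m" using p by (subst (asm) mult_left_cancel) auto
    then show ?thesis using step q' by blast
  next
    assume "dvd_in (polys_over R) [:p:] m"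
    then obtain m' where m': "m' \<in> polys_over R" "m = [:p:] * m'" by (auto simp: dvd_in_def)
    then have "[:p:] * smult l f = [:p:] * (q * m')" using eq by simp
    then have "smult l f = q * m'" using p by (subst (asm) mult_left_cancel) auto
    then obtain q' m'' c where *: "q' \<in> polys_over R" "m'' \<in> polys_over R" "c \<in> R" "c \<noteq> 0"
      "m' = smult c m''" "f = q' * m''" using step m' by blast
    then have "m = smult (p * c) m''" using m' by (simp add: mult.commute)
    then show ?thesis using * p R by (metis no_zero_divisors subring_mult)
  qed
qed

text \<open>A prime of \<open>l\<close> divides f * c but not the primitive \<open>f\<close>, hence
  it divides \<open>c\<close>; so the primes of \<open>l\<close> cancel one by one.\<close>

lemma primitive_cancel_const:
  fixes f :: "'a::idom poly"
  assumes "prime_product R k l" and R: "is_subring R" and f: "f \<in> polys_over R"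
    and prim: "primitive_over R f" and a: "a \<in> polys_over R"
    and "dvd_in (polys_over R) f (smult l a)"
  shows "dvd_in (polys_over R) f a"
  using assms(1,6)
proof (induction rule: prime_product.induct)
  case (unit u)
  then obtain v where v: "v \<in> R" "u * v = 1" by (auto simp: dvd_in_def)
  have "dvd_in (polys_over R) f (smult u a * [:v:])"
    using unit v by (intro dvd_in_mult) (auto simp: R polys_over_subring const_polys_over)
  then show ?case using v by (simp add: mult.commute)
next
  case (step k l p)
  have p: "p \<noteq> 0" "p \<in> R" using step by (auto simp: prime_in_def)
  have la: "smult l a \<in> polys_over R"
    using smult_polys_over[OF R prime_product_in[OF R step(1)] a] .
  obtain c where c: "c \<in> polys_over R" "smult (p * l) a = f * c"
    using step(4) unfolding dvd_in_def by blast
  then have c: "c \<in> polys_over R" "[:p:] * smult l a = f * c" by (simp_all add: mult.commute)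
  then have "dvd_in (polys_over R) [:p:] (f * c)" using la dvd_inI by metis
  then have "dvd_in (polys_over R) [:p:] c"
    using prime_in_polys_over[OF R step(2)] c f prim step(2)
    by (auto simp: prime_in_def primitive_over_def)
  then obtain c' where c': "c' \<in> polys_over R" "c = [:p:] * c'" by (auto simp: dvd_in_def)
  then have "[:p:] * smult l a = [:p:] * (f * c')" using c by simp
  then have "smult l a = f * c'" using p by (subst (asm) mult_left_cancel) auto
  then show ?case using step c' by (auto intro: dvd_inI)
qed

text \<open>An element of minimal degree in the ideal generated by \<open>f\<close> and \<open>a\<close> divides both up to
  constants, by pseudo-division.\<close>

lemma divides_or_comaximal:
  fixes f :: "'a::idom poly"
  assumes R: "is_ufd R" and f: "f \<in> polys_over R" "0 < degree f"
    and prim: "primitive_over R f" and ind: "indecomposable_over R f" and a: "a \<in> polys_over R"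
  shows "dvd_in (polys_over R) f a \<or>
    (\<exists>u\<in>polys_over R. \<exists>v\<in>polys_over R. \<exists>r\<in>R. r \<noteq> 0 \<and> u * f + v * a = [:r:])"
proof -
  let ?S = "polys_over R"
  have R': "is_subring R" using R by (simp add: is_ufd_def)
  note S = polys_over_subring[OF R']
  have pp: "\<exists>k. prime_product R k l" if "l \<in> R" "l \<noteq> 0" for l using R that by (auto simp: is_ufd_def)
  define J where "J = {u * f + v * a | u v. u \<in> ?S \<and> v \<in> ?S}"
  have JS: "J \<subseteq> ?S" using S f a by (auto simp: J_def subringD)
  have fJ: "f \<in> J" unfolding J_def using S
    by (intro CollectI exI[of _ 1] exI[of _ 0]) (auto simp: subringD)
  have aJ: "a \<in> J" unfolding J_def using S
    by (intro CollectI exI[of _ 0] exI[of _ 1]) (auto simp: subringD)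
  have Jadd: "smult l x - q * y \<in> J" if xy: "x \<in> J" "y \<in> J" "l \<in> R" "q \<in> ?S" for l x q y
  proof -
    obtain u v u' v' where *: "u \<in> ?S" "v \<in> ?S" "u' \<in> ?S" "v' \<in> ?S"
      "x = u * f + v * a" "y = u' * f + v' * a" using xy unfolding J_def by blast
    then have "smult l x - q * y = (smult l u - q * u') * f + (smult l v - q * v') * a"
      by (simp add: algebra_simps smult_add_right)
    moreover have "smult l u - q * u' \<in> ?S" "smult l v - q * v' \<in> ?S"
      using * that S R' by (auto simp: subringD smult_polys_over)
    ultimately show ?thesis unfolding J_def by blast
  qed
  have "f \<in> J \<and> f \<noteq> 0" using fJ f by auto
  then obtain m where m: "m \<in> J" "m \<noteq> 0" "\<And>y. y \<in> J \<Longrightarrow> y \<noteq> 0 \<Longrightarrow> degree m \<le> degree y"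
    using ex_has_least_nat[of "\<lambda>m. m \<in> J \<and> m \<noteq> 0" f degree] by blast
  have mS: "m \<in> ?S" using m JS by auto
  show ?thesis
  proof (cases "degree m = 0")
    \<comment> \<open>A nonzero constant in the ideal is the comaximal alternative.\<close>
    case True
    then obtain r where r: "m = [:r:]" using degree_eq_zeroE by blast
    then have "r \<in> R" "r \<noteq> 0" using mS m R' by (auto simp: const_polys_over)
    then show ?thesis using m r unfolding J_def by blast
  next
    case False
    have div: "\<exists>l\<in>R. l \<noteq> 0 \<and> (\<exists>q\<in>?S. smult l x = q * m)" if x: "x \<in> J" for x
    proof -
      obtain l q r where *: "l \<in> R" "l \<noteq> 0" "q \<in> ?S" "smult l x = q * m + r"
        "r = 0 \<or> degree r < degree m"
        using pseudo_division[OF R' mS m(2)] x JS by blast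
      \<comment> \<open>The remainder lies in the ideal, so the minimality of \<open>m\<close>
        leaves no room for a nonzero one.\<close>
      then have "r \<in> J" using Jadd[OF x m(1) *(1,3)] by simp
      then have "r = 0" using m(3) *(5) by force
      then show ?thesis using * by auto
    qed
    \<comment> \<open>Here \<open>m\<close> has positive degree. Once the constant \<open>l\<close>
      is cancelled, \<open>m'\<close> of the same degree is a factor of \<open>f\<close>, and
      indecomposability makes the cofactor \<open>q'\<close> constant.\<close>
    obtain l q where l: "l \<in> R" "l \<noteq> 0" "q \<in> ?S" "smult l f = q * m" using div[OF fJ] by blast
    obtain k where "prime_product R k l" using pp l by blast
    then obtain q' m' c where m': "q' \<in> ?S" "m' \<in> ?S" "c \<in> R" "c \<noteq> 0" "m = smult c m'" "f = q' * m'"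
      using cancel_const_factor[OF _ R' f(1) l(3) mS l(4)] by blast
    have nz: "q' \<noteq> 0" "m' \<noteq> 0" using f m' by auto
    have deg: "degree f = degree q' + degree m'" "degree m' = degree m"
      using m' nz by (auto simp: degree_mult_eq)
    moreover have "degree f \<le> degree q' \<or> degree f \<le> degree m'"
      using ind m' unfolding indecomposable_over_def by blast
    ultimately have "degree q' = 0" using False by linarith
    then obtain e where e: "q' = [:e:]" using degree_eq_zeroE by blast
    then have eR: "e \<in> R" "e \<noteq> 0" using m' nz R' by (auto simp: const_polys_over)
    \<comment> \<open>A prime factor of \<open>e\<close> would divide the primitive
      \<open>f\<close>. So \<open>e\<close> is a unit, \<open>m\<close> is a constant multiple of
      \<open>f\<close>, and \<open>f\<close> divides a nonzero constant multiple of
      \<open>a\<close>.\<close>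
    have "dvd_in R e 1"
    proof (rule ccontr)
      assume "\<not> dvd_in R e 1"
      then obtain p where p: "prime_in R p" "dvd_in R p e" using ufd_nonunit_prime R eR by blast
      then obtain d where "d \<in> R" "e = p * d" by (auto simp: dvd_in_def)
      then have "dvd_in ?S [:p:] f" using m' e R'
        by (intro dvd_inI[of "smult d m'"]) (auto simp: smult_polys_over mult.commute)
      then show False using p prim by (auto simp: primitive_over_def)
    qed
    then obtain e' where e': "e' \<in> R" "e * e' = 1" by (auto simp: dvd_in_def)
    have mf: "m = smult (c * e') f"
    proof -
      have "smult e' f = m'" using m' e e' by (simp add: mult.commute)
      then show ?thesis using m' by (metis smult_smult)
    qed
    obtain l' t where l': "l' \<in> R" "l' \<noteq> 0" "t \<in> ?S" "smult l' a = t * m" using div[OF aJ] by blast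
    then have "dvd_in ?S f (smult l' a)"
      using mf m' e' R' by (intro dvd_inI[of "smult (c * e') t"])
        (auto simp: smult_polys_over subringD mult.commute)
    then show ?thesis using primitive_cancel_const[OF _ R' f(1) prim a] pp l' by blast
  qed
qed

text \<open>If \<open>f\<close> does not divide \<open>a\<close>, multiply the identity u * f + v *
  a = r by \<open>b\<close>: then \<open>f\<close> divides r * b, and primitivity cancels the
  constant \<open>r\<close>.\<close>

lemma primitive_indecomposable_prime:
  fixes f :: "'a::idom poly"
  assumes R: "is_ufd R" and f: "f \<in> polys_over R" "0 < degree f"
    and prim: "primitive_over R f" and ind: "indecomposable_over R f"
  shows "prime_in (polys_over R) f"
proof -
  let ?S = "polys_over R"
  have R': "is_subring R" using R by (simp add: is_ufd_def)
  note S = polys_over_subring[OF R']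
  have "dvd_in ?S f a \<or> dvd_in ?S f b"
    if ab: "a \<in> ?S" "b \<in> ?S" "dvd_in ?S f (a * b)" for a b
  proof (rule ccontr)
    assume *: "\<not> ?thesis"
    then obtain u v r where u: "u \<in> ?S" "v \<in> ?S" "r \<in> R" "r \<noteq> 0" "u * f + v * a = [:r:]"
      using divides_or_comaximal[OF R f prim ind ab(1)] by blast
    obtain c where c: "c \<in> ?S" "a * b = f * c" using ab by (auto simp: dvd_in_def)
    have "smult r b = (u * f + v * a) * b" using u by simp
    also have "\<dots> = u * f * b + v * (a * b)" by (simp add: algebra_simps)
    also have "\<dots> = f * (u * b + v * c)" by (simp add: c algebra_simps)
    finally have "dvd_in ?S f (smult r b)"
      using u c ab S by (intro dvd_inI[of "u * b + v * c"]) (auto simp: subringD)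
    moreover obtain k where "prime_product R k r" using R u by (auto simp: is_ufd_def)
    ultimately show False using primitive_cancel_const[OF _ R' f(1) prim ab(2)] * by blast
  qed
  moreover have "\<not> dvd_in ?S f 1"
  proof
    assume "dvd_in ?S f 1"
    then have "f dvd 1" by (metis dvd_in_def dvdI)
    then show False using f dvd_imp_degree_le by fastforce
  qed
  ultimately show ?thesis using f by (auto simp: prime_in_def)
qed

text \<open>Two nested inductions. Splitting into factors of smaller degree lowers the degree;
  dividing off a prime constant keeps the degree but lowers the number of prime factors of the
  leading coefficient.\<close>

lemma polys_over_prime_product:
  fixes f :: "'a::idom poly"
  assumes R: "is_ufd R"
  shows "f \<in> polys_over R \<Longrightarrow> f \<noteq> 0 \<Longrightarrow> \<exists>k. prime_product (polys_over R) k f"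
proof (induction "degree f" arbitrary: f rule: less_induct)
  case less
  note IH = less(1)
  let ?S = "polys_over R"
  have R': "is_subring R" using R by (simp add: is_ufd_def)
  note S = polys_over_subring[OF R']
  have "lead_coeff f \<in> R" "lead_coeff f \<noteq> 0" using less lead_coeff_polys_over by auto
  then obtain k where "prime_product R k (lead_coeff f)" using R unfolding is_ufd_def by blast
  have "\<exists>j. prime_product ?S j g"
    if "g \<in> ?S" "g \<noteq> 0" "degree g = degree f" "prime_product R k (lead_coeff g)" for g k
    using that
  proof (induction k arbitrary: g rule: less_induct)
    case (less k)
    show ?case
    proof (cases "degree g = 0")
      case True
      then obtain r where r: "g = [:r:]" using degree_eq_zeroE by blast
      then show ?thesis using less prime_product_polys_over[OF R', of k r] by auto
    next
      case deg: False
      show ?thesis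
      proof (cases "primitive_over R g")
        case False
        then obtain p where p: "prime_in R p" "dvd_in ?S [:p:] g" by (auto simp: primitive_over_def)
        then obtain h where h: "h \<in> ?S" "g = [:p:] * h" by (auto simp: dvd_in_def)
        have p0: "p \<noteq> 0" "p \<in> R" using p by (auto simp: prime_in_def)
        have lc: "lead_coeff g = p * lead_coeff h" using h by simp
        have "dvd_in R p (lead_coeff g)" using lc lead_coeff_polys_over[OF h(1)] dvd_inI by blast
        then obtain j where j: "k = Suc j" "prime_product R j (lead_coeff h)"
          using prime_product_dvd[OF less.prems(4) R' p(1)] lc p0 by auto
        moreover have "h \<noteq> 0" "degree h = degree f" using h less p0 by auto
        ultimately obtain i where "prime_product ?S i h" using less(1)[of j h] h by auto
        then show ?thesis using prime_product.step[OF _ prime_in_polys_over[OF R' p(1)]] h by auto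
      next
        case prim: True
        show ?thesis
        proof (cases "indecomposable_over R g")
          case True
          then have "prime_in ?S g"
            using primitive_indecomposable_prime[OF R less(2) _ prim] deg by auto
          then have "prime_product ?S 1 (g * 1)"
            using prime_product.step[OF prime_product.unit, of 1 ?S g] S
            by (auto simp: subringD dvd_in_def)
          then show ?thesis by auto
        next
          case False
          then obtain g1 g2 where g: "g1 \<in> ?S" "g2 \<in> ?S" "g = g1 * g2"
            "degree g1 < degree f" "degree g2 < degree f"
            using less by (auto simp: indecomposable_over_def not_le)
          moreover have "g1 \<noteq> 0" "g2 \<noteq> 0" using g less by auto
          ultimately obtain i j where "prime_product ?S i g1" "prime_product ?S j g2"
            using IH by blast
          then show ?thesis using prime_product_mult[OF _ S] g by blast
        qed
      qed
    qed
  qed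
  then show ?case using less \<open>prime_product R k (lead_coeff f)\<close> by blast
qed

theorem is_ufd_polys_over:
  fixes R :: "'a::idom set"
  shows "is_ufd R \<Longrightarrow> is_ufd (polys_over R)"
  using polys_over_prime_product polys_over_subring by (auto simp: is_ufd_def)

text \<open>Converse of \<open>primitive_indecomposable_prime\<close>. It makes
  \<open>divides_or_comaximal\<close> available for a prime that is given.\<close>

lemma prime_degree_pos:
  fixes f :: "'a::idom poly"
  assumes R: "is_ufd R" and f: "prime_in (polys_over R) f" "0 < degree f"
  shows "primitive_over R f" "indecomposable_over R f"
proof -
  let ?S = "polys_over R"
  have R': "is_subring R" using R by (simp add: is_ufd_def)
  note S = polys_over_subring[OF R']
  have fS: "f \<in> ?S" "f \<noteq> 0" using f by (auto simp: prime_in_def)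
  show "indecomposable_over R f" unfolding indecomposable_over_def
  proof (intro ballI impI)
    fix g h assume gh: "g \<in> ?S" "h \<in> ?S" "f = g * h"
    then have "dvd_in ?S f (g * h)" using S by (auto simp: dvd_in_def subringD intro!: bexI[of _ 1])
    then have "dvd_in ?S f g \<or> dvd_in ?S f h" using f gh by (auto simp: prime_in_def)
    then have "f dvd g \<or> f dvd h" by (auto simp: dvd_in_def)
    then show "degree f \<le> degree g \<or> degree f \<le> degree h"
      using fS gh by (metis dvd_imp_degree_le mult_eq_0_iff)
  qed
  show "primitive_over R f" unfolding primitive_over_def
  proof (intro allI impI notI)
    fix p assume p: "prime_in R p" "dvd_in ?S [:p:] f"
    \<comment> \<open>A constant prime that divides the prime \<open>f\<close> is associated to it,
      against the positive degree of \<open>f\<close>.\<close>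
    obtain u where u: "u \<in> ?S" "dvd_in ?S u 1" "f = [:p:] * u"
      using prime_dvd_prime[OF S prime_in_polys_over[OF R' p(1)] f(1) p(2)] by blast
    then have "u dvd 1" by (metis dvd_in_def dvdI)
    then have "degree u = 0" using dvd_imp_degree_le by fastforce
    then show False using u f p by (simp add: prime_in_def)
  qed
qed

lemma prime_divides_or_comaximal:
  fixes f :: "'a::idom poly"
  assumes "is_ufd R" "prime_in (polys_over R) f" "0 < degree f" "a \<in> polys_over R"
  shows "dvd_in (polys_over R) f a \<or>
    (\<exists>u\<in>polys_over R. \<exists>v\<in>polys_over R. \<exists>r\<in>R. r \<noteq> 0 \<and> u * f + v * a = [:r:])"
  using divides_or_comaximal[OF assms(1) _ assms(3) prime_degree_pos[OF assms(1-3)] assms(4)]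
    assms(2) by (auto simp: prime_in_def)

text \<open>Divisibility and primality are multiplicative notions, so a bijection that respects
  products, 0 and 1 transports them.\<close>

lemma prime_in_iso:
  assumes h: "\<And>x y. x \<in> R \<Longrightarrow> y \<in> R \<Longrightarrow> h (x * y) = h x * h y" "h 1 = 1" "h 0 = 0"
    and b: "bij_betw h R R'" and R: "is_subring R" and p: "p \<in> R"
  shows dvd_in_iso: "a \<in> R \<Longrightarrow> dvd_in R' (h p) (h a) \<longleftrightarrow> dvd_in R p a"
    and "prime_in R' (h p) \<longleftrightarrow> prime_in R p"
proof -
  have inj: "h x = h y \<longleftrightarrow> x = y" if "x \<in> R" "y \<in> R" for x y
    using b that by (auto simp: bij_betw_def inj_on_def)
  have R': "R' = h ` R" using b by (simp add: bij_betw_def)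
  have D: "dvd_in R' (h p) (h a) \<longleftrightarrow> dvd_in R p a" if "p \<in> R" "a \<in> R" for p a
    using that R by (auto simp: dvd_in_def R' inj h(1)[symmetric] subringD)
  then show "a \<in> R \<Longrightarrow> dvd_in R' (h p) (h a) \<longleftrightarrow> dvd_in R p a" using p by blast
  have "(\<forall>a\<in>R'. \<forall>b\<in>R'. dvd_in R' (h p) (a * b) \<longrightarrow> dvd_in R' (h p) a \<or> dvd_in R' (h p) b) \<longleftrightarrow>
    (\<forall>a\<in>R. \<forall>b\<in>R. dvd_in R p (a * b) \<longrightarrow> dvd_in R p a \<or> dvd_in R p b)"
    using p D R by (simp add: R' h(1)[symmetric] subringD)
  moreover have "dvd_in R' (h p) 1 \<longleftrightarrow> dvd_in R p 1" using D[OF p, of 1] R h by (simp add: subringD)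
  moreover have "h p = 0 \<longleftrightarrow> p = 0" using inj[OF p, of 0] R h by (simp add: subringD)
  ultimately show "prime_in R' (h p) \<longleftrightarrow> prime_in R p" using p R' by (auto simp: prime_in_def)
qed

lemma prime_product_iso:
  assumes h: "\<And>x y. x \<in> R \<Longrightarrow> y \<in> R \<Longrightarrow> h (x * y) = h x * h y" "h 1 = 1" "h 0 = 0"
    and b: "bij_betw h R R'" and R: "is_subring R"
  shows "prime_product R k f \<Longrightarrow> prime_product R' k (h f)"
proof (induction rule: prime_product.induct)
  case (unit u)
  then show ?case using dvd_in_iso[OF h b R unit(1), of 1] R b h
    by (intro prime_product.unit) (auto simp: subringD bij_betw_def)
next
  case (step k f p)
  then have "p \<in> R" "f \<in> R" using prime_product_in[OF R] by (auto simp: prime_in_def)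
  then show ?case using prime_product.step[OF step(3)] prime_in_iso[OF h b R] step h by auto
qed

section \<open>Polynomial functions in finitely many variables\<close>

lemma poly_funs_mono: "C \<subseteq> D \<Longrightarrow> f \<in> poly_funs C \<Longrightarrow> f \<in> poly_funs D"
  by (rotate_tac, induction rule: poly_funs.induct) (auto intro: poly_funs.intros)

lemma poly_funs_uminus: "f \<in> poly_funs C \<Longrightarrow> (\<lambda>x. - f x) \<in> poly_funs C"
  using poly_funs.mult[OF poly_funs.const[of "-1"]] by fastforce

lemma poly_funs_affine_coords_cong:
  "f \<in> poly_funs (affine_coords n) \<Longrightarrow> (\<And>i. i < n \<Longrightarrow> z i = w i) \<Longrightarrow> f z = f w"
  by (induction rule: poly_funs.induct) (auto simp: affine_coords_def)

text \<open>Polynomial functions in the infinitely many variables \<open>z 0, z 1, \<dots>\<close>: the induction on the number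
  of variables needs the polynomial rings in \<open>n\<close> variables, for all \<open>n\<close>, inside a single type.\<close>

typedef polyfun = "poly_funs {\<lambda>z::nat \<Rightarrow> complex. z i | i. True}"
  morphisms ev Polyfun
  by (blast intro: poly_funs.const)

text \<open>Restriction to lines reduces to polynomials in one complex variable. Both the absence of
  zero divisors and the constancy of units rest on it.\<close>

lemma polyfun_line: "\<exists>P. \<forall>t. ev f (\<lambda>i. a i + t * b i) = poly P t"
proof -
  have "ev f \<in> poly_funs {\<lambda>z::nat \<Rightarrow> complex. z i | i. True}" by (rule ev)
  then show ?thesis
  proof (induction rule: poly_funs.induct)
    case (const c)
    then show ?case by (intro exI[of _ "[:c:]"]) simp
  next
    case (coord f)
    then obtain i where "f = (\<lambda>z. z i)" by blast
    then show ?case by (intro exI[of _ "[:a i, b i:]"]) simp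
  next
    case (add f g)
    then show ?case by (metis poly_add)
  next
    case (mult f g)
    then show ?case by (metis poly_mult)
  qed
qed

instantiation polyfun :: idom
begin

definition "0 = Polyfun (\<lambda>_. 0)"
definition "1 = Polyfun (\<lambda>_. 1)"
definition "f + g = Polyfun (\<lambda>z. ev f z + ev g z)"
definition "f * g = Polyfun (\<lambda>z. ev f z * ev g z)"
definition "- f = Polyfun (\<lambda>z. - ev f z)"
definition "f - (g::polyfun) = f + - g"

lemma ev_simps: "ev 0 = (\<lambda>_. 0)" "ev 1 = (\<lambda>_. 1)" "ev (f + g) = (\<lambda>z. ev f z + ev g z)"
    "ev (f * g) = (\<lambda>z. ev f z * ev g z)" "ev (- f) = (\<lambda>z. - ev f z)"
    "ev (f - g) = (\<lambda>z. ev f z - ev g z)"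
proof -
  show "ev 0 = (\<lambda>_. 0)" "ev 1 = (\<lambda>_. 1)"
    by (simp_all add: zero_polyfun_def one_polyfun_def Polyfun_inverse poly_funs.const)
  show A: "ev (f + g) = (\<lambda>z. ev f z + ev g z)" for f g
    unfolding plus_polyfun_def using ev[of f] ev[of g]
    by (intro Polyfun_inverse poly_funs.add)
  show "ev (f * g) = (\<lambda>z. ev f z * ev g z)"
    unfolding times_polyfun_def using ev[of f] ev[of g]
    by (intro Polyfun_inverse poly_funs.mult)
  show U: "ev (- f) = (\<lambda>z. - ev f z)" for f
    unfolding uminus_polyfun_def using ev[of f] by (intro Polyfun_inverse poly_funs_uminus)
  show "ev (f - g) = (\<lambda>z. ev f z - ev g z)"
    by (simp add: minus_polyfun_def A U)
qed

lemma polyfun_eq_iff: "f = g \<longleftrightarrow> (\<forall>z. ev f z = ev g z)"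
  by (metis ev_inject ext)

instance
proof
  fix f g :: polyfun
  assume "f \<noteq> 0" "g \<noteq> 0"
  then obtain a b where ab: "ev f a \<noteq> 0" "ev g b \<noteq> 0" by (auto simp: polyfun_eq_iff ev_simps)
  \<comment> \<open>The line through \<open>a\<close> and \<open>b\<close> has parameter 0 at
    \<open>a\<close> and 1 at \<open>b\<close>, so neither restriction is the zero
    polynomial.\<close>
  obtain P Q where P: "\<And>t. ev f (\<lambda>i. a i + t * (b i - a i)) = poly P t"
    and Q: "\<And>t. ev g (\<lambda>i. a i + t * (b i - a i)) = poly Q t"
    using polyfun_line[of f] polyfun_line[of g] by metis
  have "poly P 0 \<noteq> 0" "poly Q 1 \<noteq> 0" using ab by (simp_all flip: P Q)
  then have "P * Q \<noteq> 0" by auto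
  then obtain t where "poly (P * Q) t \<noteq> 0" using poly_all_0_iff_0 by blast
  then have "ev (f * g) (\<lambda>i. a i + t * (b i - a i)) \<noteq> 0" by (simp add: ev_simps P Q)
  then show "f * g \<noteq> 0" by (metis ev_simps(1))
qed (auto simp: polyfun_eq_iff ev_simps algebra_simps)

end

lemma ev_power [simp]: "ev (f ^ k) z = ev f z ^ k"
  by (induction k) (simp_all add: ev_simps)

section \<open>Passage from n to n + 1 variables\<close>

definition polyfuns :: "nat \<Rightarrow> polyfun set" where
  "polyfuns n = {f. ev f \<in> poly_funs (affine_coords n)}"

definition Const :: "complex \<Rightarrow> polyfun" where "Const a = Polyfun (\<lambda>_. a)"
definition Var :: "nat \<Rightarrow> polyfun" where "Var i = Polyfun (\<lambda>z. z i)"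

lemma ev_Const [simp]: "ev (Const a) = (\<lambda>_. a)"
  by (simp add: Const_def Polyfun_inverse poly_funs.const)

lemma ev_Var [simp]: "ev (Var i) = (\<lambda>z. z i)"
proof -
  have "(\<lambda>z::nat \<Rightarrow> complex. z i) \<in> poly_funs {\<lambda>z. z i | i. True}" by (blast intro: poly_funs.coord)
  then show ?thesis by (simp add: Var_def Polyfun_inverse)
qed

lemma Const_in_polyfuns [simp]: "Const a \<in> polyfuns n"
  by (simp add: polyfuns_def poly_funs.const)

lemma Var_in_polyfuns: "i < n \<Longrightarrow> Var i \<in> polyfuns n"
  by (auto simp: polyfuns_def affine_coords_def intro!: poly_funs.coord)

lemma is_subring_polyfuns: "is_subring (polyfuns n)"
  by (auto simp: is_subring_def polyfuns_def ev_simps poly_funs.const poly_funs.add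
      poly_funs.mult poly_funs_uminus)

lemma polyfuns_mono: "m \<le> n \<Longrightarrow> polyfuns m \<subseteq> polyfuns n"
proof -
  assume "m \<le> n"
  then have "affine_coords m \<subseteq> affine_coords n" by (force simp: affine_coords_def)
  then show ?thesis by (auto simp: polyfuns_def intro: poly_funs_mono)
qed

lemma poly_funs_eq_ev:
  assumes "f \<in> poly_funs (affine_coords n)"
  obtains F where "F \<in> polyfuns n" "f = ev F"
proof -
  have "f \<in> poly_funs {\<lambda>z::nat \<Rightarrow> complex. z i | i. True}"
    using assms by (rule poly_funs_mono[rotated]) (auto simp: affine_coords_def)
  then show ?thesis using assms that[of "Polyfun f"] by (simp add: polyfuns_def Polyfun_inverse)
qed

lemma ev_cong: "f \<in> polyfuns n \<Longrightarrow> (\<And>i. i < n \<Longrightarrow> z i = w i) \<Longrightarrow> ev f z = ev f w"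
  using poly_funs_affine_coords_cong by (auto simp: polyfuns_def)

text \<open>Freezing the coefficients at \<open>z\<close> leaves a complex polynomial in the last
  variable, to which the fundamental theorem of algebra applies.\<close>

definition slice :: "polyfun poly \<Rightarrow> (nat \<Rightarrow> complex) \<Rightarrow> complex poly" where
  "slice P z = map_poly (\<lambda>c. ev c z) P"

lemma coeff_slice: "coeff (slice P z) i = ev (coeff P i) z"
  by (simp add: slice_def coeff_map_poly ev_simps)

lemma ev_poly_Var:
  "P \<in> polys_over (polyfuns n) \<Longrightarrow> ev (poly P (Var n)) (z(n := t)) = poly (slice P z) t"
proof (induction P)
  case 0
  then show ?case by (simp add: slice_def ev_simps)
next
  case (pCons a P)
  then have "a \<in> polyfuns n" "P \<in> polys_over (polyfuns n)"
    by (auto simp: polys_over_def coeff_pCons split: nat.splits)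
  moreover have "ev a (z(n := t)) = ev a z" using \<open>a \<in> polyfuns n\<close> by (rule ev_cong) auto
  moreover have "slice (pCons a P) z = pCons (ev a z) (slice P z)"
    by (auto simp: poly_eq_iff coeff_slice coeff_pCons split: nat.splits)
  moreover have "ev (poly (pCons a P) (Var n)) (z(n := t)) =
      ev a (z(n := t)) + t * ev (poly P (Var n)) (z(n := t))"
    by (simp only: poly_pCons ev_simps ev_Var fun_upd_same)
  ultimately show ?case using pCons.IH by (simp add: fun_upd_def)
qed

text \<open>Injectivity: a slice that vanishes for every value of the last variable is zero, hence
  every coefficient vanishes at every point. Through this bijection the results on
  \<open>polys_over\<close> carry the induction on the number of variables.\<close>

lemma bij_betw_poly_Var:
  "bij_betw (\<lambda>P. poly P (Var n)) (polys_over (polyfuns n)) (polyfuns (Suc n))"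
proof -
  let ?R = "polyfuns n" and ?S = "polys_over (polyfuns n)"
  note R = is_subring_polyfuns[of n]
  note S = polys_over_subring[OF R]
  have "P = Q" if PQ: "P \<in> ?S" "Q \<in> ?S" "poly P (Var n) = poly Q (Var n)" for P Q
  proof -
    have "poly (slice (P - Q) z) t = 0" for z t
      using ev_poly_Var[of "P - Q" n z t] PQ S by (simp add: subringD ev_simps)
    then have "slice (P - Q) z = 0" for z using poly_all_0_iff_0 by blast
    then have "ev (coeff (P - Q) i) z = 0" for i z by (metis coeff_slice coeff_0)
    then show ?thesis by (simp add: poly_eq_iff polyfun_eq_iff ev_simps)
  qed
  moreover have "poly P (Var n) \<in> polyfuns (Suc n)" if "P \<in> ?S" for P
    unfolding poly_altdef using that polyfuns_mono[of n "Suc n"] is_subring_polyfuns[of "Suc n"]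
    by (auto intro!: subring_sum subring_mult subring_power Var_in_polyfuns simp: polys_over_def)
  moreover have "\<exists>P\<in>?S. f = ev (poly P (Var n))" if "f \<in> poly_funs (affine_coords (Suc n))" for f
    using that
  proof (induction rule: poly_funs.induct)
    case (const a)
    then show ?case using R by (intro bexI[of _ "[:Const a:]"]) (auto simp: const_polys_over)
  next
    case (coord f)
    then obtain i where i: "i < Suc n" "f = (\<lambda>z. z i)" by (auto simp: affine_coords_def)
    show ?case
    proof (cases "i = n")
      case True
      have "[:0, 1:] \<in> ?S" using R
        by (auto simp: polys_over_def coeff_pCons subringD split: nat.splits)
      then show ?thesis using True i by (intro bexI[of _ "[:0, 1:]"]) auto
    next
      case False
      then show ?thesis using i R
        by (intro bexI[of _ "[:Var i:]"]) (auto simp: const_polys_over Var_in_polyfuns)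
    qed
  next
    case (add f g)
    then show ?case using S by (metis (no_types, lifting) ev_simps(3) poly_add subring_add)
  next
    case (mult f g)
    then show ?case using S by (metis (no_types, lifting) ev_simps(4) poly_mult subring_mult)
  qed
  then have "polyfuns (Suc n) \<subseteq> (\<lambda>P. poly P (Var n)) ` ?S"
    by (fastforce simp: polyfuns_def ev_inject)
  ultimately show ?thesis unfolding bij_betw_def inj_on_def by blast
qed

lemma polyfuns_0: "f \<in> polyfuns 0 \<Longrightarrow> f \<noteq> 0 \<Longrightarrow> dvd_in (polyfuns 0) f 1"
proof -
  assume f: "f \<in> polyfuns 0" "f \<noteq> 0"
  \<comment> \<open>In no variables every function is constant, and \<open>undefined\<close> is just
    some point to evaluate at.\<close>
  have "ev f z = ev f undefined" for z using f by (intro ev_cong) auto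
  then show ?thesis using f
    by (intro dvd_inI[of "Const (1 / ev f undefined)"]) (auto simp: polyfun_eq_iff ev_simps)
qed

lemmas poly_Var_iso =
  prime_in_iso[of "polys_over (polyfuns n)" "\<lambda>P. poly P (Var n)", OF _ _ _ bij_betw_poly_Var
      polys_over_subring[OF is_subring_polyfuns], simplified] for n


lemma polyfuns_Suc_E:
  assumes "f \<in> polyfuns (Suc n)"
  obtains P where "P \<in> polys_over (polyfuns n)" "f = poly P (Var n)"
proof -
  have "f \<in> (\<lambda>P. poly P (Var n)) ` polys_over (polyfuns n)"
    unfolding bij_betw_imp_surj_on[OF bij_betw_poly_Var] by (rule assms)
  then show ?thesis by (rule imageE) (rule that)
qed

theorem is_ufd_polyfuns: "is_ufd (polyfuns n)"
proof (induction n)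
  case 0
  show ?case unfolding is_ufd_def
  proof (intro conjI ballI impI)
    show "is_subring (polyfuns 0)" by (rule is_subring_polyfuns)
    fix f assume "f \<in> polyfuns 0" "f \<noteq> 0"
    then have "prime_product (polyfuns 0) 0 f" by (intro prime_product.unit polyfuns_0)
    then show "\<exists>k. prime_product (polyfuns 0) k f" by (rule exI)
  qed
next
  case (Suc n)
  have "\<exists>k. prime_product (polyfuns (Suc n)) k f"
    if fn: "f \<in> polyfuns (Suc n)" "f \<noteq> 0" for f
  proof -
    obtain P where P: "P \<in> polys_over (polyfuns n)" "f = poly P (Var n)"
      using polyfuns_Suc_E[OF fn(1)] .
    have "P \<noteq> 0" using P(2) fn(2) by auto
    then obtain k where k: "prime_product (polys_over (polyfuns n)) k P"
      using is_ufd_polys_over[OF Suc] P(1) unfolding is_ufd_def by blast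
    have "prime_product (polyfuns (Suc n)) k (poly P (Var n))"
      by (rule prime_product_iso[OF _ _ _ bij_betw_poly_Var
            polys_over_subring[OF is_subring_polyfuns] k]) simp_all
    then show ?thesis unfolding P(2) by blast
  qed
  then show ?case by (simp add: is_ufd_def is_subring_polyfuns)
qed

text \<open>Converse of \<open>prime_in_polys_over\<close>; it serves primes that do not involve the
  last variable.\<close>

lemma prime_in_const_polys_over:
  fixes p :: "'a::idom"
  assumes R: "is_subring R" and p: "prime_in (polys_over R) [:p:]"
  shows "prime_in R p"
proof -
  have pR: "p \<in> R" using p R by (auto simp: prime_in_def const_polys_over)
  have D: "dvd_in (polys_over R) [:p:] [:a:] \<longleftrightarrow> dvd_in R p a" for a
  proof -
    have "dvd_in R p 0" using R by (auto simp: dvd_in_def subringD intro!: bexI[of _ 0])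
    then show ?thesis unfolding const_dvd_in[OF R pR]
      by (auto simp: coeff_pCons split: nat.splits)
  qed
  have "dvd_in R p a \<or> dvd_in R p b" if "a \<in> R" "b \<in> R" "dvd_in R p (a * b)" for a b
  proof -
    have "dvd_in (polys_over R) [:p:] ([:a:] * [:b:])" using that D[of "a * b"] by (simp add: mult.commute)
    then show ?thesis using p that R D by (meson prime_in_def const_polys_over)
  qed
  then show ?thesis using p pR D[of 1] by (auto simp: prime_in_def one_pCons)
qed

text \<open>Let x be the last variable. If \<open>p\<close> is free of x, a zero of \<open>p\<close>
  in the other variables is a zero for every x, so all coefficients of \<open>f\<close> vanish there
  and the induction hypothesis applies to each. Otherwise, if \<open>p\<close> did not divide
  \<open>f\<close>, some r = u * p + v * f would be nonzero and free of x. Over a point where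
  \<open>r\<close> and the leading coefficient of \<open>p\<close> are nonzero, \<open>p\<close> has
  a root in x; it is also a root of \<open>f\<close>, so \<open>r\<close> would vanish after
  all.\<close>

theorem hypersurface_nullstellensatz:
  "prime_in (polyfuns n) p \<Longrightarrow> f \<in> polyfuns n \<Longrightarrow> (\<And>z. ev p z = 0 \<Longrightarrow> ev f z = 0) \<Longrightarrow>
    dvd_in (polyfuns n) p f"
proof (induction n arbitrary: p f)
  case 0
  from 0(1) have "p \<in> polyfuns 0" "p \<noteq> 0" "\<not> dvd_in (polyfuns 0) p 1"
    unfolding prime_in_def by simp_all
  then show ?case using polyfuns_0 by blast
next
  case (Suc n)
  let ?R = "polyfuns n" and ?S = "polys_over (polyfuns n)"
  note R = is_subring_polyfuns[of n]
  note S = polys_over_subring[OF R]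
  have "p \<in> polyfuns (Suc n)" using Suc.prems(1) by (simp add: prime_in_def)
  then obtain P where P: "P \<in> ?S" "p = poly P (Var n)" by (rule polyfuns_Suc_E)
  obtain F where F: "F \<in> ?S" "f = poly F (Var n)" using polyfuns_Suc_E[OF Suc.prems(2)] .
  have prime: "prime_in ?S P" using Suc.prems(1) unfolding P(2) poly_Var_iso(2)[OF P(1)] .
  then have P0: "P \<noteq> 0" by (simp add: prime_in_def)
  have van: "poly (slice F z) t = 0" if "poly (slice P z) t = 0" for z t
    using Suc.prems(3)[of "z(n := t)"] that
    unfolding P(2) F(2) ev_poly_Var[OF P(1)] ev_poly_Var[OF F(1)] by blast
  have "dvd_in ?S P F"
  proof (cases "degree P = 0")
    case True
    then obtain q where q: "P = [:q:]" using degree_eq_zeroE by blast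
    then have qp: "prime_in ?R q" using prime_in_const_polys_over[OF R] prime by simp
    have "dvd_in ?R q (coeff F i)" for i
    proof (rule Suc.IH[OF qp])
      show "coeff F i \<in> ?R" using F by (simp add: polys_over_def)
      fix z assume z: "ev q z = 0"
      have "slice P z = 0" using q z by (auto simp: poly_eq_iff coeff_slice coeff_pCons ev_simps split: nat.splits)
      then have "\<forall>t. poly (slice F z) t = 0" using van by simp
      then have "slice F z = 0" using poly_all_0_iff_0 by blast
      then show "ev (coeff F i) z = 0" by (metis coeff_slice coeff_0)
    qed
    then show ?thesis using q const_dvd_in[OF R, of q F] P R by (simp add: const_polys_over)
  next
    case False
    then consider "dvd_in ?S P F"
      | u v r where "u \<in> ?S" "v \<in> ?S" "r \<in> ?R" "r \<noteq> 0" "u * P + v * F = [:r:]"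
      using prime_divides_or_comaximal[OF is_ufd_polyfuns prime _ F(1)] by blast
    then show ?thesis
    proof cases
      case 2
      \<comment> \<open>The leading coefficient of \<open>P\<close> has to survive at
        \<open>z\<close>, lest the slice of \<open>P\<close> become constant and have no
        root.\<close>
      have "r * lead_coeff P \<noteq> 0" using 2 P0 by simp
      then obtain z where z: "ev (r * lead_coeff P) z \<noteq> 0" by (auto simp: polyfun_eq_iff ev_simps)
      then have "coeff (slice P z) (degree P) \<noteq> 0" by (simp add: coeff_slice ev_simps)
      then have "degree P \<le> degree (slice P z)" by (rule le_degree)
      then have "\<not> constant (poly (slice P z))" using False by (simp add: constant_degree)
      then obtain t where t: "poly (slice P z) t = 0" using fundamental_theorem_of_algebra by blast
      have eP: "ev (poly P (Var n)) (z(n := t)) = 0" "ev (poly F (Var n)) (z(n := t)) = 0"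
        unfolding ev_poly_Var[OF P(1)] ev_poly_Var[OF F(1)] using t van[OF t] by simp_all
      have "ev r (z(n := t)) = ev (poly (u * P + v * F) (Var n)) (z(n := t))" using 2 by simp
      also have "\<dots> = 0" by (simp add: ev_simps eP)
      finally have "ev r z = 0" using ev_cong[OF 2(3), of "z(n := t)" z] by simp
      then show ?thesis using z by (simp add: ev_simps)
    qed
  qed
  then show ?case unfolding P(2) F(2) poly_Var_iso(1)[OF P(1) F(1)] .
qed

section \<open>Regular functions on open subsets of affine space\<close>

text \<open>Open sets as unions of principal open sets, the form in which a single polynomial
  witnesses openness at a point.\<close>

lemma zariski_open_iff:
  "zariski_open X C U \<longleftrightarrow>
    U \<subseteq> X \<and> (\<forall>x\<in>U. \<exists>q\<in>poly_funs C. q x \<noteq> 0 \<and> (\<forall>y\<in>X. q y \<noteq> 0 \<longrightarrow> y \<in> U))"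
proof
  assume "zariski_open X C U"
  then show "U \<subseteq> X \<and> (\<forall>x\<in>U. \<exists>q\<in>poly_funs C. q x \<noteq> 0 \<and> (\<forall>y\<in>X. q y \<noteq> 0 \<longrightarrow> y \<in> U))"
    by (auto simp: zariski_open_def vanishing_locus_def)
next
  assume H: "U \<subseteq> X \<and> (\<forall>x\<in>U. \<exists>q\<in>poly_funs C. q x \<noteq> 0 \<and> (\<forall>y\<in>X. q y \<noteq> 0 \<longrightarrow> y \<in> U))"
  \<comment> \<open>The defining equations are all polynomials whose non-vanishing locus in
    \<open>X\<close> lies in \<open>U\<close>.\<close>
  show "zariski_open X C U" unfolding zariski_open_def vanishing_locus_def
    using H by (intro exI[of _ "{q \<in> poly_funs C. \<forall>y\<in>X. q y \<noteq> 0 \<longrightarrow> y \<in> U}"]) blast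
qed

text \<open>Expanding the fraction by a polynomial that is nonzero only inside the given
  neighbourhood lets the denominator alone describe the neighbourhood.\<close>

lemma regular_on_iff:
  assumes "U \<subseteq> X"
  shows "regular_on X C U f \<longleftrightarrow> (\<forall>x\<in>U. \<exists>p\<in>poly_funs C. \<exists>q\<in>poly_funs C.
    q x \<noteq> 0 \<and> (\<forall>y\<in>X. q y \<noteq> 0 \<longrightarrow> y \<in> U \<and> f y = p y / q y))"
proof
  assume L: "regular_on X C U f"
  show "\<forall>x\<in>U. \<exists>p\<in>poly_funs C. \<exists>q\<in>poly_funs C.
    q x \<noteq> 0 \<and> (\<forall>y\<in>X. q y \<noteq> 0 \<longrightarrow> y \<in> U \<and> f y = p y / q y)"
  proof
    fix x assume "x \<in> U"
    then obtain W p q where W: "zariski_open X C W" "x \<in> W" "W \<subseteq> U" "p \<in> poly_funs C"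
      "q \<in> poly_funs C" "\<And>y. y \<in> W \<Longrightarrow> q y \<noteq> 0 \<and> f y = p y / q y"
      using L unfolding regular_on_def by metis
    then obtain s where s: "s \<in> poly_funs C" "s x \<noteq> 0" "\<And>y. y \<in> X \<Longrightarrow> s y \<noteq> 0 \<Longrightarrow> y \<in> W"
      unfolding zariski_open_iff by metis
    show "\<exists>p\<in>poly_funs C. \<exists>q\<in>poly_funs C.
      q x \<noteq> 0 \<and> (\<forall>y\<in>X. q y \<noteq> 0 \<longrightarrow> y \<in> U \<and> f y = p y / q y)"
    proof (rule bexI[of _ "\<lambda>y. s y * p y"], rule bexI[of _ "\<lambda>y. s y * q y"], intro conjI ballI impI)
      show "(\<lambda>y. s y * p y) \<in> poly_funs C" "(\<lambda>y. s y * q y) \<in> poly_funs C"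
        using s W by (auto intro: poly_funs.mult)
    qed (use s W in auto)
  qed
next
  assume R: "\<forall>x\<in>U. \<exists>p\<in>poly_funs C. \<exists>q\<in>poly_funs C.
    q x \<noteq> 0 \<and> (\<forall>y\<in>X. q y \<noteq> 0 \<longrightarrow> y \<in> U \<and> f y = p y / q y)"
  show "regular_on X C U f" unfolding regular_on_def
  proof
    fix x assume x: "x \<in> U"
    then obtain p q where pq: "p \<in> poly_funs C" "q \<in> poly_funs C" "q x \<noteq> 0"
      "\<And>y. y \<in> X \<Longrightarrow> q y \<noteq> 0 \<Longrightarrow> y \<in> U \<and> f y = p y / q y" using R by metis
    have "zariski_open X C {y \<in> X. q y \<noteq> 0}" using pq by (auto simp: zariski_open_iff)
    then show "\<exists>W. zariski_open X C W \<and> x \<in> W \<and> W \<subseteq> U \<and>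
        (\<exists>p \<in> poly_funs C. \<exists>q \<in> poly_funs C. \<forall>y\<in>W. q y \<noteq> 0 \<and> f y = p y / q y)"
      using x pq assms by (intro exI[of _ "{y \<in> X. q y \<noteq> 0}"]) auto
  qed
qed

lemma zariski_open_subset: "zariski_open X C U \<Longrightarrow> U \<subseteq> X"
  by (simp add: zariski_open_iff)

lemma zariski_open_whole: "zariski_open X C X"
  by (auto simp: zariski_open_iff intro!: bexI[of _ "\<lambda>_. 1"] poly_funs.const)

lemma regular_on_poly_fun: "zariski_open X C U \<Longrightarrow> p \<in> poly_funs C \<Longrightarrow> regular_on X C U p"
proof (subst regular_on_iff)
  assume U: "zariski_open X C U" and p: "p \<in> poly_funs C"
  then show "U \<subseteq> X" by (simp add: zariski_open_subset)
  show "\<forall>x\<in>U. \<exists>p'\<in>poly_funs C. \<exists>q\<in>poly_funs C.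
    q x \<noteq> 0 \<and> (\<forall>y\<in>X. q y \<noteq> 0 \<longrightarrow> y \<in> U \<and> p y = p' y / q y)"
  proof
    fix x assume "x \<in> U"
    then obtain q where "q \<in> poly_funs C" "q x \<noteq> 0" "\<And>y. y \<in> X \<Longrightarrow> q y \<noteq> 0 \<Longrightarrow> y \<in> U"
      using U unfolding zariski_open_iff by metis
    then show "\<exists>p'\<in>poly_funs C. \<exists>q\<in>poly_funs C.
        q x \<noteq> 0 \<and> (\<forall>y\<in>X. q y \<noteq> 0 \<longrightarrow> y \<in> U \<and> p y = p' y / q y)"
      using poly_funs.mult[OF p] by (intro bexI[of _ "\<lambda>y. p y * q y"] bexI[of _ q]) auto
  qed
qed

lemma regular_on_cong:
  assumes "regular_on X C U f" and eq: "\<And>x. x \<in> U \<Longrightarrow> f x = g x"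
  shows "regular_on X C U g"
  unfolding regular_on_def
proof
  fix x assume "x \<in> U"
  then obtain W p q where "zariski_open X C W" "x \<in> W" "W \<subseteq> U" "p \<in> poly_funs C" "q \<in> poly_funs C"
    "\<forall>y\<in>W. q y \<noteq> 0 \<and> f y = p y / q y"
    using assms(1) unfolding regular_on_def by blast
  then show "\<exists>W. zariski_open X C W \<and> x \<in> W \<and> W \<subseteq> U \<and>
      (\<exists>p\<in>poly_funs C. \<exists>q\<in>poly_funs C. \<forall>y\<in>W. q y \<noteq> 0 \<and> g y = p y / q y)"
    using eq by (metis subsetD)
qed

lemma regular_on_zariski_open: "regular_on X C U f \<Longrightarrow> U \<subseteq> X \<Longrightarrow> zariski_open X C U"
  unfolding zariski_open_iff by (subst (asm) regular_on_iff) blast+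

lemma regular_on_mult:
  assumes f: "regular_on X C U f" and g: "regular_on X C V g" and UV: "U \<subseteq> X" "V \<subseteq> X"
  shows "regular_on X C (U \<inter> V) (\<lambda>x. f x * g x)"
proof (subst regular_on_iff)
  show "U \<inter> V \<subseteq> X" using UV by blast
  show "\<forall>x\<in>U \<inter> V. \<exists>p\<in>poly_funs C. \<exists>q\<in>poly_funs C. q x \<noteq> 0 \<and>
    (\<forall>y\<in>X. q y \<noteq> 0 \<longrightarrow> y \<in> U \<inter> V \<and> f y * g y = p y / q y)"
  proof
    fix x assume x: "x \<in> U \<inter> V"
    obtain p q where p: "p \<in> poly_funs C" "q \<in> poly_funs C" "q x \<noteq> 0"
      "\<And>y. y \<in> X \<Longrightarrow> q y \<noteq> 0 \<Longrightarrow> y \<in> U \<and> f y = p y / q y"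
      using f x unfolding regular_on_iff[OF UV(1)] by (metis IntD1)
    obtain p' q' where p': "p' \<in> poly_funs C" "q' \<in> poly_funs C" "q' x \<noteq> 0"
      "\<And>y. y \<in> X \<Longrightarrow> q' y \<noteq> 0 \<Longrightarrow> y \<in> V \<and> g y = p' y / q' y"
      using g x unfolding regular_on_iff[OF UV(2)] by (metis IntD2)
    show "\<exists>p\<in>poly_funs C. \<exists>q\<in>poly_funs C. q x \<noteq> 0 \<and>
      (\<forall>y\<in>X. q y \<noteq> 0 \<longrightarrow> y \<in> U \<inter> V \<and> f y * g y = p y / q y)"
    proof (rule bexI[of _ "\<lambda>y. p y * p' y"], rule bexI[of _ "\<lambda>y. q y * q' y"], intro conjI ballI impI)
      show "(\<lambda>y. p y * p' y) \<in> poly_funs C" "(\<lambda>y. q y * q' y) \<in> poly_funs C"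
        using p p' by (auto intro: poly_funs.mult)
    qed (use p p' in auto)
  qed
qed

text \<open>Read off from the domain of a product of two constant functions.\<close>

lemma zariski_open_Int: "zariski_open X C U \<Longrightarrow> zariski_open X C V \<Longrightarrow> zariski_open X C (U \<inter> V)"
  using regular_on_mult[OF regular_on_poly_fun[OF _ poly_funs.const]
      regular_on_poly_fun[OF _ poly_funs.const]] regular_on_zariski_open zariski_open_subset
  by (metis inf.coboundedI1)

lemma regular_on_inverse:
  assumes f: "regular_on X C U f" and U: "U \<subseteq> X" and nz: "\<And>x. x \<in> U \<Longrightarrow> f x \<noteq> 0"
  shows "regular_on X C U (\<lambda>x. 1 / f x)"
  unfolding regular_on_iff[OF U]
proof
  fix x assume x: "x \<in> U"
  obtain p q where p: "p \<in> poly_funs C" "q \<in> poly_funs C" "q x \<noteq> 0"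
    "\<And>y. y \<in> X \<Longrightarrow> q y \<noteq> 0 \<Longrightarrow> y \<in> U \<and> f y = p y / q y"
    using f x unfolding regular_on_iff[OF U] by metis
  have "p x \<noteq> 0" using nz[OF x] p(3) p(4)[of x] x U by auto
  show "\<exists>p\<in>poly_funs C. \<exists>q\<in>poly_funs C. q x \<noteq> 0 \<and>
    (\<forall>y\<in>X. q y \<noteq> 0 \<longrightarrow> y \<in> U \<and> 1 / f y = p y / q y)"
  \<comment> \<open>1 / f = q / p, expanded by \<open>q\<close>: where q * p is nonzero,
    \<open>q\<close> is nonzero as well, which puts the point in \<open>U\<close> and gives f = p /
    q there.\<close>
  proof (rule bexI[of _ "\<lambda>y. q y * q y"], rule bexI[of _ "\<lambda>y. q y * p y"], intro conjI ballI impI)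
    show "(\<lambda>y. q y * q y) \<in> poly_funs C" "(\<lambda>y. q y * p y) \<in> poly_funs C"
      using p by (auto intro: poly_funs.mult)
  qed (use p \<open>p x \<noteq> 0\<close> in auto)
qed

lemma regular_on_local:
  assumes "\<And>x. x \<in> U \<Longrightarrow> \<exists>V. x \<in> V \<and> V \<subseteq> U \<and> regular_on X C V f"
  shows "regular_on X C U f"
  unfolding regular_on_def
proof
  fix x assume "x \<in> U"
  then obtain V where "x \<in> V" "V \<subseteq> U" "regular_on X C V f" using assms by blast
  then show "\<exists>W. zariski_open X C W \<and> x \<in> W \<and> W \<subseteq> U \<and>
      (\<exists>p\<in>poly_funs C. \<exists>q\<in>poly_funs C. \<forall>y\<in>W. q y \<noteq> 0 \<and> f y = p y / q y)"
    unfolding regular_on_def by (meson subset_trans)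
qed

lemma poly_funs_pullback:
  assumes "f \<in> poly_funs C" "\<And>c. c \<in> C \<Longrightarrow> (\<lambda>y. c (F y)) \<in> poly_funs D"
  shows "(\<lambda>y. f (F y)) \<in> poly_funs D"
  using assms(1) by (induction rule: poly_funs.induct) (auto intro: poly_funs.intros assms(2))

lemma regular_on_pullback:
  assumes f: "regular_on X C U f" and U: "U \<subseteq> X" and F: "\<And>y. y \<in> Y \<Longrightarrow> F y \<in> X"
    and C: "\<And>c. c \<in> C \<Longrightarrow> (\<lambda>y. c (F y)) \<in> poly_funs D"
  shows "regular_on Y D {y \<in> Y. F y \<in> U} (\<lambda>y. f (F y))"
proof (subst regular_on_iff)
  show "\<forall>x\<in>{y \<in> Y. F y \<in> U}. \<exists>p\<in>poly_funs D. \<exists>q\<in>poly_funs D. q x \<noteq> 0 \<and>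
    (\<forall>y\<in>Y. q y \<noteq> 0 \<longrightarrow> y \<in> {y \<in> Y. F y \<in> U} \<and> f (F y) = p y / q y)"
  proof
    fix x assume x: "x \<in> {y \<in> Y. F y \<in> U}"
    obtain p q where p: "p \<in> poly_funs C" "q \<in> poly_funs C" "q (F x) \<noteq> 0"
      "\<And>y. y \<in> X \<Longrightarrow> q y \<noteq> 0 \<Longrightarrow> y \<in> U \<and> f y = p y / q y"
      using f x unfolding regular_on_iff[OF U] by blast
    show "\<exists>p\<in>poly_funs D. \<exists>q\<in>poly_funs D. q x \<noteq> 0 \<and>
      (\<forall>y\<in>Y. q y \<noteq> 0 \<longrightarrow> y \<in> {y \<in> Y. F y \<in> U} \<and> f (F y) = p y / q y)"
      using p poly_funs_pullback[OF p(1) C] poly_funs_pullback[OF p(2) C] F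
      by (intro bexI[of _ "\<lambda>y. p (F y)"] bexI[of _ "\<lambda>y. q (F y)"]) auto
  qed
qed auto

section \<open>Fractions in lowest terms and hypersurfaces\<close>

definition coprime_in :: "'a::comm_ring_1 set \<Rightarrow> 'a \<Rightarrow> 'a \<Rightarrow> bool" where
  "coprime_in R p q \<longleftrightarrow> (\<forall>w. prime_in R w \<longrightarrow> \<not> (dvd_in R w p \<and> dvd_in R w q))"

text \<open>Each common prime that is cancelled lowers the number of prime factors of
  \<open>q\<close>, so the process stops.\<close>

lemma reduce_fraction:
  fixes p q :: "'a::idom"
  assumes "prime_product R k q" and R: "is_subring R"
  shows "p \<in> R \<Longrightarrow> \<exists>p'\<in>R. \<exists>q'\<in>R. \<exists>d\<in>R. d \<noteq> 0 \<and> p = d * p' \<and> q = d * q' \<and> coprime_in R p' q'"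
  using assms(1)
proof (induction k arbitrary: p q)
  case 0
  then have "q \<in> R" "dvd_in R q 1" by (auto elim: prime_product.cases)
  then show ?case using 0 R prime_not_dvd_unit[OF R]
    by (intro bexI[of _ p] bexI[of _ q] bexI[of _ 1]) (auto simp: coprime_in_def subringD)
next
  case (Suc k)
  show ?case
  proof (cases "coprime_in R p q")
    case True
    then show ?thesis using R Suc prime_product_in[OF R Suc(3)]
      by (intro bexI[of _ p] bexI[of _ q] bexI[of _ 1]) (auto simp: subringD)
  next
    case False
    then obtain w where w: "prime_in R w" "dvd_in R w p" "dvd_in R w q" by (auto simp: coprime_in_def)
    obtain q1 where q1: "q = w * q1" "prime_product R k q1"
      using prime_product_dvd[OF Suc(3) R w(1,3)] by auto
    obtain p1 where p1: "p1 \<in> R" "p = w * p1" using w by (auto simp: dvd_in_def)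
    obtain p' q' d where "p' \<in> R" "q' \<in> R" "d \<in> R" "d \<noteq> 0" "p1 = d * p'" "q1 = d * q'"
      "coprime_in R p' q'" using Suc.IH[OF p1(1) q1(2)] by blast
    then show ?thesis using p1 q1 w R
      by (intro bexI[of _ p'] bexI[of _ q'] bexI[of _ "w * d"])
        (auto simp: mult.assoc prime_in_def subringD)
  qed
qed

text \<open>The primes of \<open>q\<close> are split off \<open>r\<close> one at a time, as
  coprimality keeps them from dividing \<open>p\<close>.\<close>

lemma coprime_dvd_cancel:
  fixes p :: "'a::idom"
  assumes "prime_product R k q" and R: "is_subring R" and p: "p \<in> R"
  shows "coprime_in R p q \<Longrightarrow> r \<in> R \<Longrightarrow> dvd_in R q (p * r) \<Longrightarrow> dvd_in R q r"
  using assms(1)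
proof (induction arbitrary: r rule: prime_product.induct[consumes 1, case_names unit step])
  case (unit u)
  then show ?case using R dvd_in_trans[OF R unit(2), of r] by (auto simp: dvd_in_def)
next
  case (step k f w)
  have wR: "w \<in> R" "w \<noteq> 0" using step by (auto simp: prime_in_def)
  have fR: "f \<in> R" using prime_product_in[OF R step(1)] .
  have wf: "dvd_in R w (w * f)" using fR by (auto intro: dvd_inI)
  then have "dvd_in R w (p * r)" using dvd_in_trans[OF R] step by blast
  then have "dvd_in R w p \<or> dvd_in R w r" using step p unfolding prime_in_def by blast
  then have "dvd_in R w r" using step(2,4) wf unfolding coprime_in_def by blast
  then obtain r' where r': "r' \<in> R" "r = w * r'" by (auto simp: dvd_in_def)
  obtain c where c: "c \<in> R" "p * r = w * f * c" using step by (auto simp: dvd_in_def)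
  then have "w * (p * r') = w * (f * c)" using r' by (simp add: algebra_simps)
  then have "p * r' = f * c" using wR by (subst (asm) mult_left_cancel) auto
  then have "dvd_in R f (p * r')" using c by (auto intro: dvd_inI)
  moreover have "coprime_in R p f"
    using step(4) dvd_in_mult2[OF R _ wR(1)] by (auto simp: coprime_in_def)
  ultimately have "dvd_in R f r'" using step r' by blast
  then show ?case using r' by (auto simp: dvd_in_def mult.assoc)
qed

lemma prime_multiplicity:
  fixes f :: "'a::idom"
  assumes "prime_product R k f" and R: "is_subring R" and p: "prime_in R p"
  shows "\<exists>i. \<exists>g\<in>R. f = p ^ i * g \<and> \<not> dvd_in R p g"
  using assms(1)
proof (induction k arbitrary: f rule: less_induct)
  case (less k)
  show ?case
  proof (cases "dvd_in R p f")
    case False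
    then show ?thesis using prime_product_in[OF R less(2)]
      by (intro exI[of _ 0] bexI[of _ f]) auto
  next
    case True
    then obtain j g where g: "k = Suc j" "f = p * g" "prime_product R j g"
      using prime_product_dvd[OF less(2) R p] by blast
    then obtain i h where "h \<in> R" "g = p ^ i * h" "\<not> dvd_in R p h" using less(1)[of j g] by auto
    then show ?thesis using g by (intro exI[of _ "Suc i"] bexI[of _ h]) (auto simp: mult.assoc)
  qed
qed

lemma prime_not_dvd_mult:
  "prime_in R p \<Longrightarrow> a \<in> R \<Longrightarrow> b \<in> R \<Longrightarrow> \<not> dvd_in R p a \<Longrightarrow> \<not> dvd_in R p b \<Longrightarrow> \<not> dvd_in R p (a * b)"
  by (auto simp: prime_in_def)

lemma ev_dvd_zero: "dvd_in R p f \<Longrightarrow> ev p z = 0 \<Longrightarrow> ev f z = 0"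
  by (auto simp: dvd_in_def ev_simps)

lemma vanishing_prime_factor:
  assumes "prime_product (polyfuns n) k f" "ev f z = 0"
  shows "\<exists>p. prime_in (polyfuns n) p \<and> dvd_in (polyfuns n) p f \<and> ev p z = 0"
  using assms
proof (induction rule: prime_product.induct)
  case (unit u)
  then have "ev 1 z = 0" using ev_dvd_zero by blast
  then show ?case by (simp add: ev_simps)
next
  case (step k f p)
  note R = is_subring_polyfuns[of n]
  show ?case
  proof (cases "ev p z = 0")
    case True
    then show ?thesis using step prime_product_in[OF R] by (blast intro: dvd_inI)
  next
    case False
    then obtain q where "prime_in (polyfuns n) q" "dvd_in (polyfuns n) q f" "ev q z = 0"
      using step by (auto simp: ev_simps)
    then show ?thesis using dvd_in_mult2[OF R] step(2) by (auto simp: prime_in_def)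
  qed
qed

text \<open>Points of \<open>affine_space n\<close> are \<open>undefined\<close> from index
  \<open>n\<close> on, while elements of \<open>polyfun\<close> are evaluated at arbitrary
  sequences. The cut-off passes from one to the other.\<close>

lemma ev_affine_cong:
  "f \<in> polyfuns n \<Longrightarrow> ev f (restrict z {..<n}) = ev f z"
  by (rule ev_cong) auto

lemma polyfun_zero_affine:
  assumes "f \<in> polyfuns n" "\<And>z. z \<in> affine_space n \<Longrightarrow> ev f z = 0"
  shows "f = 0"
proof -
  have "ev f z = 0" for z
    using assms(2)[of "restrict z {..<n}"] ev_affine_cong[OF assms(1)]
    by (auto simp: affine_space_def)
  then show ?thesis by (simp add: polyfun_eq_iff ev_simps)
qed

text \<open>The product f * g vanishes on all of affine space, and there are no zero
  divisors.\<close>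

lemma zero_on_dense:
  assumes "f \<in> polyfuns n" "g \<in> polyfuns n" "g \<noteq> 0"
    "\<And>z. z \<in> affine_space n \<Longrightarrow> ev g z \<noteq> 0 \<Longrightarrow> ev f z = 0"
  shows "f = 0"
proof -
  have "f * g = 0"
    using assms is_subring_polyfuns[of n]
    by (intro polyfun_zero_affine[of _ n]) (auto simp: subringD ev_simps)
  then show ?thesis using assms by simp
qed

text \<open>Two nonempty open parts of the hypersurface p = 0 meet: otherwise g * g' vanishes on it,
  and by the Nullstellensatz the prime \<open>p\<close> divides \<open>g\<close> or
  \<open>g'\<close>. The point \<open>y\<close> rules out the former.\<close>

lemma hypersurface_irreducible:
  assumes p: "prime_in (polyfuns n) p" and y: "ev p y = 0" "ev g y \<noteq> 0" "g \<in> polyfuns n"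
    and g': "g' \<in> polyfuns n" "\<not> dvd_in (polyfuns n) p g'"
  shows "\<exists>z\<in>affine_space n. ev p z = 0 \<and> ev g z \<noteq> 0 \<and> ev g' z \<noteq> 0"
proof (rule ccontr)
  assume *: "\<not> ?thesis"
  note R = is_subring_polyfuns[of n]
  have pR: "p \<in> polyfuns n" using p by (simp add: prime_in_def)
  have "dvd_in (polyfuns n) p (g * g')"
  proof (rule hypersurface_nullstellensatz[OF p])
    show "g * g' \<in> polyfuns n" using y g' R by (simp add: subringD)
    fix z assume z: "ev p z = 0"
    have "restrict z {..<n} \<in> affine_space n" by (simp add: affine_space_def)
    then show "ev (g * g') z = 0"
      using * z ev_affine_cong[OF pR, of z] ev_affine_cong[OF y(3), of z]
        ev_affine_cong[OF g'(1), of z] by (auto simp: ev_simps)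
  qed
  moreover have "\<not> dvd_in (polyfuns n) p g" using y ev_dvd_zero by blast
  ultimately show False using p y g' by (auto simp: prime_in_def)
qed

lemma ufd_prime_product:
  "f \<in> polyfuns n \<Longrightarrow> f \<noteq> 0 \<Longrightarrow> \<exists>k. prime_product (polyfuns n) k f"
  using is_ufd_polyfuns[of n] by (simp add: is_ufd_def)

locale affine_open =
  fixes n :: nat and Z :: "(nat \<Rightarrow> complex) set"
  assumes Z_open: "zariski_open (affine_space n) (affine_coords n) Z"
begin

abbreviation "R \<equiv> polyfuns n"
abbreviation "C \<equiv> affine_coords n"

lemmas subringR = subringD[OF is_subring_polyfuns[of n]]

text \<open>As \<open>Z\<close> is open, the basic open set can be cut out of the whole affine
  space, where density and the Nullstellensatz are available.\<close>

lemma open_basis: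
  assumes "zariski_open Z C W" "x \<in> W"
  obtains g where "g \<in> R" "ev g x \<noteq> 0" "\<And>y. y \<in> affine_space n \<Longrightarrow> ev g y \<noteq> 0 \<Longrightarrow> y \<in> W"
proof -
  obtain q where q: "q \<in> poly_funs C" "q x \<noteq> 0" "\<And>y. y \<in> Z \<Longrightarrow> q y \<noteq> 0 \<Longrightarrow> y \<in> W" "x \<in> Z"
    using assms unfolding zariski_open_iff by blast
  obtain s where s: "s \<in> poly_funs C" "s x \<noteq> 0" "\<And>y. y \<in> affine_space n \<Longrightarrow> s y \<noteq> 0 \<Longrightarrow> y \<in> Z"
    using Z_open q unfolding zariski_open_iff by blast
  obtain g where "g \<in> R" "(\<lambda>y. s y * q y) = ev g"
    using poly_funs_eq_ev[OF poly_funs.mult[OF s(1) q(1)]] .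
  then show ?thesis using that[of g] q s by (metis mult_eq_0_iff)
qed

text \<open>Local fractions agree on a dense set, so p * q1 = p1 * q as polynomials. If p / q is in
  lowest terms, \<open>q\<close> divides each local denominator q1 and therefore has no zero on
  \<open>W\<close>: one fraction serves the whole of \<open>W\<close>.\<close>

lemma regular_global_fraction:
  assumes f: "regular_on Z C W f" and W: "W \<subseteq> Z"
  shows "\<exists>p\<in>R. \<exists>q\<in>R. coprime_in R p q \<and> (\<forall>x\<in>W. ev q x \<noteq> 0 \<and> f x = ev p x / ev q x)"
proof -
  have Wo: "zariski_open Z C W" using regular_on_zariski_open[OF f W] .
  have loc: "\<exists>p\<in>R. \<exists>q\<in>R. \<exists>g\<in>R. ev g x \<noteq> 0 \<and> (\<forall>y\<in>affine_space n. ev g y \<noteq> 0 \<longrightarrow>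
      y \<in> W \<and> ev q y \<noteq> 0 \<and> f y = ev p y / ev q y)" if x: "x \<in> W" for x
  proof -
    obtain p q where "p \<in> poly_funs C" "q \<in> poly_funs C" "q x \<noteq> 0"
      and fq: "\<And>y. y \<in> Z \<Longrightarrow> q y \<noteq> 0 \<Longrightarrow> y \<in> W \<and> f y = p y / q y"
      using f x unfolding regular_on_iff[OF W] by blast
    then obtain P Q where PQ: "P \<in> R" "p = ev P" "Q \<in> R" "q = ev Q"
      by (metis poly_funs_eq_ev)
    obtain g where "g \<in> R" "ev g x \<noteq> 0" "\<And>y. y \<in> affine_space n \<Longrightarrow> ev g y \<noteq> 0 \<Longrightarrow> y \<in> W"
      using open_basis[OF Wo x] by metis
    then show ?thesis using PQ fq W \<open>q x \<noteq> 0\<close>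
      by (intro bexI[of _ P] bexI[of _ Q] bexI[of _ "g * Q"]) (auto simp: ev_simps subringR)
  qed
  show ?thesis
  proof (cases "W = {}")
    case True
    have "coprime_in R 0 1" by (auto simp: coprime_in_def prime_in_def)
    then show ?thesis using True by (intro bexI[of _ 0] bexI[of _ 1]) (auto simp: subringR)
  next
    case False
    then obtain x0 where x0: "x0 \<in> W" by blast
    then obtain p0 q0 g0 where 0: "p0 \<in> R" "q0 \<in> R" "g0 \<in> R" "ev g0 x0 \<noteq> 0"
      "\<And>y. y \<in> affine_space n \<Longrightarrow> ev g0 y \<noteq> 0 \<Longrightarrow> y \<in> W \<and> ev q0 y \<noteq> 0 \<and> f y = ev p0 y / ev q0 y"
      using loc by metis
    have g0: "g0 \<noteq> 0" using 0(4) by (auto simp: ev_simps)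
    have xA: "x \<in> affine_space n" if "x \<in> W" for x
      using that W zariski_open_subset[OF Z_open] by blast
    have "q0 \<noteq> 0" using 0(4,5) xA[OF x0] by (auto simp: ev_simps)
    then obtain k where "prime_product R k q0" using ufd_prime_product 0 by blast
    then obtain p q d where pq: "p \<in> R" "q \<in> R" "d \<in> R" "d \<noteq> 0" "p0 = d * p" "q0 = d * q"
      "coprime_in R p q" using reduce_fraction[OF _ is_subring_polyfuns 0(1)] by blast
    have q0: "q \<noteq> 0" using pq \<open>q0 \<noteq> 0\<close> by auto
    then obtain j where j: "prime_product R j q" using ufd_prime_product pq by blast
    have "ev q x \<noteq> 0 \<and> f x = ev p x / ev q x" if x: "x \<in> W" for x
    proof -
      obtain p1 q1 g1 where 1: "p1 \<in> R" "q1 \<in> R" "g1 \<in> R" "ev g1 x \<noteq> 0"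
        "\<And>y. y \<in> affine_space n \<Longrightarrow> ev g1 y \<noteq> 0 \<Longrightarrow> y \<in> W \<and> ev q1 y \<noteq> 0 \<and> f y = ev p1 y / ev q1 y"
        using loc[OF x] by metis
      have g1: "g1 \<noteq> 0" using 1(4) by (auto simp: ev_simps)
      have "p * q1 - p1 * q = 0"
      proof (rule zero_on_dense[of _ n "g0 * g1"])
        fix z assume z: "z \<in> affine_space n" "ev (g0 * g1) z \<noteq> 0"
        then have "ev q0 z \<noteq> 0" "ev q1 z \<noteq> 0" "ev p0 z / ev q0 z = ev p1 z / ev q1 z"
          using 0(5)[of z] 1(5)[of z] by (auto simp: ev_simps)
        then show "ev (p * q1 - p1 * q) z = 0" by (simp add: pq ev_simps field_simps)
      qed (use g0 g1 0 1 pq in \<open>auto simp: subringR\<close>)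
      then have eq: "p * q1 = p1 * q" by simp
      then have "dvd_in R q (p * q1)" using 1 by (intro dvd_inI[of p1]) auto
      then have "dvd_in R q q1"
        using coprime_dvd_cancel[OF j is_subring_polyfuns pq(1,7) 1(2)] by blast
      then obtain c where c: "c \<in> R" "q1 = q * c" by (auto simp: dvd_in_def)
      then have "q * (p * c) = q * p1" using eq by (simp add: mult_ac)
      then have "p1 = p * c" using q0 by simp
      then show ?thesis using 1(4,5) xA[OF x] c by (auto simp: ev_simps)
    qed
    then show ?thesis using pq by blast
  qed
qed

end

section \<open>Triviality of line bundle cocycles\<close>

context affine_open
begin

text \<open>The cocycle \<open>f\<close> is a coboundary outside the hypersurface s = 0, by one
  fraction per chart without zeros or poles there. The goal is the case s = 1.\<close>

definition trivial_off where
  "trivial_off I U f s \<longleftrightarrow> (\<exists>h.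
     (\<forall>i\<in>I. \<exists>p\<in>R. \<exists>q\<in>R. \<forall>x\<in>U i. ev s x \<noteq> 0 \<longrightarrow>
        ev p x \<noteq> 0 \<and> ev q x \<noteq> 0 \<and> h i x = ev p x / ev q x) \<and>
     (\<forall>i\<in>I. \<forall>j\<in>I. \<forall>x\<in>U i \<inter> U j. ev s x \<noteq> 0 \<longrightarrow> h j x = f i j x * h i x))"

lemma open_dense:
  assumes "zariski_open Z C W" "W \<noteq> {}" "s \<in> R" "s \<noteq> 0" "f \<in> R"
    and "\<And>z. z \<in> W \<Longrightarrow> ev s z \<noteq> 0 \<Longrightarrow> ev f z = 0"
  shows "f = 0"
proof -
  obtain x where "x \<in> W" using assms by blast
  then obtain g where g: "g \<in> R" "ev g x \<noteq> 0" "\<And>y. y \<in> affine_space n \<Longrightarrow> ev g y \<noteq> 0 \<Longrightarrow> y \<in> W"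
    using open_basis[OF assms(1)] by metis
  have "g \<noteq> 0" using g(2) by (auto simp: ev_simps)
  then show ?thesis using assms g
    by (intro zero_on_dense[of f n "g * s"]) (auto simp: ev_simps subringR)
qed

lemma open_meets:
  assumes "zariski_open Z C W" "W \<noteq> {}" "s \<in> R" "s \<noteq> 0"
  obtains z where "z \<in> W" "ev s z \<noteq> 0"
  using open_dense[OF assms, of 1] that subringR(1) by force

text \<open>Extends \<open>reduce_fraction\<close> to q = 0, with 1 / 0 as the reduced form, so that
  the choice in \<open>trivial_off_remove_prime\<close> can run over all charts, including empty
  ones, about whose fractions nothing is known.\<close>

lemma reduced_fraction:
  assumes p: "p \<in> R" and q: "q \<in> R"
  shows "\<exists>p' q' d. p' \<in> R \<and> q' \<in> R \<and> coprime_in R p' q' \<and> p = d * p' \<and> q = d * q'"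
proof (cases "q = 0")
  case True
  have "coprime_in R 1 0" by (auto simp: coprime_in_def prime_in_def)
  then show ?thesis using True by (intro exI[of _ 1] exI[of _ 0] exI[of _ p]) (auto simp: subringR)
next
  case False
  then show ?thesis using ufd_prime_product[OF q] reduce_fraction[OF _ is_subring_polyfuns p] by metis
qed

text \<open>A power of \<open>w\<close> makes the given trivialization a unit along \<open>w = 0\<close> in one chart meeting this
  hypersurface. As any two such charts meet along \<open>w = 0\<close>, it is then a unit in all of them.\<close>

lemma trivial_off_remove_prime:
  assumes op: "\<And>i. i \<in> I \<Longrightarrow> zariski_open Z C (U i)"
    and cover: "(\<Union>i\<in>I. U i) = Z"
    and reg: "\<And>i j. i \<in> I \<Longrightarrow> j \<in> I \<Longrightarrow> regular_on Z C (U i \<inter> U j) (f i j)"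
    and nz: "\<And>i j x. i \<in> I \<Longrightarrow> j \<in> I \<Longrightarrow> x \<in> U i \<inter> U j \<Longrightarrow> f i j x \<noteq> 0"
    and w: "prime_in R w" and s: "s \<in> R" "s \<noteq> 0" and triv: "trivial_off I U f (w * s)"
  shows "trivial_off I U f s"
proof -
  have wR: "w \<in> R" "w \<noteq> 0" using w by (auto simp: prime_in_def)
  have ws: "w * s \<in> R" "w * s \<noteq> 0" using wR s by (auto simp: subringR)
  have UZ: "U i \<subseteq> Z" if "i \<in> I" for i using op[OF that] zariski_open_subset by blast
  have ZA: "Z \<subseteq> affine_space n" using zariski_open_subset[OF Z_open] .
  obtain h where
      H: "\<forall>i\<in>I. \<exists>p\<in>R. \<exists>q\<in>R. \<forall>x\<in>U i. ev (w * s) x \<noteq> 0 \<longrightarrow>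
        ev p x \<noteq> 0 \<and> ev q x \<noteq> 0 \<and> h i x = ev p x / ev q x"
    and h: "\<And>i j x. i \<in> I \<Longrightarrow> j \<in> I \<Longrightarrow> x \<in> U i \<inter> U j \<Longrightarrow> ev (w * s) x \<noteq> 0 \<Longrightarrow>
        h j x = f i j x * h i x"
    using triv unfolding trivial_off_def by blast
  obtain P where P': "\<forall>i\<in>I. P i \<in> R \<and> (\<exists>q\<in>R. \<forall>x\<in>U i. ev (w * s) x \<noteq> 0 \<longrightarrow>
        ev (P i) x \<noteq> 0 \<and> ev q x \<noteq> 0 \<and> h i x = ev (P i) x / ev q x)"
    using bchoice[OF H[unfolded Bex_def]] by (auto simp: Bex_def)
  then have "\<forall>i\<in>I. \<exists>q. q \<in> R \<and> (\<forall>x\<in>U i. ev (w * s) x \<noteq> 0 \<longrightarrow>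
        ev (P i) x \<noteq> 0 \<and> ev q x \<noteq> 0 \<and> h i x = ev (P i) x / ev q x)" by blast
  from bchoice[OF this] obtain Q where P: "\<And>i. i \<in> I \<Longrightarrow> P i \<in> R" "\<And>i. i \<in> I \<Longrightarrow> Q i \<in> R"
    and PQ: "\<And>i x. i \<in> I \<Longrightarrow> x \<in> U i \<Longrightarrow> ev (w * s) x \<noteq> 0 \<Longrightarrow>
        ev (P i) x \<noteq> 0 \<and> ev (Q i) x \<noteq> 0 \<and> h i x = ev (P i) x / ev (Q i) x"
    using P' by blast
  have PQ0: "P i \<noteq> 0" "Q i \<noteq> 0" if i: "i \<in> I" and x: "x \<in> U i" for i x
  proof -
    obtain z where "z \<in> U i" "ev (w * s) z \<noteq> 0" using open_meets[OF op[OF i] _ ws] x by blast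
    then show "P i \<noteq> 0" "Q i \<noteq> 0" using PQ[OF i, of z] by (auto simp: ev_simps(1))
  qed
  show ?thesis
  proof (cases "\<exists>y\<in>Z. ev w y = 0 \<and> ev s y \<noteq> 0")
    case False
    \<comment> \<open>If w = 0 misses the part of \<open>Z\<close> where \<open>s\<close> is
      nonzero, the old trivialization already works.\<close>
    then have *: "ev s x \<noteq> 0 \<longleftrightarrow> ev (w * s) x \<noteq> 0" if "x \<in> U i" "i \<in> I" for i x
      using that UZ by (auto simp: ev_simps)
    show ?thesis unfolding trivial_off_def
    proof (intro exI[of _ h] conjI ballI impI)
      fix i assume "i \<in> I"
      then show "\<exists>p\<in>R. \<exists>q\<in>R. \<forall>x\<in>U i. ev s x \<noteq> 0 \<longrightarrow>
        ev p x \<noteq> 0 \<and> ev q x \<noteq> 0 \<and> h i x = ev p x / ev q x"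
        using P PQ * by (intro bexI[of _ "P i"] bexI[of _ "Q i"]) auto
    next
      fix i j x assume ij: "i \<in> I" "j \<in> I" "x \<in> U i \<inter> U j" "ev s x \<noteq> 0"
      then have "ev (w * s) x \<noteq> 0" using *[of x i] by blast
      then show "h j x = f i j x * h i x" by (rule h[OF ij(1-3)])
    qed
  next
    case True
    then obtain y0 a where a: "a \<in> I" "y0 \<in> U a" "ev w y0 = 0" "ev s y0 \<noteq> 0" using cover by blast
    \<comment> \<open>\<open>i0\<close> and \<open>j0\<close> are the multiplicities of
      \<open>w\<close> in the numerator and the denominator of the chart \<open>a\<close>.
      Multiplying every \<open>h\<close> by w^j0 / w^i0 removes the zero or pole along w = 0 in this
      chart, and a common factor does not disturb the relations between charts.\<close>
    obtain i0 p' where p': "p' \<in> R" "P a = w ^ i0 * p'" "\<not> dvd_in R w p'"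
      using prime_multiplicity[OF _ is_subring_polyfuns w] ufd_prime_product P PQ0[OF a(1,2)] a(1) by metis
    obtain j0 q' where q': "q' \<in> R" "Q a = w ^ j0 * q'" "\<not> dvd_in R w q'"
      using prime_multiplicity[OF _ is_subring_polyfuns w] ufd_prime_product P PQ0[OF a(1,2)] a(1) by metis
    have "\<exists>p q d. p \<in> R \<and> q \<in> R \<and> coprime_in R p q \<and> P i * w ^ j0 = d * p \<and> Q i * w ^ i0 = d * q"
      if i: "i \<in> I" for i
      using P[OF i] wR subring_power[OF is_subring_polyfuns] by (intro reduced_fraction) (simp_all add: subringR)
    then obtain p q d where pq: "\<And>i. i \<in> I \<Longrightarrow> p i \<in> R" "\<And>i. i \<in> I \<Longrightarrow> q i \<in> R"
      "\<And>i. i \<in> I \<Longrightarrow> coprime_in R (p i) (q i)" "\<And>i. i \<in> I \<Longrightarrow> P i * w ^ j0 = d i * p i"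
      "\<And>i. i \<in> I \<Longrightarrow> Q i * w ^ i0 = d i * q i" by metis
    have off: "ev (p i) x \<noteq> 0 \<and> ev (q i) x \<noteq> 0 \<and>
        ev (p i) x / ev (q i) x = h i x * (ev w x ^ j0 / ev w x ^ i0)"
      if i: "i \<in> I" and x: "x \<in> U i" and wsx: "ev (w * s) x \<noteq> 0" for i x
    proof -
      have e: "ev (P i) x * ev w x ^ j0 = ev (d i) x * ev (p i) x"
        "ev (Q i) x * ev w x ^ i0 = ev (d i) x * ev (q i) x"
        using arg_cong[OF pq(4)[OF i], of "\<lambda>f. ev f x"] arg_cong[OF pq(5)[OF i], of "\<lambda>f. ev f x"]
        by (simp_all add: ev_simps)
      have n: "ev (P i) x \<noteq> 0" "ev (Q i) x \<noteq> 0" "ev w x \<noteq> 0" "h i x = ev (P i) x / ev (Q i) x"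
        using PQ[OF i x wsx] wsx by (auto simp: ev_simps)
      then have nn: "ev (d i) x \<noteq> 0" "ev (p i) x \<noteq> 0" "ev (q i) x \<noteq> 0" using e by auto
      have "h i x * (ev w x ^ j0 / ev w x ^ i0) =
          (ev (P i) x * ev w x ^ j0) / (ev (Q i) x * ev w x ^ i0)" using n by simp
      also have "\<dots> = ev (p i) x / ev (q i) x" unfolding e using nn by simp
      finally show ?thesis using nn by simp
    qed
    \<comment> \<open>The corrected fraction of the chart \<open>a\<close> is also p' / q', neither
      part of which is divisible by \<open>w\<close>.\<close>
    have eq_a: "p a * q' = q a * p'"
    proof -
      have "P a * w ^ j0 * q a = d a * q a * p a" unfolding pq(4)[OF a(1)] by (simp only: mult_ac)
      also have "\<dots> = Q a * w ^ i0 * p a" unfolding pq(5)[OF a(1)] ..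
      finally have "P a * w ^ j0 * q a = Q a * w ^ i0 * p a" .
      then have "(w ^ i0 * w ^ j0) * (q a * p') = (w ^ i0 * w ^ j0) * (p a * q')"
        by (simp add: p' q' mult_ac)
      then show ?thesis using wR by simp
    qed
    have w_a: "\<not> dvd_in R w (p a)" "\<not> dvd_in R w (q a)"
    proof -
      have pa: "p a \<in> R" "q a \<in> R" "coprime_in R (p a) (q a)" using pq a by auto
      have "dvd_in R w (q a)" if "dvd_in R w (p a)"
      proof -
        have "dvd_in R w (q a * p')" unfolding eq_a[symmetric]
          using dvd_in_mult[OF is_subring_polyfuns that q'(1)] .
        then show ?thesis using w p' pa by (auto simp: prime_in_def)
      qed
      moreover have "dvd_in R w (p a)" if "dvd_in R w (q a)"
      proof -
        have "dvd_in R w (p a * q')" unfolding eq_a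
          using dvd_in_mult[OF is_subring_polyfuns that p'(1)] .
        then show ?thesis using w q' pa by (auto simp: prime_in_def)
      qed
      ultimately show "\<not> dvd_in R w (p a)" "\<not> dvd_in R w (q a)"
        using pa(3) w unfolding coprime_in_def by blast+
    qed
    \<comment> \<open>Cleared of denominators, the relation between two charts holds on a dense set
      and thus as an identity of polynomials, in which divisibility by \<open>w\<close> can be
      traced.\<close>
    have cross: "\<exists>A\<in>R. \<exists>B\<in>R. (\<forall>x\<in>U i \<inter> U j. ev A x \<noteq> 0 \<and> ev B x \<noteq> 0 \<and> f i j x = ev A x / ev B x)
        \<and> (U i \<inter> U j \<noteq> {} \<longrightarrow> p j * q i * B = q j * A * p i)"
      if i: "i \<in> I" and j: "j \<in> I" for i j
    proof -
      obtain A B where AB: "A \<in> R" "B \<in> R"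
        and fAB: "\<And>x. x \<in> U i \<inter> U j \<Longrightarrow> ev B x \<noteq> 0 \<and> f i j x = ev A x / ev B x"
        using regular_global_fraction[OF reg[OF i j]] UZ[OF i] by blast
      have A0: "ev A x \<noteq> 0" if "x \<in> U i \<inter> U j" for x using nz[OF i j that] fAB[OF that] by auto
      have "p j * q i * B - q j * A * p i = 0" if "U i \<inter> U j \<noteq> {}"
      proof (rule open_dense[OF zariski_open_Int[OF op[OF i] op[OF j]] that ws])
        show "p j * q i * B - q j * A * p i \<in> R" using pq i j AB by (simp add: subringR)
        fix z assume z: "z \<in> U i \<inter> U j" "ev (w * s) z \<noteq> 0"
        have "ev (p j) z / ev (q j) z = f i j z * (ev (p i) z / ev (q i) z)"
          using off[OF i _ z(2)] off[OF j _ z(2)] h[OF i j z] z by simp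
        then have "ev (p j) z / ev (q j) z = (ev A z / ev B z) * (ev (p i) z / ev (q i) z)"
          using fAB[OF z(1)] by simp
        moreover have "ev (q j) z \<noteq> 0" "ev (q i) z \<noteq> 0" "ev B z \<noteq> 0"
          using off[OF i _ z(2)] off[OF j _ z(2)] fAB z by auto
        ultimately show "ev (p j * q i * B - q j * A * p i) z = 0"
          by (simp add: ev_simps field_simps)
      qed
      then show ?thesis using AB fAB A0 by (intro bexI[of _ A] bexI[of _ B]) auto
    qed
    \<comment> \<open>A zero of \<open>F\<close> lies on v = 0 for some prime factor
      \<open>v\<close>. If \<open>v\<close> does not divide \<open>w\<close>, that hypersurface has
      a point of \<open>U i\<close> off w * s = 0, where \<open>F\<close> cannot vanish. If it does,
      \<open>v\<close> is associated to \<open>w\<close>, and comparison with the chart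
      \<open>a\<close> decides.\<close>
    have unit: "ev F y \<noteq> 0"
      if i: "i \<in> I" and y: "y \<in> U i" and sy: "ev s y \<noteq> 0" and F: "F = p i \<or> F = q i" for i y F
    proof
      assume Fy: "ev F y = 0"
      have FR: "F \<in> R" using F pq i by auto
      have F_off: "ev F x \<noteq> 0" if "x \<in> U i" "ev (w * s) x \<noteq> 0" for x
        using off[OF i that] F by auto
      have "F \<noteq> 0"
      proof -
        obtain z where "z \<in> U i" "ev (w * s) z \<noteq> 0" using open_meets[OF op[OF i] _ ws] y by blast
        then show ?thesis using F_off[of z] by (auto simp: ev_simps(1))
      qed
      then obtain v where v: "prime_in R v" "dvd_in R v F" "ev v y = 0"
        using ufd_prime_product[OF FR] vanishing_prime_factor Fy by blast
      obtain g where g: "g \<in> R" "ev g y \<noteq> 0" "\<And>y. y \<in> affine_space n \<Longrightarrow> ev g y \<noteq> 0 \<Longrightarrow> y \<in> U i"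
        using open_basis[OF op[OF i] y] by metis
      have gs: "g * s \<in> R" "ev (g * s) y \<noteq> 0" using g s sy by (auto simp: subringR ev_simps)
      show False
      proof (cases "dvd_in R v w")
        case False
        obtain z where z: "z \<in> affine_space n" "ev v z = 0" "ev (g * s) z \<noteq> 0" "ev w z \<noteq> 0"
          using hypersurface_irreducible[OF v(1,3) gs(2,1) wR(1) False] by blast
        then have "ev F z \<noteq> 0" using g(3) by (intro F_off) (auto simp: ev_simps)
        then show False using ev_dvd_zero[OF v(2) z(2)] by simp
      next
        case True
        then obtain u where u: "u \<in> R" "w = v * u" "dvd_in R u 1"
          using prime_dvd_prime[OF is_subring_polyfuns v(1) w] by blast
        then have wy: "ev w y = 0" using v(3) by (simp add: ev_simps)
        have wF: "dvd_in R w F"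
        proof -
          obtain u' where u': "u' \<in> R" "1 = u * u'" using u by (auto simp: dvd_in_def)
          then have "v = w * u'" using u by (metis mult.assoc mult.right_neutral)
          then have "dvd_in R w v" using u' by (auto intro: dvd_inI)
          then show ?thesis using v(2) dvd_in_trans[OF is_subring_polyfuns] by blast
        qed
        obtain g' where g': "g' \<in> R" "ev g' y0 \<noteq> 0"
          "\<And>y. y \<in> affine_space n \<Longrightarrow> ev g' y \<noteq> 0 \<Longrightarrow> y \<in> U a"
          using open_basis[OF op[OF a(1)] a(2)] by metis
        have "\<not> dvd_in R w g'" using g'(2) a(3) ev_dvd_zero by blast
        \<comment> \<open>Irreducibility of w = 0 gives a common point of the charts
          \<open>i\<close> and \<open>a\<close> on it. The transition function has neither zero nor
          pole there, so \<open>w\<close> divides neither \<open>A\<close> nor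
          \<open>B\<close>.\<close>
        then obtain z where z: "z \<in> affine_space n" "ev w z = 0" "ev (g * s) z \<noteq> 0" "ev g' z \<noteq> 0"
          using hypersurface_irreducible[OF w wy gs(2,1) g'(1)] by blast
        have zU: "z \<in> U a \<inter> U i" using g g' z by (auto simp: ev_simps)
        obtain A B where AB: "A \<in> R" "B \<in> R" "ev A z \<noteq> 0" "ev B z \<noteq> 0"
          "p i * q a * B = q i * A * p a" using cross[OF a(1) i] zU by blast
        have wAB: "\<not> dvd_in R w A" "\<not> dvd_in R w B" using AB z(2) ev_dvd_zero by blast+
        have pqi: "p i \<in> R" "q i \<in> R" "p a \<in> R" "q a \<in> R" using pq i a by auto
        \<comment> \<open>As \<open>w\<close> divides none of \<open>A\<close>, \<open>B\<close>,
          \<open>p a\<close> and \<open>q a\<close>, the identity passes divisibility by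
          \<open>w\<close> from either of \<open>p i\<close> and \<open>q i\<close> to the
          other.\<close>
        have "dvd_in R w (p i) \<and> dvd_in R w (q i)"
        proof (cases "F = p i")
          case True
          then have "dvd_in R w (p i * q a * B)"
            using wF by (auto intro!: dvd_in_mult[OF is_subring_polyfuns] pqi AB(2))
          then have "dvd_in R w (q i * A * p a)" by (simp only: AB(5))
          then have "dvd_in R w (q i)"
            using prime_not_dvd_mult[OF w subringR(4)[OF pqi(2) AB(1)] pqi(3) _ w_a(1)]
              prime_not_dvd_mult[OF w pqi(2) AB(1) _ wAB(1)] by blast
          then show ?thesis using True wF by blast
        next
          case False
          then have "dvd_in R w (q i)" using F wF by auto
          then have "dvd_in R w (q i * A * p a)"
            by (auto intro!: dvd_in_mult[OF is_subring_polyfuns] pqi AB(1))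
          then have "dvd_in R w (p i * q a * B)" by (simp only: AB(5))
          then have "dvd_in R w (p i)"
            using prime_not_dvd_mult[OF w subringR(4)[OF pqi(1,4)] AB(2) _ wAB(2)]
              prime_not_dvd_mult[OF w pqi(1,4) _ w_a(2)] by blast
          then show ?thesis using \<open>dvd_in R w (q i)\<close> by blast
        qed
        then show False using pq(3)[OF i] w unfolding coprime_in_def by blast
      qed
    qed
    show ?thesis unfolding trivial_off_def
    proof (intro exI[of _ "\<lambda>i x. ev (p i) x / ev (q i) x"] conjI ballI impI)
      fix i assume i: "i \<in> I"
      show "\<exists>p'\<in>R. \<exists>q'\<in>R. \<forall>x\<in>U i. ev s x \<noteq> 0 \<longrightarrow>
          ev p' x \<noteq> 0 \<and> ev q' x \<noteq> 0 \<and> ev (p i) x / ev (q i) x = ev p' x / ev q' x"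
        using unit[OF i] pq i by (intro bexI[of _ "p i"] bexI[of _ "q i"]) auto
    next
      fix i j x assume i: "i \<in> I" and j: "j \<in> I" and x: "x \<in> U i \<inter> U j" "ev s x \<noteq> 0"
      obtain A B where AB: "ev A x \<noteq> 0" "ev B x \<noteq> 0" "f i j x = ev A x / ev B x"
          "p j * q i * B = q j * A * p i" using cross[OF i j] x by blast
      have "ev (p j) x * ev (q i) x * ev B x = ev (q j) x * ev A x * ev (p i) x"
        using arg_cong[OF AB(4), of "\<lambda>f. ev f x"] by (simp add: ev_simps)
      moreover have "ev (q i) x \<noteq> 0" "ev (q j) x \<noteq> 0" using unit[OF i, of x "q i"] unit[OF j, of x "q j"] x by simp_all
      ultimately show "ev (p j) x / ev (q j) x = f i j x * (ev (p i) x / ev (q i) x)"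
        unfolding AB(3) using AB(1,2) by (simp add: field_simps)
    qed
  qed
qed

text \<open>On a principal open subset g \<noteq> 0 of one chart \<open>a\<close>, the transition
  functions out of \<open>a\<close> trivialize the cocycle. The prime factors of \<open>g\<close>
  are removed until a unit is left.\<close>

theorem cocycle_trivial:
  assumes op: "\<And>i. i \<in> I \<Longrightarrow> zariski_open Z C (U i)"
    and cover: "(\<Union>i\<in>I. U i) = Z"
    and reg: "\<And>i j. i \<in> I \<Longrightarrow> j \<in> I \<Longrightarrow> regular_on Z C (U i \<inter> U j) (f i j)"
    and nz: "\<And>i j x. i \<in> I \<Longrightarrow> j \<in> I \<Longrightarrow> x \<in> U i \<inter> U j \<Longrightarrow> f i j x \<noteq> 0"
    and cocycle: "\<And>i j k x. i \<in> I \<Longrightarrow> j \<in> I \<Longrightarrow> k \<in> I \<Longrightarrow> x \<in> U i \<inter> U j \<inter> U k \<Longrightarrow>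
        f i j x * f j k x = f i k x"
  shows "\<exists>h. (\<forall>i\<in>I. regular_on Z C (U i) (h i) \<and> (\<forall>x\<in>U i. h i x \<noteq> 0)) \<and>
    (\<forall>i\<in>I. \<forall>j\<in>I. \<forall>x\<in>U i \<inter> U j. h j x = f i j x * h i x)"
proof (cases "Z = {}")
  case True
  then have "U i = {}" if "i \<in> I" for i using cover that by blast
  then show ?thesis by (auto simp: regular_on_def)
next
  case False
  have UZ: "U i \<subseteq> Z" if "i \<in> I" for i using op[OF that] zariski_open_subset by blast
  obtain x a where a: "a \<in> I" "x \<in> U a" using False cover by blast
  obtain g where g: "g \<in> R" "ev g x \<noteq> 0" "\<And>y. y \<in> affine_space n \<Longrightarrow> ev g y \<noteq> 0 \<Longrightarrow> y \<in> U a"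
    using open_basis[OF op[OF a(1)] a(2)] by metis
  have Ug: "y \<in> U a" if "y \<in> U i" "i \<in> I" "ev g y \<noteq> 0" for y i
    using g(3) that UZ zariski_open_subset[OF Z_open] by blast
  have g0: "g \<noteq> 0" using g(2) by (auto simp: ev_simps)
  have "trivial_off I U f g" unfolding trivial_off_def
  proof (intro exI[of _ "f a"] conjI ballI impI)
    fix i assume i: "i \<in> I"
    obtain p q where "p \<in> R" "q \<in> R"
      and pq: "\<And>x. x \<in> U a \<inter> U i \<Longrightarrow> ev q x \<noteq> 0 \<and> f a i x = ev p x / ev q x"
      using regular_global_fraction[OF reg[OF a(1) i]] UZ[OF i] by blast
    moreover have "ev p x \<noteq> 0" if "x \<in> U a \<inter> U i" for x using nz[OF a(1) i that] pq[OF that] by auto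
    ultimately show "\<exists>p\<in>R. \<exists>q\<in>R. \<forall>x\<in>U i. ev g x \<noteq> 0 \<longrightarrow>
        ev p x \<noteq> 0 \<and> ev q x \<noteq> 0 \<and> f a i x = ev p x / ev q x"
      using Ug[OF _ i] by (intro bexI[of _ p] bexI[of _ q]) auto
  next
    fix i j x assume *: "i \<in> I" "j \<in> I" "x \<in> U i \<inter> U j" "ev g x \<noteq> 0"
    then have "x \<in> U a" using Ug[of x i] by blast
    then have "x \<in> U a \<inter> U i \<inter> U j" using *(3) by blast
    then have "f a i x * f i j x = f a j x" by (rule cocycle[OF a(1) *(1,2)])
    then show "f a j x = f i j x * f a i x" by (metis mult.commute)
  qed
  moreover have "trivial_off I U f 1" if "prime_product R k s" "trivial_off I U f s" for k s
    using that
  proof (induction rule: prime_product.induct)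
    case (unit u)
    \<comment> \<open>A unit has no zeros, so triviality off u = 0 is triviality everywhere.\<close>
    then have "ev u x \<noteq> 0" for x using ev_dvd_zero[of R u 1 x] by (auto simp: ev_simps)
    then show ?case using unit(3) by (simp add: trivial_off_def ev_simps)
  next
    case (step k s w)
    have "trivial_off I U f s"
      by (rule trivial_off_remove_prime[OF op cover reg nz step.hyps(2)
            prime_product_in[OF is_subring_polyfuns step.hyps(1)]
            prime_product_nonzero[OF step.hyps(1)] step.prems])
    then show ?case by (rule step.IH)
  qed
  ultimately have "trivial_off I U f 1" using ufd_prime_product[OF g(1) g0] by blast
  then have "\<exists>h. (\<forall>i\<in>I. \<exists>p\<in>R. \<exists>q\<in>R. \<forall>x\<in>U i.
        ev p x \<noteq> 0 \<and> ev q x \<noteq> 0 \<and> h i x = ev p x / ev q x) \<and>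
      (\<forall>i\<in>I. \<forall>j\<in>I. \<forall>x\<in>U i \<inter> U j. h j x = f i j x * h i x)"
    by (simp add: trivial_off_def ev_simps(2))
  then obtain h where h: "\<And>i. i \<in> I \<Longrightarrow> \<exists>p\<in>R. \<exists>q\<in>R. \<forall>x\<in>U i.
        ev p x \<noteq> 0 \<and> ev q x \<noteq> 0 \<and> h i x = ev p x / ev q x"
     "\<And>i j x. i \<in> I \<Longrightarrow> j \<in> I \<Longrightarrow> x \<in> U i \<inter> U j \<Longrightarrow> h j x = f i j x * h i x"
    by blast
  have "regular_on Z C (U i) (h i) \<and> (\<forall>x\<in>U i. h i x \<noteq> 0)" if i: "i \<in> I" for i
  proof -
    obtain p q where pq: "p \<in> R" "q \<in> R"
      "\<And>x. x \<in> U i \<Longrightarrow> ev p x \<noteq> 0 \<and> ev q x \<noteq> 0 \<and> h i x = ev p x / ev q x" using h(1)[OF i] by blast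
    have "regular_on Z C (U i) (ev p)" "regular_on Z C (U i) (ev q)"
      using pq regular_on_poly_fun[OF op[OF i]] by (auto simp: polyfuns_def)
    then have "regular_on Z C (U i \<inter> U i) (\<lambda>x. ev p x * (1 / ev q x))"
      using pq UZ[OF i] by (intro regular_on_mult regular_on_inverse) auto
    then have "regular_on Z C (U i) (\<lambda>x. ev p x * (1 / ev q x))" by simp
    then have "regular_on Z C (U i) (h i)" by (rule regular_on_cong) (simp add: pq(3))
    then show ?thesis using pq by auto
  qed
  then show ?thesis using h(2) by (intro exI[of _ h]) blast
qed

text \<open>A coordinate line through a point whose other coordinates are nonzero lies in
  \<open>Z\<close>, so a polynomial without zeros on \<open>Z\<close> is constant along it. Moving
  the coordinates to 1 one by one shows that it is constant on the torus, which is dense. This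
  applies to the numerator and the denominator of \<open>f\<close>.\<close>

lemma nonvanishing_regular_constant:
  assumes Z: "\<And>z. z \<in> affine_space n \<Longrightarrow> (\<And>i j. i < n \<Longrightarrow> j < n \<Longrightarrow> z i = 0 \<Longrightarrow> z j = 0 \<Longrightarrow> i = j) \<Longrightarrow> z \<in> Z"
    and f: "regular_on Z C Z f" "\<And>z. z \<in> Z \<Longrightarrow> f z \<noteq> 0"
  shows "\<exists>c. \<forall>z\<in>Z. f z = c"
proof -
  let ?one = "restrict (\<lambda>_. 1::complex) {..<n}"
  have const: "\<exists>c. p = Const c" if p: "p \<in> R" and nz: "\<And>z. z \<in> Z \<Longrightarrow> ev p z \<noteq> 0" for p
  proof -
    have line: "ev p (z(i := t)) = ev p (z(i := t'))"
      if z: "z \<in> affine_space n" "\<And>j. j < n \<Longrightarrow> j \<noteq> i \<Longrightarrow> z j \<noteq> 0" "i < n" for z i t t'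
    proof -
      obtain P where P: "\<And>t. ev p (\<lambda>k. (z(i := 0)) k + t * (if k = i then 1 else 0)) = poly P t"
        using polyfun_line[of p "z(i := 0)" "\<lambda>k. if k = i then 1 else 0"] by metis
      have "(\<lambda>k. (z(i := 0)) k + t * (if k = i then 1 else 0)) = z(i := t)" for t by auto
      then have P: "ev p (z(i := t)) = poly P t" for t using P by metis
      have "poly P t \<noteq> 0" for t
        using z by (subst P[symmetric], intro nz Z) (auto simp: affine_space_def PiE_iff extensional_def split: if_splits)
      then have "constant (poly P)" using fundamental_theorem_of_algebra by blast
      then show ?thesis using P unfolding constant_def by metis
    qed
    have torus: "ev p z = ev p ?one" if z: "z \<in> affine_space n" "\<And>j. j < n \<Longrightarrow> z j \<noteq> 0" for z
    proof -
      \<comment> \<open>The first \<open>m\<close> coordinates have been moved to 1.\<close>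
      have "m \<le> n \<Longrightarrow> ev p (\<lambda>k. if k < m then 1 else z k) = ev p z" for m
      proof (induction m)
        case (Suc m)
        let ?y = "\<lambda>k. if k < m then 1 else z k"
        have "ev p (?y(m := 1)) = ev p (?y(m := z m))"
          using Suc z by (intro line) (auto simp: affine_space_def PiE_iff extensional_def)
        moreover have "?y(m := 1) = (\<lambda>k. if k < Suc m then 1 else z k)" "?y(m := z m) = ?y"
          by (auto simp: less_Suc_eq)
        ultimately show ?case using Suc by simp
      qed auto
      from this[of n] have "ev p (\<lambda>k. if k < n then 1 else z k) = ev p z" by simp
      moreover have "ev p ?one = ev p (\<lambda>k. if k < n then 1 else z k)" by (rule ev_cong[OF p]) auto
      ultimately show ?thesis by simp
    qed
    \<comment> \<open>The torus is the set where the product of the coordinates is nonzero.\<close>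
    let ?g = "\<Prod>i<n. Var i"
    have evg: "ev (\<Prod>i\<in>A. Var i) z = (\<Prod>i\<in>A. z i)" if "finite A" for z and A :: "nat set"
      using that by induction (simp_all add: ev_simps)
    have gR: "(\<Prod>i\<in>A. Var i) \<in> R" if "A \<subseteq> {..<n}" "finite A" for A
      using that(2,1) by induction (auto simp: subringR Var_in_polyfuns)
    have "p - Const (ev p ?one) = 0"
    proof (rule zero_on_dense[of _ n ?g])
      have "ev ?g (\<lambda>_. 1) = 1" using evg by simp
      then show "?g \<noteq> 0" using ev_simps(1) by (metis zero_neq_one)
    qed (use p gR torus evg in \<open>auto simp: subringR ev_simps\<close>)
    then show ?thesis by auto
  qed
  obtain p q where "p \<in> R" "q \<in> R" and pq: "\<And>x. x \<in> Z \<Longrightarrow> ev q x \<noteq> 0 \<and> f x = ev p x / ev q x"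
    using regular_global_fraction[OF f(1)] by blast
  moreover have "ev p x \<noteq> 0" if "x \<in> Z" for x using f(2)[OF that] pq[OF that] by auto
  ultimately obtain a b where "p = Const a" "q = Const b" using const by metis
  then show ?thesis using pq by auto
qed

end

section \<open>Characters of abelian groups\<close>

text \<open>\<open>\<Gamma>\<close> is the graph of a homomorphism from a subgroup of \<open>A\<close> to the nonzero complex numbers.\<close>

definition partial_character :: "('a, 'm) monoid_scheme \<Rightarrow> ('a \<times> complex) set \<Rightarrow> bool" where
  "partial_character A \<Gamma> \<longleftrightarrow> \<Gamma> \<subseteq> carrier A \<times> - {0} \<and> (\<one>\<^bsub>A\<^esub>, 1) \<in> \<Gamma> \<and>
     (\<forall>x y x' y'. (x, y) \<in> \<Gamma> \<longrightarrow> (x', y') \<in> \<Gamma> \<longrightarrow> (x \<otimes>\<^bsub>A\<^esub> x', y * y') \<in> \<Gamma>) \<and>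
     (\<forall>x y. (x, y) \<in> \<Gamma> \<longrightarrow> (inv\<^bsub>A\<^esub> x, inverse y) \<in> \<Gamma>) \<and>
     (\<forall>y. (\<one>\<^bsub>A\<^esub>, y) \<in> \<Gamma> \<longrightarrow> y = 1)"

context
  fixes A :: "('a, 'm) monoid_scheme"
  assumes A: "comm_group A"
begin

interpretation A: comm_group A by (rule A)

lemma partial_characterD:
  assumes "partial_character A \<Gamma>"
  shows "(x, y) \<in> \<Gamma> \<Longrightarrow> x \<in> carrier A" "(x, y) \<in> \<Gamma> \<Longrightarrow> y \<noteq> 0" "(\<one>\<^bsub>A\<^esub>, 1) \<in> \<Gamma>"
    "(x, y) \<in> \<Gamma> \<Longrightarrow> (x', y') \<in> \<Gamma> \<Longrightarrow> (x \<otimes>\<^bsub>A\<^esub> x', y * y') \<in> \<Gamma>"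
    "(x, y) \<in> \<Gamma> \<Longrightarrow> (inv\<^bsub>A\<^esub> x, inverse y) \<in> \<Gamma>"
    "(\<one>\<^bsub>A\<^esub>, y) \<in> \<Gamma> \<Longrightarrow> y = 1"
  using assms unfolding partial_character_def by blast+

lemma partial_character_unique:
  assumes P: "partial_character A \<Gamma>" and "(x, y) \<in> \<Gamma>" "(x, y') \<in> \<Gamma>"
  shows "y = y'"
proof -
  have "(x \<otimes>\<^bsub>A\<^esub> inv\<^bsub>A\<^esub> x, y * inverse y') \<in> \<Gamma>" using assms partial_characterD[OF P] by blast
  then have "y * inverse y' = 1" using partial_characterD(1,6)[OF P] assms by auto
  then show ?thesis using partial_characterD(2)[OF P assms(3)] by (simp add: field_simps)
qed

lemma partial_character_int_pow:
  assumes P: "partial_character A \<Gamma>" and xy: "(x, y) \<in> \<Gamma>"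
  shows "(x [^]\<^bsub>A\<^esub> (k::int), y powi k) \<in> \<Gamma>"
proof -
  have nat: "(x [^]\<^bsub>A\<^esub> (m::nat), y ^ m) \<in> \<Gamma>" for m
  proof (induction m)
    case 0
    then show ?case using partial_characterD(3)[OF P] by simp
  next
    case (Suc m)
    then show ?case using partial_characterD(4)[OF P Suc xy] by (simp add: mult.commute)
  qed
  show ?thesis
  proof (cases k)
    case (nonneg m)
    then show ?thesis using nat by (simp add: int_pow_int)
  next
    case (neg m)
    have "(inv\<^bsub>A\<^esub> (x [^]\<^bsub>A\<^esub> Suc m), inverse (y ^ Suc m)) \<in> \<Gamma>"
      using partial_characterD(5)[OF P nat] .
    moreover have "x [^]\<^bsub>A\<^esub> k = inv\<^bsub>A\<^esub> (x [^]\<^bsub>A\<^esub> Suc m)" using partial_characterD(1)[OF P xy]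
      unfolding neg by (simp only: A.int_pow_neg int_pow_int)
    moreover have "y powi k = inverse (y ^ Suc m)"
      unfolding neg by (simp only: power_int_minus power_int_of_nat)
    ultimately show ?thesis by simp
  qed
qed

text \<open>The products of elements of the domain with powers of \<open>a\<close> form a graph
  again: if x times a power of \<open>a\<close> is the identity, then x is itself a power of
  \<open>a\<close>, and \<open>compat\<close> fixes its value.\<close>

lemma partial_character_extend:
  assumes P: "partial_character A \<Gamma>" and a: "a \<in> carrier A" and c: "c \<noteq> 0"
    and compat: "\<And>k y. (a [^]\<^bsub>A\<^esub> (k::int), y) \<in> \<Gamma> \<Longrightarrow> y = c powi k"
  shows "\<exists>\<Gamma>'. partial_character A \<Gamma>' \<and> \<Gamma> \<subseteq> \<Gamma>' \<and> (a, c) \<in> \<Gamma>'"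
proof (intro exI conjI)
  let ?\<Gamma> = "{(x \<otimes>\<^bsub>A\<^esub> a [^]\<^bsub>A\<^esub> (k::int), y * c powi k) | x y k. (x, y) \<in> \<Gamma>}"
  note PD = partial_characterD[OF P]
  have I: "(x \<otimes>\<^bsub>A\<^esub> a [^]\<^bsub>A\<^esub> k, y * c powi k) \<in> ?\<Gamma>" if "(x, y) \<in> \<Gamma>" for x y and k :: int
    using that by blast
  show "\<Gamma> \<subseteq> ?\<Gamma>"
  proof
    fix z assume "z \<in> \<Gamma>"
    then show "z \<in> ?\<Gamma>" using I[of "fst z" "snd z" 0] PD(1)[of "fst z" "snd z"] by simp
  qed
  show "(a, c) \<in> ?\<Gamma>" using I[OF PD(3), of 1] a by (simp add: A.int_pow_1)
  show "partial_character A ?\<Gamma>"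
    unfolding partial_character_def
  proof (intro conjI allI impI)
    show "?\<Gamma> \<subseteq> carrier A \<times> - {0}" using PD(1,2) a c by auto
    show "(\<one>\<^bsub>A\<^esub>, 1) \<in> ?\<Gamma>" using I[OF PD(3), of 0] by simp
  next
    fix x y x' y' assume "(x, y) \<in> ?\<Gamma>" "(x', y') \<in> ?\<Gamma>"
    then obtain u v u' v' k k' where *: "(u, v) \<in> \<Gamma>" "(u', v') \<in> \<Gamma>"
      "x = u \<otimes>\<^bsub>A\<^esub> a [^]\<^bsub>A\<^esub> (k::int)" "y = v * c powi k"
      "x' = u' \<otimes>\<^bsub>A\<^esub> a [^]\<^bsub>A\<^esub> (k'::int)" "y' = v' * c powi k'" by blast
    have u: "u \<in> carrier A" "u' \<in> carrier A" using * PD(1) by auto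
    have e1: "x \<otimes>\<^bsub>A\<^esub> x' = (u \<otimes>\<^bsub>A\<^esub> u') \<otimes>\<^bsub>A\<^esub> a [^]\<^bsub>A\<^esub> (k + k')"
      unfolding * using u a by (simp add: A.int_pow_mult A.m_ac)
    have e2: "y * y' = (v * v') * c powi (k + k')"
      unfolding * using c by (simp add: power_int_add)
    show "(x \<otimes>\<^bsub>A\<^esub> x', y * y') \<in> ?\<Gamma>"
      unfolding e1 e2 by (rule I[OF PD(4)[OF *(1,2)]])
  next
    fix x y assume "(x, y) \<in> ?\<Gamma>"
    then obtain u v k where *: "(u, v) \<in> \<Gamma>" "x = u \<otimes>\<^bsub>A\<^esub> a [^]\<^bsub>A\<^esub> (k::int)" "y = v * c powi k"
      by blast
    have e1: "inv\<^bsub>A\<^esub> x = inv\<^bsub>A\<^esub> u \<otimes>\<^bsub>A\<^esub> a [^]\<^bsub>A\<^esub> (- k)"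
      unfolding * using PD(1)[OF *(1)] a by (simp add: A.inv_mult A.int_pow_neg)
    have e2: "inverse y = inverse v * c powi (- k)" unfolding * by (simp add: power_int_minus)
    show "(inv\<^bsub>A\<^esub> x, inverse y) \<in> ?\<Gamma>" unfolding e1 e2 by (rule I[OF PD(5)[OF *(1)]])
  next
    fix y assume "(\<one>\<^bsub>A\<^esub>, y) \<in> ?\<Gamma>"
    then obtain u v k where *: "(u, v) \<in> \<Gamma>" "\<one>\<^bsub>A\<^esub> = u \<otimes>\<^bsub>A\<^esub> a [^]\<^bsub>A\<^esub> (k::int)" "y = v * c powi k"
      by blast
    have u: "u \<in> carrier A" using * PD(1) by auto
    have "u = inv\<^bsub>A\<^esub> (a [^]\<^bsub>A\<^esub> k)" using *(2) u a by (metis A.inv_equality A.int_pow_closed)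
    then have "u = a [^]\<^bsub>A\<^esub> (- k)" using a by (simp add: A.int_pow_neg)
    then have "v = c powi (- k)" using compat *(1) by blast
    then show "y = 1" using * c by (simp add: power_int_minus)
  qed
qed

text \<open>If no positive power of \<open>a\<close> lies in the domain, the value at
  \<open>a\<close> is free. Otherwise it has to be an m-th root of the value at the least such
  power. The last clause starts an extension that is nontrivial at a given element: for the trivial
  \<open>\<Gamma>\<close> and \<open>a\<close> of finite order, m is at least 2 and some m-th root
  differs from 1.\<close>

lemma partial_character_extend_point:
  assumes P: "partial_character A \<Gamma>" and a: "a \<in> carrier A"
  shows "\<exists>\<Gamma>' c. partial_character A \<Gamma>' \<and> \<Gamma> \<subseteq> \<Gamma>' \<and> (a, c) \<in> \<Gamma>' \<and>
    (\<Gamma> = {(\<one>\<^bsub>A\<^esub>, 1)} \<and> a \<noteq> \<one>\<^bsub>A\<^esub> \<longrightarrow> c \<noteq> 1)"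
proof -
  note PD = partial_characterD[OF P]
  have "\<exists>c. c \<noteq> 0 \<and> (\<forall>k y. (a [^]\<^bsub>A\<^esub> (k::int), y) \<in> \<Gamma> \<longrightarrow> y = c powi k) \<and>
    (\<Gamma> = {(\<one>\<^bsub>A\<^esub>, 1)} \<and> a \<noteq> \<one>\<^bsub>A\<^esub> \<longrightarrow> c \<noteq> 1)"
  proof (cases "\<exists>m>0. \<exists>y. (a [^]\<^bsub>A\<^esub> (m::nat), y) \<in> \<Gamma>")
    case False
    have "k = 0" if "(a [^]\<^bsub>A\<^esub> (k::int), y) \<in> \<Gamma>" for k y
    proof (rule ccontr)
      assume "k \<noteq> 0"
      have "(a [^]\<^bsub>A\<^esub> \<bar>k\<bar>, if k < 0 then inverse y else y) \<in> \<Gamma>"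
        using that PD(5)[OF that] a by (auto simp: A.int_pow_neg abs_if)
      moreover have "\<bar>k\<bar> = int (nat \<bar>k\<bar>)" by simp
      ultimately have "(a [^]\<^bsub>A\<^esub> nat \<bar>k\<bar>, if k < 0 then inverse y else y) \<in> \<Gamma>"
        by (metis int_pow_int)
      then show False using False \<open>k \<noteq> 0\<close> by (metis zero_less_abs_iff zero_less_nat_eq)
    qed
    \<comment> \<open>The value 2 stands for any number other than 0 and 1.\<close>
    then have "y = 2 powi k" if "(a [^]\<^bsub>A\<^esub> (k::int), y) \<in> \<Gamma>" for k y
      using that PD(6)[of y] by fastforce
    then show ?thesis by (intro exI[of _ 2] conjI allI impI) auto
  next
    case True
    define m where "m = (LEAST m. m > 0 \<and> (\<exists>y. (a [^]\<^bsub>A\<^esub> (m::nat), y) \<in> \<Gamma>))"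
    have "m > 0 \<and> (\<exists>y. (a [^]\<^bsub>A\<^esub> m, y) \<in> \<Gamma>)" unfolding m_def using True by (rule LeastI_ex)
    then obtain y0 where m: "m > 0" "(a [^]\<^bsub>A\<^esub> m, y0) \<in> \<Gamma>" by blast
    have least: "m \<le> l" if "l > 0" "(a [^]\<^bsub>A\<^esub> l, y) \<in> \<Gamma>" for l y
      unfolding m_def using that by (intro Least_le) blast
    have y0: "y0 \<noteq> 0" using PD(2) m by blast
    have mroot: "card {z. z ^ m = y0} = m" using card_nth_roots[OF y0 m(1)] .
    have compat: "y = c powi k" if c: "c ^ m = y0" and k: "(a [^]\<^bsub>A\<^esub> (k::int), y) \<in> \<Gamma>" for c k y
    proof -
      \<comment> \<open>The remainder \<open>r\<close> is an exponent below the least positive one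
        in the domain, hence it is 0.\<close>
      define q r where "q = k div int m" and "r = nat (k mod int m)"
      have r: "k mod int m = int r" "r < m" using m(1)
        by (auto simp: r_def nat_less_iff)
      have k_eq: "k = int m * q + int r" using r(1) by (simp add: q_def flip: r(1))
      have mq: "((a [^]\<^bsub>A\<^esub> m) [^]\<^bsub>A\<^esub> q, y0 powi q) \<in> \<Gamma>" using partial_character_int_pow[OF P m(2)] .
      have am: "(a [^]\<^bsub>A\<^esub> m) [^]\<^bsub>A\<^esub> q = a [^]\<^bsub>A\<^esub> (int m * q)"
        using a by (metis A.int_pow_pow int_pow_int)
      have "a [^]\<^bsub>A\<^esub> k \<otimes>\<^bsub>A\<^esub> inv\<^bsub>A\<^esub> (a [^]\<^bsub>A\<^esub> (int m * q)) = a [^]\<^bsub>A\<^esub> (k + - (int m * q))"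
        using a by (simp only: A.int_pow_mult A.int_pow_neg)
      also have "\<dots> = a [^]\<^bsub>A\<^esub> r" using k_eq by (simp add: int_pow_int)
      finally have "(a [^]\<^bsub>A\<^esub> r, y * inverse (y0 powi q)) \<in> \<Gamma>"
        using PD(4)[OF k PD(5)[OF mq]] by (simp add: am)
      then have "r = 0" using least[of r] r(2) by (metis linorder_not_less not_gr_zero)
      then have "k = int m * q" using k_eq by simp
      then have "(a [^]\<^bsub>A\<^esub> k, y0 powi q) \<in> \<Gamma>" using mq am by simp
      then have "y = y0 powi q" using partial_character_unique[OF P k] by blast
      also have "\<dots> = c powi k" using \<open>k = int m * q\<close> c by (simp add: power_int_mult flip: c)
      finally show ?thesis .
    qed
    have "\<exists>c. c ^ m = y0 \<and> (\<Gamma> = {(\<one>\<^bsub>A\<^esub>, 1)} \<and> a \<noteq> \<one>\<^bsub>A\<^esub> \<longrightarrow> c \<noteq> 1)"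
    proof (cases "\<Gamma> = {(\<one>\<^bsub>A\<^esub>, 1)} \<and> a \<noteq> \<one>\<^bsub>A\<^esub>")
      case True
      have "a [^]\<^bsub>A\<^esub> (1::nat) = a" using a by simp
      \<comment> \<open>m = 1 would put \<open>a\<close> itself into the trivial domain.\<close>
      then have "m \<noteq> 1" using m(2) True by (intro notI) auto
      then have "\<not> {z. z ^ m = y0} \<subseteq> {1}"
        using mroot m(1) card_mono[of "{1::complex}" "{z. z ^ m = y0}"] by auto
      then show ?thesis by blast
    next
      case False
      have "{z. z ^ m = y0} \<noteq> {}" using mroot m(1) by (metis card.empty less_irrefl)
      then show ?thesis using False by blast
    qed
    then obtain c where c: "c ^ m = y0" "\<Gamma> = {(\<one>\<^bsub>A\<^esub>, 1)} \<and> a \<noteq> \<one>\<^bsub>A\<^esub> \<longrightarrow> c \<noteq> 1" by blast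
    have "c \<noteq> 0" using c(1) y0 m(1) by auto
    then show ?thesis using c compat[OF c(1)] by blast
  qed
  then show ?thesis using partial_character_extend[OF P a] by metis
qed

text \<open>The multiplicative group of the complex numbers is divisible, so characters extend.\<close>

lemma character_separates:
  assumes u: "u \<in> carrier A" "u \<noteq> \<one>\<^bsub>A\<^esub>"
  shows "\<exists>\<chi>\<in>hom A complex_units. \<chi> u \<noteq> 1"
proof -
  have "partial_character A {(\<one>\<^bsub>A\<^esub>, 1)}" by (auto simp: partial_character_def)
  then obtain \<Gamma>0 c0 where 0: "partial_character A \<Gamma>0" "(u, c0) \<in> \<Gamma>0" "c0 \<noteq> 1"
    using partial_character_extend_point[OF _ u(1)] u(2) by blast
  define S where "S = {\<Gamma>. partial_character A \<Gamma> \<and> \<Gamma>0 \<subseteq> \<Gamma>}"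
  have "\<exists>M\<in>S. \<forall>X\<in>S. M \<subseteq> X \<longrightarrow> X = M"
  proof (rule subset_Zorn_nonempty)
    show "S \<noteq> {}" using 0 by (auto simp: S_def)
    fix Ch assume Ch: "Ch \<noteq> {}" "subset.chain S Ch"
    then have CS: "Ch \<subseteq> S" and lin: "\<And>X Y. X \<in> Ch \<Longrightarrow> Y \<in> Ch \<Longrightarrow> X \<subseteq> Y \<or> Y \<subseteq> X"
      by (auto simp: subset_chain_def)
    have pc: "partial_character A X" "\<Gamma>0 \<subseteq> X" if "X \<in> Ch" for X using that CS by (auto simp: S_def)
    have "partial_character A (\<Union>Ch)"
      unfolding partial_character_def
    proof (intro conjI allI impI)
      show "\<Union>Ch \<subseteq> carrier A \<times> - {0}" using pc(1) by (force simp: partial_character_def)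
      show "(\<one>\<^bsub>A\<^esub>, 1) \<in> \<Union>Ch" using pc(1) Ch(1) partial_characterD(3) by blast
    next
      fix x y x' y' assume "(x, y) \<in> \<Union>Ch" "(x', y') \<in> \<Union>Ch"
      then obtain X Y where "X \<in> Ch" "Y \<in> Ch" "(x, y) \<in> X" "(x', y') \<in> Y" by blast
      then obtain W where "W \<in> Ch" "(x, y) \<in> W" "(x', y') \<in> W" using lin by blast
      then show "(x \<otimes>\<^bsub>A\<^esub> x', y * y') \<in> \<Union>Ch" using partial_characterD(4)[OF pc(1)] by blast
    next
      fix x y assume "(x, y) \<in> \<Union>Ch"
      then show "(inv\<^bsub>A\<^esub> x, inverse y) \<in> \<Union>Ch" using partial_characterD(5)[OF pc(1)] by blast
    next
      fix y assume "(\<one>\<^bsub>A\<^esub>, y) \<in> \<Union>Ch"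
      then show "y = 1" using partial_characterD(6)[OF pc(1)] by blast
    qed
    then show "\<Union>Ch \<in> S" using pc(2) Ch(1) by (auto simp: S_def)
  qed
  then obtain M where M: "partial_character A M" "\<Gamma>0 \<subseteq> M"
    and max: "\<And>X. partial_character A X \<Longrightarrow> M \<subseteq> X \<Longrightarrow> X = M" by (auto simp: S_def)
  \<comment> \<open>A maximal partial character is defined everywhere, since at any missing point it
    could be extended.\<close>
  have total: "\<exists>c. (a, c) \<in> M" if "a \<in> carrier A" for a
    using partial_character_extend_point[OF M(1) that] max by blast
  define \<chi> where "\<chi> a = (SOME c. (a, c) \<in> M)" for a
  have \<chi>: "(a, \<chi> a) \<in> M" if "a \<in> carrier A" for a unfolding \<chi>_def using total[OF that] by (rule someI_ex)
  have "\<chi> \<in> hom A complex_units"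
  proof (rule homI)
    fix x y assume xy: "x \<in> carrier A" "y \<in> carrier A"
    show "\<chi> x \<in> carrier complex_units"
      using partial_characterD(2)[OF M(1) \<chi>[OF xy(1)]] by (simp add: complex_units_def)
    have "(x \<otimes>\<^bsub>A\<^esub> y, \<chi> x * \<chi> y) \<in> M" using partial_characterD(4)[OF M(1)] \<chi> xy by blast
    then have "\<chi> (x \<otimes>\<^bsub>A\<^esub> y) = \<chi> x * \<chi> y"
      using partial_character_unique[OF M(1)] \<chi> xy by blast
    then show "\<chi> (x \<otimes>\<^bsub>A\<^esub> y) = \<chi> x \<otimes>\<^bsub>complex_units\<^esub> \<chi> y" by (simp add: complex_units_def)
  qed
  moreover have "\<chi> u = c0" using partial_character_unique[OF M(1) \<chi>[OF u(1)]] 0 M(2) by blast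
  ultimately show ?thesis using 0(3) by blast
qed

end

text \<open>Dedekind's argument: translate the relation by \<open>h\<close>, subtract \<chi> k h
  times the original, and the k-th term is gone. The characters form an indexed family so that two
  kinds of them can be indexed by a disjoint sum.\<close>

lemma characters_independent:
  fixes G :: "('g, 'm) monoid_scheme" and \<chi> :: "'i \<Rightarrow> 'g \<Rightarrow> complex"
  assumes "finite I" and G: "monoid G"
    and "\<And>i g h. i \<in> I \<Longrightarrow> g \<in> carrier G \<Longrightarrow> h \<in> carrier G \<Longrightarrow> \<chi> i (g \<otimes>\<^bsub>G\<^esub> h) = \<chi> i g * \<chi> i h"
    and "\<And>i. i \<in> I \<Longrightarrow> \<chi> i \<one>\<^bsub>G\<^esub> = 1"
    and "\<And>i j. i \<in> I \<Longrightarrow> j \<in> I \<Longrightarrow> i \<noteq> j \<Longrightarrow> \<exists>g\<in>carrier G. \<chi> i g \<noteq> \<chi> j g"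
    and "\<And>g. g \<in> carrier G \<Longrightarrow> (\<Sum>i\<in>I. c i * \<chi> i g) = 0"
  shows "\<forall>i\<in>I. c i = 0"
  using assms(1,3-)
proof (induction I arbitrary: c rule: finite_induct)
  case (insert k F)
  note mult = insert.prems(1) and one = insert.prems(2) and dist = insert.prems(3)
    and zero = insert.prems(4)
  have G1: "\<one>\<^bsub>G\<^esub> \<in> carrier G" using G by (simp add: monoid.one_closed)
  have "\<forall>i\<in>F. c i * (\<chi> i h - \<chi> k h) = 0" if h: "h \<in> carrier G" for h
  proof (rule insert.IH)
    fix g assume g: "g \<in> carrier G"
    have "(\<Sum>i\<in>insert k F. c i * \<chi> i (h \<otimes>\<^bsub>G\<^esub> g)) = 0"
      using zero monoid.m_closed[OF G h g] by blast
    moreover have "(\<Sum>i\<in>insert k F. c i * \<chi> i (h \<otimes>\<^bsub>G\<^esub> g)) =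
        (\<Sum>i\<in>insert k F. c i * (\<chi> i h * \<chi> i g))"
      by (intro sum.cong refl) (simp add: mult h g)
    ultimately have 1: "(\<Sum>i\<in>insert k F. c i * (\<chi> i h * \<chi> i g)) = 0" by simp
    have 2: "\<chi> k h * (\<Sum>i\<in>insert k F. c i * \<chi> i g) = 0" using zero[OF g] by simp
    have "(\<Sum>i\<in>insert k F. c i * (\<chi> i h - \<chi> k h) * \<chi> i g) =
        (\<Sum>i\<in>insert k F. c i * (\<chi> i h * \<chi> i g)) - \<chi> k h * (\<Sum>i\<in>insert k F. c i * \<chi> i g)"
      by (simp only: sum_distrib_left sum_subtractf[symmetric]) (intro sum.cong refl, simp add: algebra_simps)
    then have "(\<Sum>i\<in>insert k F. c i * (\<chi> i h - \<chi> k h) * \<chi> i g) = 0" using 1 2 by simp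
    then show "(\<Sum>i\<in>F. c i * (\<chi> i h - \<chi> k h) * \<chi> i g) = 0" using insert.hyps by simp
  qed (use mult one dist in auto)
  then have F: "c i = 0" if "i \<in> F" for i
    using dist[of i k] that insert.hyps(2) by (metis insertCI mult_eq_0_iff right_minus_eq)
  then have "c k = 0" using zero[OF G1] one[of k] insert.hyps by simp
  then show ?case using F by simp
qed simp

section \<open>Regular functions on the group of characters\<close>

definition evaluations :: "('a, 'm) monoid_scheme \<Rightarrow> (('a \<Rightarrow> complex) \<Rightarrow> complex) set" where
  "evaluations A = {\<lambda>g. g u | u. u \<in> carrier A}"

lemma hom_group_complex_units:
  assumes "g \<in> carrier (hom_group A complex_units)"
  shows "u \<in> carrier A \<Longrightarrow> g u \<noteq> 0"
    and "u \<in> carrier A \<Longrightarrow> v \<in> carrier A \<Longrightarrow> g (u \<otimes>\<^bsub>A\<^esub> v) = g u * g v"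
  using assms by (auto simp: hom_group_def hom_def complex_units_def)

lemma hom_group_complex_units_one:
  assumes "g \<in> carrier (hom_group A complex_units)" "group A"
  shows "g \<one>\<^bsub>A\<^esub> = 1"
proof -
  interpret group A by fact
  have "g \<one>\<^bsub>A\<^esub> * g \<one>\<^bsub>A\<^esub> = g \<one>\<^bsub>A\<^esub>"
    using hom_group_complex_units(2)[OF assms(1) one_closed one_closed] by simp
  then show ?thesis using hom_group_complex_units(1)[OF assms(1) one_closed] by simp
qed

text \<open>The product of the evaluations at two elements is the evaluation at their product, so
  the linear span is closed under multiplication: it is the image of the group algebra of
  \<open>A\<close>.\<close>

lemma evaluations_span:
  assumes "f \<in> poly_funs (evaluations A)" and A: "group A"
  shows "\<exists>U c. finite U \<and> U \<subseteq> carrier A \<and>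
    (\<forall>g\<in>carrier (hom_group A complex_units). f g = (\<Sum>u\<in>U. c u * g u))"
  using assms(1)
proof (induction rule: poly_funs.induct)
  interpret group A by (rule A)
  case (const a)
  then show ?case using hom_group_complex_units_one[OF _ A]
    by (intro exI[of _ "{\<one>\<^bsub>A\<^esub>}"] exI[of _ "\<lambda>_. a"]) auto
next
  case (coord f)
  then obtain u where "u \<in> carrier A" "f = (\<lambda>g. g u)" by (auto simp: evaluations_def)
  then show ?case by (intro exI[of _ "{u}"] exI[of _ "\<lambda>_. 1"]) auto
next
  case (add f g)
  then obtain U c V d where U: "finite U" "U \<subseteq> carrier A" "finite V" "V \<subseteq> carrier A"
    and f: "\<And>x. x \<in> carrier (hom_group A complex_units) \<Longrightarrow> f x = (\<Sum>u\<in>U. c u * x u)"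
    and g: "\<And>x. x \<in> carrier (hom_group A complex_units) \<Longrightarrow> g x = (\<Sum>u\<in>V. d u * x u)" by metis
  let ?e = "\<lambda>u. (if u \<in> U then c u else 0) + (if u \<in> V then d u else 0)"
  have "f x + g x = (\<Sum>u\<in>U \<union> V. ?e u * x u)" if "x \<in> carrier (hom_group A complex_units)" for x
  proof -
    have "(\<Sum>u\<in>U \<union> V. (if u \<in> U then c u else 0) * x u) = (\<Sum>u\<in>U. c u * x u)"
      using U by (intro sum.mono_neutral_cong_right) auto
    moreover have "(\<Sum>u\<in>U \<union> V. (if u \<in> V then d u else 0) * x u) = (\<Sum>u\<in>V. d u * x u)"
      using U by (intro sum.mono_neutral_cong_right) auto
    ultimately show ?thesis using f g that by (simp add: distrib_right sum.distrib)
  qed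
  then show ?case using U by (intro exI[of _ "U \<union> V"] exI[of _ ?e]) auto
next
  interpret group A by (rule A)
  case (mult f g)
  then obtain U c V d where U: "finite U" "U \<subseteq> carrier A" "finite V" "V \<subseteq> carrier A"
    and f: "\<And>x. x \<in> carrier (hom_group A complex_units) \<Longrightarrow> f x = (\<Sum>u\<in>U. c u * x u)"
    and g: "\<And>x. x \<in> carrier (hom_group A complex_units) \<Longrightarrow> g x = (\<Sum>u\<in>V. d u * x u)" by metis
  let ?m = "\<lambda>p. fst p \<otimes>\<^bsub>A\<^esub> snd p"
  let ?e = "\<lambda>w. \<Sum>p\<in>{p \<in> U \<times> V. ?m p = w}. c (fst p) * d (snd p)"
  have "f x * g x = (\<Sum>w\<in>?m ` (U \<times> V). ?e w * x w)"
    if x: "x \<in> carrier (hom_group A complex_units)" for x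
  proof -
    have "f x * g x = (\<Sum>p\<in>U \<times> V. (c (fst p) * x (fst p)) * (d (snd p) * x (snd p)))"
      by (simp add: f g x sum_product sum.cartesian_product split_beta)
    also have "\<dots> = (\<Sum>p\<in>U \<times> V. c (fst p) * d (snd p) * x (?m p))"
      using U by (intro sum.cong refl) (auto simp: hom_group_complex_units(2)[OF x] subset_iff)
    also have "\<dots> = (\<Sum>w\<in>?m ` (U \<times> V). \<Sum>p\<in>{p \<in> U \<times> V. ?m p = w}. c (fst p) * d (snd p) * x (?m p))"
      using U by (intro sum.image_gen) auto
    also have "\<dots> = (\<Sum>w\<in>?m ` (U \<times> V). ?e w * x w)"
      by (intro sum.cong refl) (simp add: sum_distrib_right)
    finally show ?thesis .
  qed
  moreover have "?m ` (U \<times> V) \<subseteq> carrier A" using U by (auto intro!: m_closed)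
  moreover have "finite (?m ` (U \<times> V))" using U by blast
  ultimately show ?case by (intro exI[of _ "?m ` (U \<times> V)"] exI[of _ ?e]) blast
qed

lemma comm_group_complex_units: "comm_group complex_units"
proof (rule comm_groupI)
  fix x assume "x \<in> carrier complex_units"
  then show "\<exists>y\<in>carrier complex_units. y \<otimes>\<^bsub>complex_units\<^esub> x = \<one>\<^bsub>complex_units\<^esub>"
    by (intro bexI[of _ "inverse x"]) (auto simp: complex_units_def)
qed (auto simp: complex_units_def)

lemma comm_group_hom_group:
  assumes A: "group A" and B: "comm_group B"
  shows "comm_group (hom_group A B)"
proof -
  interpret A: group A by (rule A)
  interpret B: comm_group B by (rule B)
  show ?thesis
  proof (rule comm_groupI)
    fix f g assume "f \<in> carrier (hom_group A B)" "g \<in> carrier (hom_group A B)"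
    then show "f \<otimes>\<^bsub>hom_group A B\<^esub> g \<in> carrier (hom_group A B)"
      by (auto simp: hom_group_def hom_def Pi_iff B.m_ac)
  next
    show "\<one>\<^bsub>hom_group A B\<^esub> \<in> carrier (hom_group A B)" by (auto simp: hom_group_def hom_def)
  next
    fix f assume f: "f \<in> carrier (hom_group A B)"
    then show "\<one>\<^bsub>hom_group A B\<^esub> \<otimes>\<^bsub>hom_group A B\<^esub> f = f"
      by (auto simp: hom_group_def hom_def Pi_iff fun_eq_iff extensional_def)
    have "(\<lambda>x\<in>carrier A. inv\<^bsub>B\<^esub> f x) \<in> carrier (hom_group A B)"
      using f by (auto simp: hom_group_def hom_def Pi_iff B.inv_mult)
    moreover have "(\<lambda>x\<in>carrier A. inv\<^bsub>B\<^esub> f x) \<otimes>\<^bsub>hom_group A B\<^esub> f = \<one>\<^bsub>hom_group A B\<^esub>"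
      using f by (auto simp: hom_group_def hom_def Pi_iff fun_eq_iff)
    ultimately show "\<exists>g\<in>carrier (hom_group A B). g \<otimes>\<^bsub>hom_group A B\<^esub> f = \<one>\<^bsub>hom_group A B\<^esub>" by blast
  qed (auto simp: hom_group_def hom_def Pi_iff fun_eq_iff B.m_ac)
qed

lemma hom_group_separates:
  assumes A: "comm_group A" and u: "u \<in> carrier A" "v \<in> carrier A" "u \<noteq> v"
  shows "\<exists>g\<in>carrier (hom_group A complex_units). g u \<noteq> g v"
proof -
  interpret comm_group A by (rule A)
  have "u \<otimes>\<^bsub>A\<^esub> inv\<^bsub>A\<^esub> v \<noteq> \<one>\<^bsub>A\<^esub>" using u by (metis inv_closed inv_equality inv_inv)
  then obtain \<chi> where \<chi>: "\<chi> \<in> hom A complex_units" "\<chi> (u \<otimes>\<^bsub>A\<^esub> inv\<^bsub>A\<^esub> v) \<noteq> 1"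
    using character_separates[OF A, of "u \<otimes>\<^bsub>A\<^esub> inv\<^bsub>A\<^esub> v"] u by blast
  let ?g = "restrict \<chi> (carrier A)"
  have g: "?g \<in> carrier (hom_group A complex_units)"
    using \<chi>(1) by (auto simp: hom_group_def hom_def)
  have "?g u \<noteq> ?g v"
  proof
    assume eq: "?g u = ?g v"
    have "?g (u \<otimes>\<^bsub>A\<^esub> inv\<^bsub>A\<^esub> v) = ?g v * ?g (inv\<^bsub>A\<^esub> v)"
      using hom_group_complex_units(2)[OF g u(1), of "inv\<^bsub>A\<^esub> v"] u eq by simp
    also have "\<dots> = ?g \<one>\<^bsub>A\<^esub>"
      using hom_group_complex_units(2)[OF g u(2), of "inv\<^bsub>A\<^esub> v"] u by simp
    also have "\<dots> = 1" by (rule hom_group_complex_units_one[OF g is_group])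
    finally show False using \<chi>(2) u by simp
  qed
  then show ?thesis using g by blast
qed

text \<open>Near the identity \<chi> = p / q, so \<chi> * q^2 = p * q everywhere. Expanded in
  evaluations, this is a linear relation among characters of the form \<chi> * u and v. Were \<chi>
  not an evaluation, these would be pairwise distinct, hence independent, and q would vanish at the
  identity.\<close>

lemma regular_character:
  fixes A :: "('a, 'm) monoid_scheme"
  defines "G \<equiv> hom_group A complex_units"
  assumes A: "comm_group A"
    and mult: "\<And>g h. g \<in> carrier G \<Longrightarrow> h \<in> carrier G \<Longrightarrow> \<chi> (g \<otimes>\<^bsub>G\<^esub> h) = \<chi> g * \<chi> h"
    and nz: "\<And>g. g \<in> carrier G \<Longrightarrow> \<chi> g \<noteq> 0"
    and reg: "regular_on (carrier G) (evaluations A) W \<chi>" "\<one>\<^bsub>G\<^esub> \<in> W" "W \<subseteq> carrier G"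
  shows "\<exists>u\<in>carrier A. \<forall>g\<in>carrier G. \<chi> g = g u"
proof (rule ccontr)
  assume neg: "\<not> ?thesis"
  interpret A: comm_group A by (rule A)
  interpret G: comm_group G unfolding G_def
    by (rule comm_group_hom_group[OF A.is_group comm_group_complex_units])
  note gA = hom_group_complex_units[of _ A, folded G_def]
  note g1 = hom_group_complex_units_one[of _ A, folded G_def, OF _ A.is_group]
  have Gmult: "(g \<otimes>\<^bsub>G\<^esub> h) u = g u * h u" if "u \<in> carrier A" for g h u
    using that by (simp add: G_def hom_group_def complex_units_def)
  have Gone: "\<one>\<^bsub>G\<^esub> u = 1" if "u \<in> carrier A" for u
    using that by (simp add: G_def hom_group_def complex_units_def)
  have \<chi>1: "\<chi> \<one>\<^bsub>G\<^esub> = 1" using mult[of "\<one>\<^bsub>G\<^esub>" "\<one>\<^bsub>G\<^esub>"] nz[of "\<one>\<^bsub>G\<^esub>"] by simp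
  obtain p q where pq: "p \<in> poly_funs (evaluations A)" "q \<in> poly_funs (evaluations A)" "q \<one>\<^bsub>G\<^esub> \<noteq> 0"
    "\<And>y. y \<in> carrier G \<Longrightarrow> q y \<noteq> 0 \<Longrightarrow> \<chi> y = p y / q y"
    using reg unfolding regular_on_iff[OF reg(3)] by metis
  obtain U c where U: "finite U" "U \<subseteq> carrier A"
    and qc: "\<And>g. g \<in> carrier G \<Longrightarrow> q g * q g = (\<Sum>u\<in>U. c u * g u)"
    using evaluations_span[OF poly_funs.mult[OF pq(2,2)] A.is_group, folded G_def] by blast
  obtain V d where V: "finite V" "V \<subseteq> carrier A"
    and pd: "\<And>g. g \<in> carrier G \<Longrightarrow> p g * q g = (\<Sum>u\<in>V. d u * g u)"
    using evaluations_span[OF poly_funs.mult[OF pq(1,2)] A.is_group, folded G_def] by blast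
  \<comment> \<open>The additional factor \<open>q\<close> makes the identity hold also where
    \<open>q\<close> vanishes.\<close>
  have eq: "\<chi> g * (q g * q g) = p g * q g" if "g \<in> carrier G" for g
    using pq(4)[OF that] by (cases "q g = 0") auto
  let ?I = "U <+> V"
  let ?\<chi> = "\<lambda>i g. case i of Inl u \<Rightarrow> \<chi> g * g u | Inr v \<Rightarrow> g v"
  let ?c = "\<lambda>i. case i of Inl u \<Rightarrow> c u | Inr v \<Rightarrow> - d v"
  have sep: "\<exists>g\<in>carrier G. g u \<noteq> g v" if "u \<in> carrier A" "v \<in> carrier A" "u \<noteq> v" for u v
    unfolding G_def using hom_group_separates[OF A that] .
  have mixed: "\<exists>g\<in>carrier G. \<chi> g * g u \<noteq> g v" if uv: "u \<in> carrier A" "v \<in> carrier A" for u v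
  proof (rule ccontr)
    assume H: "\<not> ?thesis"
    have "\<chi> g = g (v \<otimes>\<^bsub>A\<^esub> inv\<^bsub>A\<^esub> u)" if g: "g \<in> carrier G" for g
    proof -
      have "g u * g (inv\<^bsub>A\<^esub> u) = 1"
        using gA(2)[OF g uv(1), of "inv\<^bsub>A\<^esub> u"] uv g1[OF g] by simp
      moreover have "\<chi> g * g u = g v" using H g by blast
      ultimately have "\<chi> g = g v * g (inv\<^bsub>A\<^esub> u)" by (metis mult.assoc mult.right_neutral)
      then show ?thesis using gA(2)[OF g uv(2), of "inv\<^bsub>A\<^esub> u"] uv by simp
    qed
    then show False using neg uv by (meson A.inv_closed A.m_closed)
  qed
  have "\<forall>i\<in>?I. ?c i = 0"
  proof (rule characters_independent[of ?I G ?\<chi>])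
    show "finite ?I" using U V by simp
    show "monoid G" by (rule G.is_monoid)
    show "?\<chi> i (g \<otimes>\<^bsub>G\<^esub> h) = ?\<chi> i g * ?\<chi> i h"
      if "i \<in> ?I" "g \<in> carrier G" "h \<in> carrier G" for i g h
      using that U V by (auto simp: mult Gmult subset_iff)
    show "?\<chi> i \<one>\<^bsub>G\<^esub> = 1" if "i \<in> ?I" for i using that U V by (auto simp: \<chi>1 Gone subset_iff)
    show "\<exists>g\<in>carrier G. ?\<chi> i g \<noteq> ?\<chi> j g" if ij: "i \<in> ?I" "j \<in> ?I" "i \<noteq> j" for i j
    proof -
      consider u v where "i = Inl u" "j = Inl v" "u \<in> U" "v \<in> U" "u \<noteq> v"
        | u v where "i = Inl u" "j = Inr v" "u \<in> U" "v \<in> V"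
        | u v where "i = Inr v" "j = Inl u" "u \<in> U" "v \<in> V"
        | u v where "i = Inr u" "j = Inr v" "u \<in> V" "v \<in> V" "u \<noteq> v"
        using ij by (elim PlusE) simp_all
      then show ?thesis
      proof cases
        case 1
        then obtain g where "g \<in> carrier G" "g u \<noteq> g v" using sep U by blast
        then show ?thesis using 1 nz by auto
      next
        case 2
        then show ?thesis using mixed[of u v] U V by auto
      next
        case 3
        then show ?thesis using mixed[of u v] U V by (auto simp: eq_commute)
      next
        case 4
        then show ?thesis using sep[of u v] V by auto
      qed
    qed
    show "(\<Sum>i\<in>?I. ?c i * ?\<chi> i g) = 0" if g: "g \<in> carrier G" for g
    proof -
      have "(\<Sum>i\<in>?I. ?c i * ?\<chi> i g) = (\<Sum>u\<in>U. c u * (\<chi> g * g u)) + (\<Sum>v\<in>V. - d v * g v)"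
        using U V by (simp add: sum.Plus)
      also have "\<dots> = \<chi> g * (q g * q g) - p g * q g"
        unfolding qc[OF g] pd[OF g] by (simp add: sum_distrib_left sum_negf mult_ac)
      finally show ?thesis using eq[OF g] by simp
    qed
  qed
  then have "c u = 0" if "u \<in> U" for u using that by (auto dest: bspec[of _ _ "Inl u"])
  then have "q \<one>\<^bsub>G\<^esub> * q \<one>\<^bsub>G\<^esub> = 0" using qc[of "\<one>\<^bsub>G\<^esub>"] by simp
  then show False using pq(3) by simp
qed

section \<open>Sections of equivariant line bundles\<close>

text \<open>Polynomiality is asked for in the point and in the group element separately, as the
  factors of automorphy are studied with one of the two fixed.\<close>

locale g_variety =
  fixes X :: "('g, 'x) gvariety"
  assumes grp: "group (grp X)"
    and act_closed: "\<And>g x. g \<in> carrier (grp X) \<Longrightarrow> x \<in> points X \<Longrightarrow> action X g x \<in> points X"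
    and act_one: "\<And>x. x \<in> points X \<Longrightarrow> action X \<one>\<^bsub>grp X\<^esub> x = x"
    and act_mult: "\<And>g h x. g \<in> carrier (grp X) \<Longrightarrow> h \<in> carrier (grp X) \<Longrightarrow> x \<in> points X \<Longrightarrow>
        action X (g \<otimes>\<^bsub>grp X\<^esub> h) x = action X g (action X h x)"
    and act_poly: "\<And>g c. g \<in> carrier (grp X) \<Longrightarrow> c \<in> coords X \<Longrightarrow>
        (\<lambda>x. c (action X g x)) \<in> poly_funs (coords X)"
    and orbit_poly: "\<And>x c. x \<in> points X \<Longrightarrow> c \<in> coords X \<Longrightarrow>
        (\<lambda>g. c (action X g x)) \<in> poly_funs (grp_coords X)"
begin

abbreviation "G \<equiv> carrier (grp X)"
abbreviation "P \<equiv> points X"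
abbreviation "reg \<equiv> regular_on (points X) (coords X)"

end

locale equivariant_bundle = g_variety X for X :: "('g, 'x) gvariety" +
  fixes L :: "('g, 'x, 'e) line_bundle"
  assumes L: "is_equivariant_line_bundle X L"
begin

lemma lb: "is_line_bundle X L" and ga: "group_action (grp X) (total L) (bundle_action L)"
  using L by (auto simp: is_equivariant_line_bundle_def)

lemma proj_points: "e \<in> total L \<Longrightarrow> proj L e \<in> P"
  using lb by (auto simp: is_line_bundle_def)

lemma chart_open: "(U, \<phi>) \<in> charts L \<Longrightarrow> zariski_open P (coords X) U"
  using lb by (auto simp: is_line_bundle_def)

lemma chart_subset: "(U, \<phi>) \<in> charts L \<Longrightarrow> U \<subseteq> P"
  using chart_open zariski_open_subset by blast

lemma chart_exists:
  assumes "x \<in> P" obtains U \<phi> where "(U, \<phi>) \<in> charts L" "x \<in> U"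
proof -
  have "P = (\<Union>(U, \<phi>) \<in> charts L. U)" using lb unfolding is_line_bundle_def by (elim conjE)
  then show ?thesis using assms that by auto
qed

lemma chart_bij:
  "(U, \<phi>) \<in> charts L \<Longrightarrow> bij_betw (\<lambda>e. (proj L e, \<phi> e)) {e \<in> total L. proj L e \<in> U} (U \<times> UNIV)"
  using lb by (auto simp: is_line_bundle_def)

lemma fibre_unique:
  assumes "(U, \<phi>) \<in> charts L" "e \<in> total L" "e' \<in> total L" "proj L e = proj L e'" "proj L e \<in> U"
    "\<phi> e = \<phi> e'"
  shows "e = e'"
  using bij_betw_imp_inj_on[OF chart_bij[OF assms(1)]] assms(2-) by (simp add: inj_on_def)

lemma fibre_exists:
  assumes "(U, \<phi>) \<in> charts L" "x \<in> U"
  obtains e where "e \<in> total L" "proj L e = x" "\<phi> e = c"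
proof -
  have "(x, c) \<in> (\<lambda>e. (proj L e, \<phi> e)) ` {e \<in> total L. proj L e \<in> U}"
    unfolding bij_betw_imp_surj_on[OF chart_bij[OF assms(1)]] using assms(2) by simp
  then show ?thesis using that by auto
qed

lemma transition:
  assumes c: "(U, \<phi>) \<in> charts L" "(V, \<psi>) \<in> charts L"
  obtains f where "reg (U \<inter> V) f" "\<And>x. x \<in> U \<inter> V \<Longrightarrow> f x \<noteq> 0"
    "\<And>e. e \<in> total L \<Longrightarrow> proj L e \<in> U \<inter> V \<Longrightarrow> \<psi> e = f (proj L e) * \<phi> e"
proof -
  have "\<forall>(U, \<phi>) \<in> charts L. \<forall>(V, \<psi>) \<in> charts L.
      \<exists>f. reg (U \<inter> V) f \<and> (\<forall>e \<in> total L. proj L e \<in> U \<inter> V \<longrightarrow> \<psi> e = f (proj L e) * \<phi> e)"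
    using lb unfolding is_line_bundle_def by (elim conjE)
  from bspec[OF bspec[OF this c(1), unfolded prod.case] c(2), unfolded prod.case]
  obtain f where f: "reg (U \<inter> V) f"
    "\<And>e. e \<in> total L \<Longrightarrow> proj L e \<in> U \<inter> V \<Longrightarrow> \<psi> e = f (proj L e) * \<phi> e" by blast
  \<comment> \<open>Invertibility of transition functions is not part of
    \<open>is_line_bundle\<close>; an element of the fibre with coordinate 1 shows it.\<close>
  have "f x \<noteq> 0" if x: "x \<in> U \<inter> V" for x
  proof -
    obtain e where e: "e \<in> total L" "proj L e = x" "\<psi> e = 1"
      using fibre_exists[OF c(2), of x 1] x by blast
    then show ?thesis using f(2)[OF e(1)] x by auto
  qed
  then show ?thesis using that f by blast
qed

lemma action_chart:
  assumes c: "(U, \<phi>) \<in> charts L" "(V, \<psi>) \<in> charts L"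
  obtains a where "regular_on (G \<times> P) (prod_coords (grp_coords X) (coords X))
              {(g, x). g \<in> G \<and> x \<in> U \<and> action X g x \<in> V} a"
      "\<And>g e. g \<in> G \<Longrightarrow> e \<in> total L \<Longrightarrow> proj L e \<in> U \<Longrightarrow> action X g (proj L e) \<in> V \<Longrightarrow>
         \<psi> (bundle_action L g e) = a (g, proj L e) * \<phi> e"
proof -
  have "\<forall>(U, \<phi>) \<in> charts L. \<forall>(V, \<psi>) \<in> charts L.
      \<exists>a. regular_on (carrier (grp X) \<times> points X) (prod_coords (grp_coords X) (coords X))
            {(g, x). g \<in> carrier (grp X) \<and> x \<in> U \<and> action X g x \<in> V} a \<and>
          (\<forall>g \<in> carrier (grp X). \<forall>e \<in> total L.
             proj L e \<in> U \<and> action X g (proj L e) \<in> V \<longrightarrow>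
             \<psi> (bundle_action L g e) = a (g, proj L e) * \<phi> e)"
    using L unfolding is_equivariant_line_bundle_def by (elim conjE)
  from bspec[OF bspec[OF this c(1), unfolded prod.case] c(2), unfolded prod.case]
  show ?thesis using that by blast
qed

lemma action_total: "g \<in> G \<Longrightarrow> e \<in> total L \<Longrightarrow> bundle_action L g e \<in> total L"
  using group_action.element_image[OF ga _ _ refl] .

lemma action_proj: "g \<in> G \<Longrightarrow> e \<in> total L \<Longrightarrow> proj L (bundle_action L g e) = action X g (proj L e)"
  using L by (auto simp: is_equivariant_line_bundle_def)

lemma action_comp: "g \<in> G \<Longrightarrow> h \<in> G \<Longrightarrow> e \<in> total L \<Longrightarrow>
    bundle_action L (g \<otimes>\<^bsub>grp X\<^esub> h) e = bundle_action L g (bundle_action L h e)"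
  using group_action.composition_rule[OF ga] by blast

lemma action_id: "e \<in> total L \<Longrightarrow> bundle_action L \<one>\<^bsub>grp X\<^esub> e = e"
  using group_action.id_eq_one[OF ga] by (metis restrict_apply')

section \<open>Nonvanishing sections and their factors of automorphy\<close>

definition nonvanishing_section :: "('x \<Rightarrow> 'e) \<Rightarrow> bool" where
  "nonvanishing_section s \<longleftrightarrow> (\<forall>x\<in>P. s x \<in> total L \<and> proj L (s x) = x) \<and>
     (\<forall>U \<phi>. (U, \<phi>) \<in> charts L \<longrightarrow> reg U (\<lambda>x. \<phi> (s x)) \<and> (\<forall>x\<in>U. \<phi> (s x) \<noteq> 0))"

text \<open>The multiple of \<open>s x\<close> by \<open>c\<close> in its fibre. The fibres carry no
  operations of their own, so it is determined by its coordinates in the charts.\<close>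

definition scaled :: "('x \<Rightarrow> 'e) \<Rightarrow> 'x \<Rightarrow> complex \<Rightarrow> 'e" where
  "scaled s x c = (THE e. e \<in> total L \<and> proj L e = x \<and>
     (\<forall>U \<phi>. (U, \<phi>) \<in> charts L \<longrightarrow> x \<in> U \<longrightarrow> \<phi> e = c * \<phi> (s x)))"

context
  fixes s assumes s: "nonvanishing_section s"
begin

lemma section_total: "x \<in> P \<Longrightarrow> s x \<in> total L" "x \<in> P \<Longrightarrow> proj L (s x) = x"
  using s by (auto simp: nonvanishing_section_def)

lemma section_chart: "(U, \<phi>) \<in> charts L \<Longrightarrow> reg U (\<lambda>x. \<phi> (s x))"
    "(U, \<phi>) \<in> charts L \<Longrightarrow> x \<in> U \<Longrightarrow> \<phi> (s x) \<noteq> 0"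
  using s unfolding nonvanishing_section_def by blast+

text \<open>Transition functions act linearly on the fibres, so the condition in one chart implies
  it in all.\<close>

lemma scaled_props:
  assumes x: "x \<in> P"
  shows scaled_total: "scaled s x c \<in> total L" and scaled_proj: "proj L (scaled s x c) = x"
    and scaled_chart: "(U, \<phi>) \<in> charts L \<Longrightarrow> x \<in> U \<Longrightarrow> \<phi> (scaled s x c) = c * \<phi> (s x)"
proof -
  let ?Q = "\<lambda>e. e \<in> total L \<and> proj L e = x \<and>
     (\<forall>U \<phi>. (U, \<phi>) \<in> charts L \<longrightarrow> x \<in> U \<longrightarrow> \<phi> e = c * \<phi> (s x))"
  obtain U \<phi> where U: "(U, \<phi>) \<in> charts L" "x \<in> U" using chart_exists[OF x] .
  obtain e where e: "e \<in> total L" "proj L e = x" "\<phi> e = c * \<phi> (s x)"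
    using fibre_exists[OF U] by blast
  have "\<psi> e = c * \<psi> (s x)" if V: "(V, \<psi>) \<in> charts L" "x \<in> V" for V \<psi>
  proof -
    obtain f where f: "\<And>e. e \<in> total L \<Longrightarrow> proj L e \<in> U \<inter> V \<Longrightarrow> \<psi> e = f (proj L e) * \<phi> e"
      using transition[OF U(1) V(1)] by metis
    show ?thesis using f[OF e(1)] f[OF section_total(1)[OF x]] section_total(2)[OF x] e U V by simp
  qed
  then have "?Q e" using e by blast
  moreover have "e' = e" if "?Q e'" for e'
    using fibre_unique[OF U(1), of e' e] that e U by auto
  ultimately have "?Q (scaled s x c)" unfolding scaled_def by (rule theI)
  then show "scaled s x c \<in> total L" "proj L (scaled s x c) = x"
    "(U, \<phi>) \<in> charts L \<Longrightarrow> x \<in> U \<Longrightarrow> \<phi> (scaled s x c) = c * \<phi> (s x)" for U \<phi> by blast+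
qed

lemma scaled_eqI:
  assumes e: "e \<in> total L" "proj L e = x" and U: "(U, \<phi>) \<in> charts L" "x \<in> U"
    and c: "\<phi> e = c * \<phi> (s x)"
  shows "e = scaled s x c"
proof -
  have x: "x \<in> P" using e proj_points by blast
  show ?thesis
    by (rule fibre_unique[OF U(1) e(1) scaled_total[OF x]])
      (use scaled_proj[OF x] scaled_chart[OF x U] e U c in simp_all)
qed

lemma scaled_exists:
  assumes "e \<in> total L" obtains c where "e = scaled s (proj L e) c"
proof -
  obtain U \<phi> where U: "(U, \<phi>) \<in> charts L" "proj L e \<in> U" using chart_exists[OF proj_points[OF assms]] .
  show ?thesis
    by (rule that[of "\<phi> e / \<phi> (s (proj L e))"], rule scaled_eqI[OF assms refl U])
      (use section_chart(2)[OF U] in simp)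
qed

lemma scaled_inj:
  assumes x: "x \<in> P" and "scaled s x c = scaled s x c'" shows "c = c'"
proof -
  obtain U \<phi> where U: "(U, \<phi>) \<in> charts L" "x \<in> U" using chart_exists[OF x] .
  have "\<phi> (scaled s x c) = \<phi> (scaled s x c')" by (rule arg_cong[OF assms(2)])
  then have "c * \<phi> (s x) = c' * \<phi> (s x)" unfolding scaled_chart[OF x U] .
  then show ?thesis using section_chart(2)[OF U] by simp
qed

lemma scaled_one: "x \<in> P \<Longrightarrow> scaled s x 1 = s x"
proof -
  assume x: "x \<in> P"
  obtain U \<phi> where U: "(U, \<phi>) \<in> charts L" "x \<in> U" using chart_exists[OF x] .
  show ?thesis using scaled_eqI[OF section_total[OF x] U, of 1] by simp
qed

lemma scaled_bij: "bij_betw (\<lambda>(x, c). scaled s x c) (P \<times> UNIV) (total L)"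
  unfolding bij_betw_def
proof
  show "inj_on (\<lambda>(x, c). scaled s x c) (P \<times> UNIV)"
  proof (rule inj_onI, clarify)
    fix x c y d assume xy: "x \<in> P" "y \<in> P" and eq: "scaled s x c = scaled s y d"
    then have "x = y" using scaled_proj by metis
    then show "x = y \<and> c = d" using scaled_inj xy eq by blast
  qed
  show "(\<lambda>(x, c). scaled s x c) ` (P \<times> UNIV) = total L"
  proof
    show "(\<lambda>(x, c). scaled s x c) ` (P \<times> UNIV) \<subseteq> total L" using scaled_total by auto
    show "total L \<subseteq> (\<lambda>(x, c). scaled s x c) ` (P \<times> UNIV)"
    proof
      fix e assume e: "e \<in> total L"
      obtain c where "e = scaled s (proj L e) c" using scaled_exists[OF e] .
      then show "e \<in> (\<lambda>(x, c). scaled s x c) ` (P \<times> UNIV)" using proj_points[OF e]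
        by (intro image_eqI[of _ _ "(proj L e, c)"]) auto
    qed
  qed
qed

text \<open>The factor of automorphy of \<open>s\<close>, which measures how far the section is from
  being invariant.\<close>

definition automorphy :: "'g \<Rightarrow> 'x \<Rightarrow> complex" where
  "automorphy g x = (THE c. bundle_action L g (s x) = scaled s (action X g x) c)"

lemma automorphy:
  assumes g: "g \<in> G" and x: "x \<in> P"
  shows "bundle_action L g (s x) = scaled s (action X g x) (automorphy g x)"
proof -
  have e: "bundle_action L g (s x) \<in> total L" "proj L (bundle_action L g (s x)) = action X g x"
    using action_total[OF g section_total(1)[OF x]] action_proj[OF g section_total(1)[OF x]]
      section_total(2)[OF x] by simp_all
  obtain c where c: "bundle_action L g (s x) = scaled s (action X g x) c"
    using scaled_exists[OF e(1)] e(2) by metis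
  show ?thesis unfolding automorphy_def
  proof (rule theI)
    show "bundle_action L g (s x) = scaled s (action X g x) c" by (rule c)
    fix d assume "bundle_action L g (s x) = scaled s (action X g x) d"
    then have "scaled s (action X g x) d = scaled s (action X g x) c" using c by simp
    then show "d = c" by (rule scaled_inj[OF act_closed[OF g x]])
  qed
qed

lemma action_scaled:
  assumes g: "g \<in> G" and x: "x \<in> P"
  shows "bundle_action L g (scaled s x c) = scaled s (action X g x) (automorphy g x * c)"
proof -
  have gx: "action X g x \<in> P" using act_closed[OF g x] .
  obtain U \<phi> where U: "(U, \<phi>) \<in> charts L" "x \<in> U" using chart_exists[OF x] .
  obtain V \<psi> where V: "(V, \<psi>) \<in> charts L" "action X g x \<in> V" using chart_exists[OF gx] .
  obtain a where "regular_on (G \<times> P) (prod_coords (grp_coords X) (coords X))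
              {(g, x). g \<in> G \<and> x \<in> U \<and> action X g x \<in> V} a"
    and a: "\<And>g e. g \<in> G \<Longrightarrow> e \<in> total L \<Longrightarrow> proj L e \<in> U \<Longrightarrow> action X g (proj L e) \<in> V \<Longrightarrow>
         \<psi> (bundle_action L g e) = a (g, proj L e) * \<phi> e"
    by (rule action_chart[OF U(1) V(1)], rule that)
  have "\<psi> (bundle_action L g (scaled s x c)) = a (g, x) * \<phi> (scaled s x c)"
    using a[OF g scaled_total[OF x]] scaled_proj[OF x] U V by simp
  also have "\<dots> = c * (a (g, x) * \<phi> (s x))" using scaled_chart[OF x U] by simp
  also have "a (g, x) * \<phi> (s x) = \<psi> (bundle_action L g (s x))"
    using a[OF g section_total(1)[OF x]] section_total(2)[OF x] U V by simp
  also have "\<dots> = automorphy g x * \<psi> (s (action X g x))"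
    using automorphy[OF g x] scaled_chart[OF gx V] by simp
  finally have "\<psi> (bundle_action L g (scaled s x c)) = (automorphy g x * c) * \<psi> (s (action X g x))"
    by simp
  then show ?thesis
    by (intro scaled_eqI[OF _ _ V] action_total[OF g] scaled_total[OF x])
      (simp_all add: action_proj[OF g scaled_total[OF x]] scaled_proj[OF x])
qed

lemma automorphy_eqI:
  assumes g: "g \<in> G" and x: "x \<in> P" and V: "(V, \<psi>) \<in> charts L" "action X g x \<in> V"
    and c: "\<psi> (bundle_action L g (s x)) = c * \<psi> (s (action X g x))"
  shows "automorphy g x = c"
proof -
  have "automorphy g x * \<psi> (s (action X g x)) = c * \<psi> (s (action X g x))"
    using c unfolding automorphy[OF g x] scaled_chart[OF act_closed[OF g x] V] .
  then show ?thesis using section_chart(2)[OF V] by simp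
qed

text \<open>The cocycle identity. Once the factor is known to be constant in \<open>x\<close>, it
  says that the factor is a character.\<close>

lemma automorphy_mult:
  assumes g: "g \<in> G" and h: "h \<in> G" and x: "x \<in> P"
  shows "automorphy (g \<otimes>\<^bsub>grp X\<^esub> h) x = automorphy g (action X h x) * automorphy h x"
proof -
  interpret G: group "grp X" by (rule grp)
  have hx: "action X h x \<in> P" using act_closed[OF h x] .
  have "scaled s (action X g (action X h x)) (automorphy (g \<otimes>\<^bsub>grp X\<^esub> h) x) =
      bundle_action L (g \<otimes>\<^bsub>grp X\<^esub> h) (s x)"
    using automorphy[OF _ x, of "g \<otimes>\<^bsub>grp X\<^esub> h"] g h act_mult[OF g h x] by simp
  also have "\<dots> = bundle_action L g (scaled s (action X h x) (automorphy h x))"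
    using action_comp[OF g h section_total(1)[OF x]] automorphy[OF h x] by simp
  also have "\<dots> = scaled s (action X g (action X h x)) (automorphy g (action X h x) * automorphy h x)"
    using action_scaled[OF g hx] .
  finally show ?thesis by (rule scaled_inj[OF act_closed[OF g hx]])
qed

lemma automorphy_one: "x \<in> P \<Longrightarrow> automorphy \<one>\<^bsub>grp X\<^esub> x = 1"
proof -
  assume x: "x \<in> P"
  interpret G: group "grp X" by (rule grp)
  have "scaled s x (automorphy \<one>\<^bsub>grp X\<^esub> x) = scaled s x 1"
    using automorphy[OF G.one_closed x] action_id[OF section_total(1)[OF x]] act_one[OF x]
      scaled_one[OF x] by simp
  then show ?thesis by (rule scaled_inj[OF x])
qed

lemma automorphy_nonzero:
  assumes g: "g \<in> G" and x: "x \<in> P" shows "automorphy g x \<noteq> 0"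
proof -
  interpret G: group "grp X" by (rule grp)
  have "automorphy (inv\<^bsub>grp X\<^esub> g) (action X g x) * automorphy g x = 1"
    using automorphy_mult[OF G.inv_closed[OF g] g x] automorphy_one[OF x] g by simp
  then show ?thesis by auto
qed

text \<open>In charts, the factor is the quotient of a * \<phi> (s x) by the value of \<psi> on the
  section at the translate of x. Pulling it back along a polynomial family of pairs treats the case
  of fixed \<open>g\<close> and that of fixed \<open>x\<close> at once.\<close>

lemma automorphy_regular:
  assumes U: "(U, \<phi>) \<in> charts L" and V: "(V, \<psi>) \<in> charts L"
    and \<gamma>: "\<And>y. y \<in> Y \<Longrightarrow> \<gamma> y \<in> G" "\<And>c. c \<in> grp_coords X \<Longrightarrow> (\<lambda>y. c (\<gamma> y)) \<in> poly_funs D"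
    and \<xi>: "\<And>y. y \<in> Y \<Longrightarrow> \<xi> y \<in> P" "\<And>c. c \<in> coords X \<Longrightarrow> (\<lambda>y. c (\<xi> y)) \<in> poly_funs D"
    and \<gamma>\<xi>: "\<And>c. c \<in> coords X \<Longrightarrow> (\<lambda>y. c (action X (\<gamma> y) (\<xi> y))) \<in> poly_funs D"
  shows "regular_on Y D {y \<in> Y. \<xi> y \<in> U \<and> action X (\<gamma> y) (\<xi> y) \<in> V} (\<lambda>y. automorphy (\<gamma> y) (\<xi> y))"
proof -
  obtain a where a: "regular_on (G \<times> P) (prod_coords (grp_coords X) (coords X))
              {(g, x). g \<in> G \<and> x \<in> U \<and> action X g x \<in> V} a"
    "\<And>g e. g \<in> G \<Longrightarrow> e \<in> total L \<Longrightarrow> proj L e \<in> U \<Longrightarrow> action X g (proj L e) \<in> V \<Longrightarrow>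
         \<psi> (bundle_action L g e) = a (g, proj L e) * \<phi> e"
    by (rule action_chart[OF U V], rule that)
  let ?W = "{(g, x). g \<in> G \<and> x \<in> U \<and> action X g x \<in> V}"
  have W: "?W \<subseteq> G \<times> P" using chart_subset[OF U] by blast
  have 1: "regular_on Y D {y \<in> Y. (\<gamma> y, \<xi> y) \<in> ?W} (\<lambda>y. a (\<gamma> y, \<xi> y))"
  proof (rule regular_on_pullback[OF a(1) W])
    show "(\<gamma> y, \<xi> y) \<in> G \<times> P" if "y \<in> Y" for y using \<gamma>(1) \<xi>(1) that by simp
    show "(\<lambda>y. c (\<gamma> y, \<xi> y)) \<in> poly_funs D" if "c \<in> prod_coords (grp_coords X) (coords X)" for c
      using that \<gamma>(2) \<xi>(2) by (auto simp: prod_coords_def)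
  qed
  have 2: "regular_on Y D {y \<in> Y. \<xi> y \<in> U} (\<lambda>y. \<phi> (s (\<xi> y)))"
    by (rule regular_on_pullback[OF section_chart(1)[OF U] chart_subset[OF U], where F = \<xi>])
      (erule \<xi>)+
  have 3: "regular_on Y D {y \<in> Y. action X (\<gamma> y) (\<xi> y) \<in> V} (\<lambda>y. \<psi> (s (action X (\<gamma> y) (\<xi> y))))"
    by (rule regular_on_pullback[OF section_chart(1)[OF V] chart_subset[OF V],
          where F = "\<lambda>y. action X (\<gamma> y) (\<xi> y)"]) (rule act_closed \<gamma>(1) \<xi>(1) \<gamma>\<xi> | assumption)+
  have 4: "regular_on Y D {y \<in> Y. action X (\<gamma> y) (\<xi> y) \<in> V} (\<lambda>y. 1 / \<psi> (s (action X (\<gamma> y) (\<xi> y))))"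
    by (rule regular_on_inverse[OF 3]) (use section_chart(2)[OF V] in auto)
  have 5: "regular_on Y D ({y \<in> Y. (\<gamma> y, \<xi> y) \<in> ?W} \<inter> ({y \<in> Y. \<xi> y \<in> U} \<inter>
        {y \<in> Y. action X (\<gamma> y) (\<xi> y) \<in> V}))
      (\<lambda>y. a (\<gamma> y, \<xi> y) * (\<phi> (s (\<xi> y)) * (1 / \<psi> (s (action X (\<gamma> y) (\<xi> y))))))"
    by (intro regular_on_mult 1 2 4) auto
  have 6: "{y \<in> Y. (\<gamma> y, \<xi> y) \<in> ?W} \<inter> ({y \<in> Y. \<xi> y \<in> U} \<inter> {y \<in> Y. action X (\<gamma> y) (\<xi> y) \<in> V}) =
      {y \<in> Y. \<xi> y \<in> U \<and> action X (\<gamma> y) (\<xi> y) \<in> V}" using \<gamma>(1) by auto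
  show ?thesis
  proof (rule regular_on_cong[OF 5[unfolded 6]])
    fix y assume y: "y \<in> {y \<in> Y. \<xi> y \<in> U \<and> action X (\<gamma> y) (\<xi> y) \<in> V}"
    then have gx: "\<gamma> y \<in> G" "\<xi> y \<in> P" using \<gamma>(1) \<xi>(1) by auto
    have "a (\<gamma> y, \<xi> y) * \<phi> (s (\<xi> y)) = \<psi> (bundle_action L (\<gamma> y) (s (\<xi> y)))"
      using a(2)[OF gx(1) section_total(1)[OF gx(2)]] section_total(2)[OF gx(2)] y by simp
    also have "\<dots> = automorphy (\<gamma> y) (\<xi> y) * \<psi> (s (action X (\<gamma> y) (\<xi> y)))"
      using automorphy[OF gx] scaled_chart[OF act_closed[OF gx] V] y by simp
    finally show "a (\<gamma> y, \<xi> y) * (\<phi> (s (\<xi> y)) * (1 / \<psi> (s (action X (\<gamma> y) (\<xi> y))))) =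
        automorphy (\<gamma> y) (\<xi> y)"
      using section_chart(2)[OF V] y by (simp add: field_simps)
  qed
qed

lemma automorphy_regular_point:
  assumes g: "g \<in> G" shows "reg P (automorphy g)"
proof (rule regular_on_local)
  fix x assume x: "x \<in> P"
  obtain U \<phi> where U: "(U, \<phi>) \<in> charts L" "x \<in> U" using chart_exists[OF x] .
  obtain V \<psi> where V: "(V, \<psi>) \<in> charts L" "action X g x \<in> V"
    using chart_exists[OF act_closed[OF g x]] .
  have "reg {y \<in> P. y \<in> U \<and> action X g y \<in> V} (\<lambda>y. automorphy g y)"
    by (rule automorphy_regular[OF U(1) V(1)])
      (use g act_poly in \<open>auto intro: poly_funs.const poly_funs.coord\<close>)
  then show "\<exists>V. x \<in> V \<and> V \<subseteq> P \<and> reg V (automorphy g)"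
    using x U V by (intro exI[of _ "{y \<in> P. y \<in> U \<and> action X g y \<in> V}"]) auto
qed

text \<open>Using one chart both at \<open>x\<close> and at its translate restricts the group to a
  neighbourhood of the identity, which is as much as \<open>regular_character\<close> asks
  for.\<close>

lemma automorphy_regular_group:
  assumes x: "x \<in> P"
  obtains W where "\<one>\<^bsub>grp X\<^esub> \<in> W" "W \<subseteq> G" "regular_on G (grp_coords X) W (\<lambda>g. automorphy g x)"
proof -
  interpret G: group "grp X" by (rule grp)
  obtain U \<phi> where U: "(U, \<phi>) \<in> charts L" "x \<in> U" using chart_exists[OF x] .
  have "regular_on G (grp_coords X) {g \<in> G. x \<in> U \<and> action X g x \<in> U} (\<lambda>g. automorphy g x)"
    by (rule automorphy_regular[OF U(1) U(1)])
      (use x orbit_poly in \<open>auto intro: poly_funs.const poly_funs.coord\<close>)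
  then show ?thesis using that[of "{g \<in> G. x \<in> U \<and> action X g x \<in> U}"] U act_one[OF x] by auto
qed

end

end

section \<open>The Picard group and its weights\<close>

text \<open>Assumptions of a locale are not polymorphic, so \<open>cocycle_trivial\<close> has the charts of the bundles
  in \<open>line_bundles X\<close> as its indices.\<close>

locale picard_variety = g_variety X for X :: "('g, 'x) gvariety" +
  fixes A :: "('a, 'm) monoid_scheme" and w :: "'a \<Rightarrow> 'g \<Rightarrow> complex" and x0 :: 'x
  assumes A: "comm_group A"
    and base_point: "x0 \<in> points X"
    and cocycle_trivial: "\<And>(I :: ('x set \<times> ('x \<times> complex \<Rightarrow> complex)) set) U f.
      (\<And>i. i \<in> I \<Longrightarrow> zariski_open (points X) (coords X) (U i)) \<Longrightarrow>
      (\<Union>i\<in>I. U i) = points X \<Longrightarrow>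
      (\<And>i j. i \<in> I \<Longrightarrow> j \<in> I \<Longrightarrow> regular_on (points X) (coords X) (U i \<inter> U j) (f i j)) \<Longrightarrow>
      (\<And>i j x. i \<in> I \<Longrightarrow> j \<in> I \<Longrightarrow> x \<in> U i \<inter> U j \<Longrightarrow> f i j x \<noteq> 0) \<Longrightarrow>
      (\<And>i j k x. i \<in> I \<Longrightarrow> j \<in> I \<Longrightarrow> k \<in> I \<Longrightarrow> x \<in> U i \<inter> U j \<inter> U k \<Longrightarrow>
        f i j x * f j k x = f i k x) \<Longrightarrow>
      \<exists>h. (\<forall>i\<in>I. regular_on (points X) (coords X) (U i) (h i) \<and> (\<forall>x\<in>U i. h i x \<noteq> 0)) \<and>
        (\<forall>i\<in>I. \<forall>j\<in>I. \<forall>x\<in>U i \<inter> U j. h j x = f i j x * h i x)"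
    and unit_constant: "\<And>f. regular_on (points X) (coords X) (points X) f \<Longrightarrow>
      (\<And>x. x \<in> points X \<Longrightarrow> f x \<noteq> 0) \<Longrightarrow> \<exists>c. \<forall>x\<in>points X. f x = c"
    and w_coord: "\<And>u. u \<in> carrier A \<Longrightarrow> w u \<in> grp_coords X"
    and w_mult: "\<And>u g h. u \<in> carrier A \<Longrightarrow> g \<in> carrier (grp X) \<Longrightarrow> h \<in> carrier (grp X) \<Longrightarrow>
      w u (g \<otimes>\<^bsub>grp X\<^esub> h) = w u g * w u h"
    and w_nonzero: "\<And>u g. u \<in> carrier A \<Longrightarrow> g \<in> carrier (grp X) \<Longrightarrow> w u g \<noteq> 0"
    and w_hom: "\<And>u v g. u \<in> carrier A \<Longrightarrow> v \<in> carrier A \<Longrightarrow> g \<in> carrier (grp X) \<Longrightarrow>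
      w (u \<otimes>\<^bsub>A\<^esub> v) g = w u g * w v g"
    and w_inj: "\<And>u v. u \<in> carrier A \<Longrightarrow> v \<in> carrier A \<Longrightarrow>
      (\<And>g. g \<in> carrier (grp X) \<Longrightarrow> w u g = w v g) \<Longrightarrow> u = v"
    and character: "\<And>\<chi> W. (\<And>g h. g \<in> carrier (grp X) \<Longrightarrow> h \<in> carrier (grp X) \<Longrightarrow>
        \<chi> (g \<otimes>\<^bsub>grp X\<^esub> h) = \<chi> g * \<chi> h) \<Longrightarrow>
      (\<And>g. g \<in> carrier (grp X) \<Longrightarrow> \<chi> g \<noteq> 0) \<Longrightarrow>
      regular_on (carrier (grp X)) (grp_coords X) W \<chi> \<Longrightarrow> \<one>\<^bsub>grp X\<^esub> \<in> W \<Longrightarrow>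
      W \<subseteq> carrier (grp X) \<Longrightarrow> \<exists>u\<in>carrier A. \<forall>g\<in>carrier (grp X). \<chi> g = w u g"
begin

lemma bundleI: "L \<in> line_bundles X \<Longrightarrow> equivariant_bundle X L"
  by unfold_locales (simp add: line_bundles_def)

text \<open>Bundles will be classified by the weights of their frames: every bundle has a frame, and
  its weight is unique.\<close>

definition frame :: "('g, 'x, 'x \<times> complex) line_bundle \<Rightarrow> 'a \<Rightarrow> ('x \<Rightarrow> 'x \<times> complex) \<Rightarrow> bool" where
  "frame L u s \<longleftrightarrow> equivariant_bundle.nonvanishing_section X L s \<and>
     (\<forall>g\<in>G. \<forall>x\<in>P. equivariant_bundle.automorphy X L s g x = w u g)"

lemma frame_section: "frame L u s \<Longrightarrow> equivariant_bundle.nonvanishing_section X L s"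
  and frame_automorphy: "frame L u s \<Longrightarrow> g \<in> G \<Longrightarrow> x \<in> P \<Longrightarrow>
    equivariant_bundle.automorphy X L s g x = w u g"
  by (simp_all add: frame_def)

text \<open>The transition functions of the charts form a cocycle. Functions \<open>h\<close> that
  make it a coboundary are compatible coordinates, and thus determine one element in each
  fibre.\<close>

lemma section_exists:
  assumes "L \<in> line_bundles X"
  shows "\<exists>s. equivariant_bundle.nonvanishing_section X L s"
proof -
  interpret L: equivariant_bundle X L by (rule bundleI[OF assms])
  let ?I = "charts L"
  have "\<forall>c\<in>?I \<times> ?I. \<exists>f. reg (fst (fst c) \<inter> fst (snd c)) f \<and>
      (\<forall>x \<in> fst (fst c) \<inter> fst (snd c). f x \<noteq> 0) \<and>
      (\<forall>e. e \<in> total L \<longrightarrow> proj L e \<in> fst (fst c) \<inter> fst (snd c) \<longrightarrow>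
         snd (snd c) e = f (proj L e) * snd (fst c) e)"
  proof
    fix c assume c: "c \<in> ?I \<times> ?I"
    then obtain U \<phi> V \<psi> where UV: "c = ((U, \<phi>), (V, \<psi>))" "(U, \<phi>) \<in> ?I" "(V, \<psi>) \<in> ?I"
      by (cases c) auto
    obtain f where "reg (U \<inter> V) f" "\<And>x. x \<in> U \<inter> V \<Longrightarrow> f x \<noteq> 0"
      "\<And>e. e \<in> total L \<Longrightarrow> proj L e \<in> U \<inter> V \<Longrightarrow> \<psi> e = f (proj L e) * \<phi> e"
      by (rule L.transition[OF UV(2,3)], rule that)
    then show "\<exists>f. reg (fst (fst c) \<inter> fst (snd c)) f \<and>
      (\<forall>x \<in> fst (fst c) \<inter> fst (snd c). f x \<noteq> 0) \<and>
      (\<forall>e. e \<in> total L \<longrightarrow> proj L e \<in> fst (fst c) \<inter> fst (snd c) \<longrightarrow>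
         snd (snd c) e = f (proj L e) * snd (fst c) e)"
      unfolding UV(1) fst_conv snd_conv by (intro exI[of _ f]) blast
  qed
  from bchoice[OF this] obtain F where F:
    "\<forall>c\<in>?I \<times> ?I. reg (fst (fst c) \<inter> fst (snd c)) (F c) \<and>
      (\<forall>x \<in> fst (fst c) \<inter> fst (snd c). F c x \<noteq> 0) \<and>
      (\<forall>e. e \<in> total L \<longrightarrow> proj L e \<in> fst (fst c) \<inter> fst (snd c) \<longrightarrow>
         snd (snd c) e = F c (proj L e) * snd (fst c) e)" ..
  define f where "f i j = F (i, j)" for i j
  have freg: "reg (fst i \<inter> fst j) (f i j)"
    and fnz: "\<And>x. x \<in> fst i \<inter> fst j \<Longrightarrow> f i j x \<noteq> 0"
    and ftr: "\<And>e. e \<in> total L \<Longrightarrow> proj L e \<in> fst i \<inter> fst j \<Longrightarrow> snd j e = f i j (proj L e) * snd i e"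
    if "i \<in> ?I" "j \<in> ?I" for i j
    using bspec[OF F SigmaI[OF that]] unfolding f_def fst_conv snd_conv by blast+
  have "\<exists>h. (\<forall>i\<in>?I. reg (fst i) (h i) \<and> (\<forall>x\<in>fst i. h i x \<noteq> 0)) \<and>
        (\<forall>i\<in>?I. \<forall>j\<in>?I. \<forall>x\<in>fst i \<inter> fst j. h j x = f i j x * h i x)"
  proof (rule cocycle_trivial)
    show "zariski_open P (coords X) (fst i)" if "i \<in> ?I" for i
      using L.chart_open[of "fst i" "snd i"] that by simp
    show "(\<Union>i\<in>?I. fst i) = P"
    proof
      show "(\<Union>i\<in>?I. fst i) \<subseteq> P" using L.chart_subset by fastforce
      show "P \<subseteq> (\<Union>i\<in>?I. fst i)"
      proof
        fix x assume x: "x \<in> P"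
        obtain U \<phi> where "(U, \<phi>) \<in> ?I" "x \<in> U" using L.chart_exists[OF x] .
        then show "x \<in> (\<Union>i\<in>?I. fst i)" by (intro UN_I[of "(U, \<phi>)"]) simp_all
      qed
    qed
    show "f i j x * f j k x = f i k x"
      if ijk: "i \<in> ?I" "j \<in> ?I" "k \<in> ?I" "x \<in> fst i \<inter> fst j \<inter> fst k" for i j k x
    proof -
      \<comment> \<open>The coordinates of the fibre element with coordinate 1 in the chart
        \<open>i\<close> are the transition functions out of \<open>i\<close>.\<close>
      have "(fst i, snd i) \<in> ?I" "x \<in> fst i" using ijk by simp_all
      from L.fibre_exists[OF this, of 1]
      obtain e where e: "e \<in> total L" "proj L e = x" "snd i e = 1" by metis
      have "snd j e = f i j x" using ftr[OF ijk(1,2) e(1)] e ijk(4) by simp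
      moreover have "snd k e = f i k x" using ftr[OF ijk(1,3) e(1)] e ijk(4) by simp
      moreover have "snd k e = f j k x * snd j e" using ftr[OF ijk(2,3) e(1)] e ijk(4) by simp
      ultimately show ?thesis by (simp add: mult.commute)
    qed
    show "reg (fst i \<inter> fst j) (f i j)" if "i \<in> ?I" "j \<in> ?I" for i j using freg[OF that] .
    show "f i j x \<noteq> 0" if "i \<in> ?I" "j \<in> ?I" "x \<in> fst i \<inter> fst j" for i j x using fnz[OF that] .
  qed
  then obtain h where h: "\<And>i. i \<in> ?I \<Longrightarrow> reg (fst i) (h i)" "\<And>i x. i \<in> ?I \<Longrightarrow> x \<in> fst i \<Longrightarrow> h i x \<noteq> 0"
    "\<And>i j x. i \<in> ?I \<Longrightarrow> j \<in> ?I \<Longrightarrow> x \<in> fst i \<inter> fst j \<Longrightarrow> h j x = f i j x * h i x" by blast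
  have "\<forall>x\<in>P. \<exists>e. e \<in> total L \<and> proj L e = x \<and> (\<forall>j\<in>?I. x \<in> fst j \<longrightarrow> snd j e = h j x)"
  proof
    fix x assume x: "x \<in> P"
    obtain U \<phi> where U: "(U, \<phi>) \<in> ?I" "x \<in> U" using L.chart_exists[OF x] .
    obtain e where e: "e \<in> total L" "proj L e = x" "\<phi> e = h (U, \<phi>) x"
      using L.fibre_exists[OF U, of "h (U, \<phi>) x"] .
    have "snd j e = h j x" if j: "j \<in> ?I" "x \<in> fst j" for j
      using ftr[OF U(1) j(1) e(1)] h(3)[OF U(1) j(1), of x] e U j by simp
    then show "\<exists>e. e \<in> total L \<and> proj L e = x \<and> (\<forall>j\<in>?I. x \<in> fst j \<longrightarrow> snd j e = h j x)"
      using e by blast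
  qed
  from bchoice[OF this] obtain s where s:
    "\<forall>x\<in>P. s x \<in> total L \<and> proj L (s x) = x \<and> (\<forall>j\<in>?I. x \<in> fst j \<longrightarrow> snd j (s x) = h j x)" ..
  have "L.nonvanishing_section s" unfolding L.nonvanishing_section_def
  proof (intro conjI allI impI)
    show "\<forall>x\<in>P. s x \<in> total L \<and> proj L (s x) = x" using s by blast
    fix U \<phi> assume U: "(U, \<phi>) \<in> ?I"
    have eq: "\<phi> (s x) = h (U, \<phi>) x" if "x \<in> U" for x
      using s U that L.chart_subset[OF U] by fastforce
    have "reg U (h (U, \<phi>))" using h(1)[OF U] by simp
    then show "reg U (\<lambda>x. \<phi> (s x))" by (rule regular_on_cong) (simp add: eq)
    show "\<forall>x\<in>U. \<phi> (s x) \<noteq> 0" using h(2)[OF U] eq by simp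
  qed
  then show ?thesis by blast
qed

text \<open>For fixed \<open>g\<close> the factor of automorphy is a nowhere vanishing regular
  function of the point, hence constant. As a function of \<open>g\<close> it is then a character,
  regular near the identity.\<close>

lemma frame_exists:
  assumes "L \<in> line_bundles X"
  obtains u s where "u \<in> carrier A" "frame L u s"
proof -
  interpret L: equivariant_bundle X L by (rule bundleI[OF assms])
  obtain s where s: "L.nonvanishing_section s" using section_exists[OF assms] by blast
  have const: "L.automorphy s g x = L.automorphy s g x0" if g: "g \<in> G" and x: "x \<in> P" for g x
  proof -
    have "\<exists>c. \<forall>x\<in>P. L.automorphy s g x = c"
      by (rule unit_constant[OF L.automorphy_regular_point[OF s g]]) (rule L.automorphy_nonzero[OF s g])
    then show ?thesis using x base_point by metis
  qed
  obtain W where W: "\<one>\<^bsub>grp X\<^esub> \<in> W" "W \<subseteq> G"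
    "regular_on G (grp_coords X) W (\<lambda>g. L.automorphy s g x0)"
    using L.automorphy_regular_group[OF s base_point] .
  have "\<exists>u\<in>carrier A. \<forall>g\<in>G. L.automorphy s g x0 = w u g"
  proof (rule character[OF _ _ W(3,1,2)])
    show "L.automorphy s (g \<otimes>\<^bsub>grp X\<^esub> h) x0 = L.automorphy s g x0 * L.automorphy s h x0"
      if "g \<in> G" "h \<in> G" for g h
      using L.automorphy_mult[OF s that base_point] const[OF that(1) act_closed[OF that(2) base_point]]
      by simp
    show "L.automorphy s g x0 \<noteq> 0" if "g \<in> G" for g using L.automorphy_nonzero[OF s that base_point] .
  qed
  then obtain u where u: "u \<in> carrier A" "\<And>g. g \<in> G \<Longrightarrow> L.automorphy s g x0 = w u g" by blast
  have "frame L u s" unfolding frame_def using s const u(2) by simp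
  then show ?thesis using that u by blast
qed

text \<open>Two sections without zeros differ by a nowhere vanishing regular function, hence by a
  constant, and a constant multiple has the same factor of automorphy.\<close>

lemma frame_unique:
  assumes L: "L \<in> line_bundles X" and f: "frame L u s" "frame L v t"
    and uv: "u \<in> carrier A" "v \<in> carrier A"
  shows "u = v"
proof (rule w_inj[OF uv])
  interpret L: equivariant_bundle X L by (rule bundleI[OF L])
  note s = frame_section[OF f(1)] and t = frame_section[OF f(2)]
  have "\<forall>x\<in>P. \<exists>c. t x = L.scaled s x c"
    using L.scaled_exists[OF s L.section_total(1)[OF t]] L.section_total(2)[OF t] by metis
  from bchoice[OF this] obtain c where c: "\<forall>x\<in>P. t x = L.scaled s x (c x)" ..
  have chart: "\<phi> (t x) = c x * \<phi> (s x)" if "(U, \<phi>) \<in> charts L" "x \<in> U" for U \<phi> x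
  proof -
    have x: "x \<in> P" using L.chart_subset that by blast
    show ?thesis using L.scaled_chart[OF s x that, of "c x"] c x by simp
  qed
  have nz: "c x \<noteq> 0" if x: "x \<in> P" for x
  proof -
    obtain U \<phi> where U: "(U, \<phi>) \<in> charts L" "x \<in> U" using L.chart_exists[OF x] .
    show ?thesis using chart[OF U] L.section_chart(2)[OF t U] by auto
  qed
  have "reg P c"
  proof (rule regular_on_local)
    fix x assume x: "x \<in> P"
    obtain U \<phi> where U: "(U, \<phi>) \<in> charts L" "x \<in> U" using L.chart_exists[OF x] .
    have "reg (U \<inter> U) (\<lambda>x. \<phi> (t x) * (1 / \<phi> (s x)))"
      using L.section_chart[OF t U(1)] L.section_chart[OF s U(1)] L.chart_subset[OF U(1)]
      by (intro regular_on_mult regular_on_inverse)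
    then have "reg U (\<lambda>x. \<phi> (t x) * (1 / \<phi> (s x)))" by simp
    then have "reg U c"
      by (rule regular_on_cong) (use chart[OF U(1)] L.section_chart(2)[OF s U(1)] in simp)
    then show "\<exists>V. x \<in> V \<and> V \<subseteq> P \<and> reg V c" using U L.chart_subset[OF U(1)] by blast
  qed
  then have "\<exists>k. \<forall>x\<in>P. c x = k" by (rule unit_constant) (rule nz)
  then obtain k where k: "\<And>x. x \<in> P \<Longrightarrow> c x = k" by blast
  have k0: "k \<noteq> 0" using nz[OF base_point] k[OF base_point] by simp
  fix g assume g: "g \<in> G"
  have gx: "action X g x0 \<in> P" using act_closed[OF g base_point] .
  obtain U \<phi> where U: "(U, \<phi>) \<in> charts L" "action X g x0 \<in> U" using L.chart_exists[OF gx] .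
  have "bundle_action L g (t x0) = L.scaled s (action X g x0) (w u g * k)"
    using L.action_scaled[OF s g base_point, of k] c k base_point frame_automorphy[OF f(1) g base_point]
    by simp
  then have "\<phi> (bundle_action L g (t x0)) = (w u g * k) * \<phi> (s (action X g x0))"
    using L.scaled_chart[OF s gx U] by simp
  also have "\<dots> = w u g * \<phi> (t (action X g x0))" using chart[OF U] k[OF gx] by simp
  finally have "L.automorphy t g x0 = w u g" by (rule L.automorphy_eqI[OF t g base_point U])
  then show "w u g = w v g" using frame_automorphy[OF f(2) g base_point] by simp
qed

text \<open>The isomorphism matches equal multiples of the two frames; it is equivariant because
  both frames have the same weight.\<close>

lemma frames_isomorphic:
  assumes "L \<in> line_bundles X" "M \<in> line_bundles X" and f: "frame L u s" "frame M u t"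
  shows "bundles_isomorphic X L M"
proof -
  interpret L: equivariant_bundle X L by (rule bundleI[OF assms(1)])
  interpret M: equivariant_bundle X M by (rule bundleI[OF assms(2)])
  note s = frame_section[OF f(1)] and t = frame_section[OF f(2)]
  define F where "F = (\<lambda>(x, c). M.scaled t x c) \<circ> inv_into (P \<times> UNIV) (\<lambda>(x, c). L.scaled s x c)"
  have F: "F (L.scaled s x c) = M.scaled t x c" if "x \<in> P" for x c
  proof -
    have "inv_into (P \<times> UNIV) (\<lambda>(x, c). L.scaled s x c) ((\<lambda>(x, c). L.scaled s x c) (x, c)) = (x, c)"
      by (rule inv_into_f_f[OF bij_betw_imp_inj_on[OF L.scaled_bij[OF s]]]) (simp add: that)
    then show ?thesis by (simp add: F_def)
  qed
  have e: "\<exists>c. e = L.scaled s (proj L e) c" if "e \<in> total L" for e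
    using L.scaled_exists[OF s that] by metis
  have "bundle_iso X L M F" unfolding bundle_iso_def
  proof (intro conjI)
    show "bij_betw F (total L) (total M)" unfolding F_def
      by (rule bij_betw_trans[OF bij_betw_inv_into[OF L.scaled_bij[OF s]] M.scaled_bij[OF t]])
  next
    show "\<forall>y\<in>total L. proj M (F y) = proj L y"
    proof
      fix y assume y: "y \<in> total L"
      then obtain c where "y = L.scaled s (proj L y) c" using e by blast
      then have "F y = M.scaled t (proj L y) c" using F[OF L.proj_points[OF y], of c] by simp
      then show "proj M (F y) = proj L y" using M.scaled_proj[OF t L.proj_points[OF y]] by simp
    qed
  next
    show "\<forall>g\<in>G. \<forall>y\<in>total L. F (bundle_action L g y) = bundle_action M g (F y)"
    proof (intro ballI)
      fix g y assume g: "g \<in> G" and y: "y \<in> total L"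
      then obtain c where c: "y = L.scaled s (proj L y) c" using e by blast
      define x where "x = proj L y"
      have x: "x \<in> P" "y = L.scaled s x c" using L.proj_points[OF y] c by (simp_all add: x_def)
      show "F (bundle_action L g y) = bundle_action M g (F y)"
        unfolding x(2) L.action_scaled[OF s g x(1)] F[OF x(1)] F[OF act_closed[OF g x(1)]]
          M.action_scaled[OF t g x(1)] frame_automorphy[OF f(1) g x(1)] frame_automorphy[OF f(2) g x(1)] ..
    qed
  next
    show "\<forall>(U, \<phi>) \<in> charts L. \<forall>(V, \<psi>) \<in> charts M. \<exists>f. reg (U \<inter> V) f \<and>
        (\<forall>e\<in>total L. proj L e \<in> U \<inter> V \<longrightarrow> \<psi> (F e) = f (proj L e) * \<phi> e)"
    proof clarify
      fix U \<phi> V \<psi> assume U: "(U, \<phi>) \<in> charts L" and V: "(V, \<psi>) \<in> charts M"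
      have r: "reg (U \<inter> V) (\<lambda>x. (1 / \<phi> (s x)) * \<psi> (t x))"
        by (intro regular_on_mult regular_on_inverse L.section_chart[OF s U] M.section_chart[OF t V]
            L.chart_subset[OF U] M.chart_subset[OF V])
      have "\<psi> (F y) = (1 / \<phi> (s (proj L y))) * \<psi> (t (proj L y)) * \<phi> y"
        if y: "y \<in> total L" and yUV: "proj L y \<in> U \<inter> V" for y
      proof -
        obtain c where c: "y = L.scaled s (proj L y) c" using e[OF y] by blast
        define x where "x = proj L y"
        have x: "x \<in> P" "y = L.scaled s x c" "x \<in> U" "x \<in> V"
          using L.proj_points[OF y] c yUV by (simp_all add: x_def)
        have "\<psi> (F y) = c * \<psi> (t x)" unfolding x(2) F[OF x(1)] M.scaled_chart[OF t x(1) V x(4)] ..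
        moreover have "\<phi> y = c * \<phi> (s x)" unfolding x(2) L.scaled_chart[OF s x(1) U x(3)] ..
        ultimately show ?thesis using L.section_chart(2)[OF s U x(3)] by (simp flip: x_def)
      qed
      then show "\<exists>f. reg (U \<inter> V) f \<and>
          (\<forall>e\<in>total L. proj L e \<in> U \<inter> V \<longrightarrow> \<psi> (F e) = f (proj L e) * \<phi> e)"
        using r by (intro exI[of _ "\<lambda>x. (1 / \<phi> (s x)) * \<psi> (t x)"]) blast
    qed
  qed
  then show ?thesis by (auto simp: bundles_isomorphic_def)
qed

lemma isomorphic_frame:
  assumes "L \<in> line_bundles X" "M \<in> line_bundles X" and F: "bundle_iso X L M F" and f: "frame L u s"
  shows "frame M u (F \<circ> s)"
proof -
  interpret L: equivariant_bundle X L by (rule bundleI[OF assms(1)])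
  interpret M: equivariant_bundle X M by (rule bundleI[OF assms(2)])
  note s = frame_section[OF f]
  have bij: "bij_betw F (total L) (total M)"
    and Fproj: "\<And>e. e \<in> total L \<Longrightarrow> proj M (F e) = proj L e"
    and Fact: "\<And>g e. g \<in> G \<Longrightarrow> e \<in> total L \<Longrightarrow> F (bundle_action L g e) = bundle_action M g (F e)"
    using F unfolding bundle_iso_def by blast+
  have Fchart: "\<exists>f. reg (U \<inter> V) f \<and> (\<forall>e \<in> total L. proj L e \<in> U \<inter> V \<longrightarrow> \<psi> (F e) = f (proj L e) * \<phi> e)"
    if UV: "(U, \<phi>) \<in> charts L" "(V, \<psi>) \<in> charts M" for U \<phi> V \<psi>
  proof -
    have "\<forall>(U, \<phi>) \<in> charts L. \<forall>(V, \<psi>) \<in> charts M.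
        \<exists>f. reg (U \<inter> V) f \<and> (\<forall>e \<in> total L. proj L e \<in> U \<inter> V \<longrightarrow> \<psi> (F e) = f (proj L e) * \<phi> e)"
      using F unfolding bundle_iso_def by (elim conjE)
    from bspec[OF bspec[OF this UV(1), unfolded prod.case] UV(2), unfolded prod.case]
    show ?thesis .
  qed
  have Ftotal: "F e \<in> total M" if "e \<in> total L" for e
    using bij_betw_apply[OF bij that] .
  have local_eq: "\<exists>f. reg (U \<inter> V) f \<and> (\<forall>e \<in> total L. proj L e \<in> U \<inter> V \<longrightarrow> \<psi> (F e) = f (proj L e) * \<phi> e)
      \<and> (\<forall>x\<in>U \<inter> V. f x \<noteq> 0)"
    if UV: "(U, \<phi>) \<in> charts L" "(V, \<psi>) \<in> charts M" for U \<phi> V \<psi>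
  proof -
    obtain f where f: "reg (U \<inter> V) f"
      "\<forall>e \<in> total L. proj L e \<in> U \<inter> V \<longrightarrow> \<psi> (F e) = f (proj L e) * \<phi> e" using Fchart[OF UV] by blast
    \<comment> \<open>That \<open>f\<close> has no zeros is not part of \<open>bundle_iso\<close>;
      it follows from surjectivity of \<open>F\<close> on fibres.\<close>
    have "f x \<noteq> 0" if x: "x \<in> U \<inter> V" for x
    proof -
      obtain e' where e': "e' \<in> total M" "proj M e' = x" "\<psi> e' = 1"
        using M.fibre_exists[OF UV(2), of x 1] x by blast
      have "e' \<in> F ` total L" unfolding bij_betw_imp_surj_on[OF bij] by (rule e'(1))
      then obtain e where e: "e \<in> total L" "F e = e'" by blast
      have "proj L e = x" using Fproj[OF e(1)] e(2) e'(2) by simp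
      then show ?thesis using bspec[OF f(2) e(1)] x e(2) e'(3) by auto
    qed
    then show ?thesis using f by blast
  qed
  have sec: "M.nonvanishing_section (F \<circ> s)" unfolding M.nonvanishing_section_def
  proof (intro conjI allI impI ballI)
    fix x assume x: "x \<in> P"
    show "(F \<circ> s) x \<in> total M" using Ftotal[OF L.section_total(1)[OF s x]] by simp
    show "proj M ((F \<circ> s) x) = x"
      using Fproj[OF L.section_total(1)[OF s x]] L.section_total(2)[OF s x] by simp
  next
    fix V \<psi> assume V: "(V, \<psi>) \<in> charts M"
    have loc: "\<exists>U \<phi> f. (U, \<phi>) \<in> charts L \<and> x \<in> U \<and> reg (U \<inter> V) f \<and>
        (\<forall>y\<in>U \<inter> V. f y \<noteq> 0 \<and> \<psi> ((F \<circ> s) y) = f y * \<phi> (s y))" if x: "x \<in> V" for x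
    proof -
      have "x \<in> P" using x M.chart_subset[OF V] by blast
      then obtain U \<phi> where U: "(U, \<phi>) \<in> charts L" "x \<in> U" using L.chart_exists by metis
      obtain f where f: "reg (U \<inter> V) f" "\<forall>x\<in>U \<inter> V. f x \<noteq> 0"
        "\<forall>e \<in> total L. proj L e \<in> U \<inter> V \<longrightarrow> \<psi> (F e) = f (proj L e) * \<phi> e"
        using local_eq[OF U(1) V] by blast
      have "\<psi> ((F \<circ> s) y) = f y * \<phi> (s y)" if y: "y \<in> U \<inter> V" for y
      proof -
        have "y \<in> P" using y M.chart_subset[OF V] by blast
        then show ?thesis using bspec[OF f(3) L.section_total(1)[OF s]] L.section_total(2)[OF s] y by simp
      qed
      then show ?thesis using U f by blast
    qed
    show "reg V (\<lambda>x. \<psi> ((F \<circ> s) x))"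
    proof (rule regular_on_local)
      fix x assume x: "x \<in> V"
      obtain U \<phi> f where U: "(U, \<phi>) \<in> charts L" "x \<in> U" and f: "reg (U \<inter> V) f"
        "\<forall>y\<in>U \<inter> V. f y \<noteq> 0 \<and> \<psi> ((F \<circ> s) y) = f y * \<phi> (s y)" using loc[OF x] by blast
      have "reg ((U \<inter> V) \<inter> U) (\<lambda>y. f y * \<phi> (s y))"
        by (rule regular_on_mult[OF f(1) L.section_chart(1)[OF s U(1)] _ L.chart_subset[OF U(1)]])
          (use L.chart_subset[OF U(1)] in blast)
      moreover have "(U \<inter> V) \<inter> U = U \<inter> V" by blast
      ultimately have "reg (U \<inter> V) (\<lambda>y. f y * \<phi> (s y))" by simp
      then have "reg (U \<inter> V) (\<lambda>x. \<psi> ((F \<circ> s) x))" by (rule regular_on_cong) (metis f(2))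
      then show "\<exists>W. x \<in> W \<and> W \<subseteq> V \<and> reg W (\<lambda>x. \<psi> ((F \<circ> s) x))"
        using x U(2) by (intro exI[of _ "U \<inter> V"]) auto
    qed
    fix x assume x: "x \<in> V"
    obtain U \<phi> f where U: "(U, \<phi>) \<in> charts L" "x \<in> U" and
        f: "\<forall>y\<in>U \<inter> V. f y \<noteq> 0 \<and> \<psi> ((F \<circ> s) y) = f y * \<phi> (s y)" using loc[OF x] by blast
    show "\<psi> ((F \<circ> s) x) \<noteq> 0" using f x U L.section_chart(2)[OF s U] by simp
  qed
  have "M.automorphy (F \<circ> s) g x = w u g" if g: "g \<in> G" and x: "x \<in> P" for g x
  proof -
    have gx: "action X g x \<in> P" using act_closed[OF g x] .
    obtain U \<phi> where U: "(U, \<phi>) \<in> charts L" "action X g x \<in> U" using L.chart_exists[OF gx] .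
    obtain V \<psi> where V: "(V, \<psi>) \<in> charts M" "action X g x \<in> V" using M.chart_exists[OF gx] .
    obtain h where h: "\<forall>e \<in> total L. proj L e \<in> U \<inter> V \<longrightarrow> \<psi> (F e) = h (proj L e) * \<phi> e"
      using local_eq[OF U(1) V(1)] by blast
    have e: "bundle_action L g (s x) = L.scaled s (action X g x) (w u g)"
      using L.automorphy[OF s g x] frame_automorphy[OF f g x] by simp
    have "\<psi> (bundle_action M g ((F \<circ> s) x)) = \<psi> (F (L.scaled s (action X g x) (w u g)))"
      using Fact[OF g L.section_total(1)[OF s x]] e by simp
    also have "\<dots> = h (action X g x) * \<phi> (L.scaled s (action X g x) (w u g))"
      using bspec[OF h L.scaled_total[OF s gx]] L.scaled_proj[OF s gx] U V by simp
    also have "\<dots> = w u g * (h (action X g x) * \<phi> (s (action X g x)))"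
      unfolding L.scaled_chart[OF s gx U] by simp
    also have "h (action X g x) * \<phi> (s (action X g x)) = \<psi> ((F \<circ> s) (action X g x))"
      using bspec[OF h L.section_total(1)[OF s gx]] L.section_total(2)[OF s gx] U V by simp
    finally show ?thesis by (rule M.automorphy_eqI[OF sec g x V])
  qed
  then show ?thesis unfolding frame_def using sec by blast
qed

section \<open>Bundles of given weight and their isomorphism classes\<close>

definition twisted_bundle :: "('g \<Rightarrow> complex) \<Rightarrow> ('g, 'x, 'x \<times> complex) line_bundle" where
  "twisted_bundle \<theta> = \<lparr>total = P \<times> UNIV, proj = fst, charts = {(P, snd)},
     bundle_action = (\<lambda>g. \<lambda>(x, c) \<in> P \<times> UNIV. (action X g x, \<theta> g * c))\<rparr>"

lemma twisted_bundle_simps [simp]: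
  "total (twisted_bundle \<theta>) = P \<times> UNIV" "proj (twisted_bundle \<theta>) = fst"
  "charts (twisted_bundle \<theta>) = {(P, snd)}"
  "x \<in> P \<Longrightarrow> bundle_action (twisted_bundle \<theta>) g (x, c) = (action X g x, \<theta> g * c)"
  by (simp_all add: twisted_bundle_def)

lemma trivial_bundle_eq: "trivial_bundle X = twisted_bundle (\<lambda>_. 1)"
  by (simp add: trivial_bundle_def twisted_bundle_def)

text \<open>Stated for a function \<open>\<theta>\<close> whose values are prescribed on
  \<open>G\<close> alone: the trivial bundle has the constant 1 in place of the weight of the
  neutral element, and the two are known to agree on \<open>G\<close> only.\<close>

lemma twisted_bundle_frame:
  assumes poly: "\<theta> \<in> poly_funs (grp_coords X)"
    and mult: "\<And>g h. g \<in> G \<Longrightarrow> h \<in> G \<Longrightarrow> \<theta> (g \<otimes>\<^bsub>grp X\<^esub> h) = \<theta> g * \<theta> h"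
    and nz: "\<And>g. g \<in> G \<Longrightarrow> \<theta> g \<noteq> 0"
  shows "twisted_bundle \<theta> \<in> line_bundles X"
    and "(\<And>g. g \<in> G \<Longrightarrow> \<theta> g = w u g) \<Longrightarrow> frame (twisted_bundle \<theta>) u (\<lambda>x. (x, 1))"
proof -
  interpret G: group "grp X" by (rule grp)
  let ?L = "twisted_bundle \<theta>"
  have ga: "group_action (grp X) (P \<times> UNIV) (bundle_action ?L)"
    unfolding group_action_def group_hom_def group_hom_axioms_def
  proof (intro conjI homI)
    show "group (grp X)" by (rule grp)
    show "group (BijGroup (P \<times> (UNIV :: complex set)))" by (rule group_BijGroup)
    have comp: "bundle_action ?L g (bundle_action ?L h e) = bundle_action ?L (g \<otimes>\<^bsub>grp X\<^esub> h) e"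
      if "g \<in> G" "h \<in> G" "e \<in> P \<times> UNIV" for g h e
      using that act_closed act_mult by (cases e) (simp add: mult)
    have one: "\<theta> \<one>\<^bsub>grp X\<^esub> = 1" using mult[of "\<one>\<^bsub>grp X\<^esub>" "\<one>\<^bsub>grp X\<^esub>"] nz[of "\<one>\<^bsub>grp X\<^esub>"] by simp
    have id: "bundle_action ?L \<one>\<^bsub>grp X\<^esub> e = e" if "e \<in> P \<times> UNIV" for e
      using that act_one one by (cases e) simp
    have closed: "bundle_action ?L g e \<in> P \<times> UNIV" if "g \<in> G" "e \<in> P \<times> UNIV" for g e
      using that act_closed by (cases e) simp
    show B: "bundle_action ?L g \<in> carrier (BijGroup (P \<times> UNIV))" if g: "g \<in> G" for g
    proof -
      have "bij_betw (bundle_action ?L g) (P \<times> UNIV) (P \<times> UNIV)"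
      proof (rule bij_betw_byWitness[where f' = "bundle_action ?L (inv\<^bsub>grp X\<^esub> g)"])
        have gi: "inv\<^bsub>grp X\<^esub> g \<in> G" using g by (rule G.inv_closed)
        show "\<forall>e\<in>P \<times> UNIV. bundle_action ?L (inv\<^bsub>grp X\<^esub> g) (bundle_action ?L g e) = e"
          using comp[OF gi g] id G.l_inv[OF g] by metis
        show "\<forall>e\<in>P \<times> UNIV. bundle_action ?L g (bundle_action ?L (inv\<^bsub>grp X\<^esub> g) e) = e"
          using comp[OF g gi] id G.r_inv[OF g] by metis
        show "bundle_action ?L g ` (P \<times> UNIV) \<subseteq> P \<times> UNIV" using closed[OF g] by blast
        show "bundle_action ?L (inv\<^bsub>grp X\<^esub> g) ` (P \<times> UNIV) \<subseteq> P \<times> UNIV" using closed[OF gi] by blast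
      qed
      moreover have "bundle_action ?L g \<in> extensional (P \<times> UNIV)"
        by (simp add: twisted_bundle_def extensional_def)
      ultimately show ?thesis by (simp add: BijGroup_def Bij_def)
    qed
    show "bundle_action ?L (g \<otimes>\<^bsub>grp X\<^esub> h) =
        bundle_action ?L g \<otimes>\<^bsub>BijGroup (P \<times> UNIV)\<^esub> bundle_action ?L h"
      if gh: "g \<in> G" "h \<in> G" for g h
    proof
      fix e
      have "bundle_action ?L (g \<otimes>\<^bsub>grp X\<^esub> h) e = compose (P \<times> UNIV) (bundle_action ?L g) (bundle_action ?L h) e"
      proof (cases "e \<in> P \<times> UNIV")
        case True
        then show ?thesis using comp[OF gh True] by (simp only: compose_eq)
      next
        case False
        then show ?thesis by (auto simp: compose_def twisted_bundle_def)
      qed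
      then show "bundle_action ?L (g \<otimes>\<^bsub>grp X\<^esub> h) e =
          (bundle_action ?L g \<otimes>\<^bsub>BijGroup (P \<times> UNIV)\<^esub> bundle_action ?L h) e"
        using B[OF gh(1)] B[OF gh(2)] by (simp add: BijGroup_def)
    qed
  qed
  have lb: "is_line_bundle X ?L"
    unfolding is_line_bundle_def
  proof (intro conjI)
    show "P = (\<Union>(U, \<phi>)\<in>charts ?L. U)" by simp
    have "regular_on P (coords X) P (\<lambda>_. 1)"
      by (rule regular_on_poly_fun[OF zariski_open_whole poly_funs.const])
    then show "\<forall>(U, \<phi>) \<in> charts ?L. \<forall>(V, \<psi>) \<in> charts ?L. \<exists>f. reg (U \<inter> V) f \<and>
        (\<forall>e \<in> total ?L. proj ?L e \<in> U \<inter> V \<longrightarrow> \<psi> e = f (proj ?L e) * \<phi> e)" by auto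
    have "{e \<in> P \<times> UNIV. fst e \<in> P} = P \<times> (UNIV :: complex set)" by auto
    then show "\<forall>(U, \<phi>) \<in> charts ?L. zariski_open P (coords X) U \<and>
        bij_betw (\<lambda>e. (proj ?L e, \<phi> e)) {e \<in> total ?L. proj ?L e \<in> U} (U \<times> UNIV)"
      by (simp add: zariski_open_whole bij_betw_def)
  qed auto
  have "regular_on (G \<times> P) (prod_coords (grp_coords X) (coords X)) (G \<times> P) (\<lambda>z. \<theta> (fst z))"
  proof (rule regular_on_poly_fun[OF zariski_open_whole], rule poly_funs_pullback[OF poly])
    fix c assume "c \<in> grp_coords X"
    then show "(\<lambda>z. c (fst z)) \<in> poly_funs (prod_coords (grp_coords X) (coords X))"
      by (intro poly_funs.coord) (auto simp: prod_coords_def)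
  qed
  moreover have "{(g, x). g \<in> G \<and> x \<in> P \<and> action X g x \<in> P} = G \<times> P" using act_closed by auto
  ultimately have "is_equivariant_line_bundle X ?L"
    unfolding is_equivariant_line_bundle_def using lb ga
    by (intro conjI) (auto intro!: exI[of _ "\<lambda>z. \<theta> (fst z)"])
  then show LB: "?L \<in> line_bundles X" by (simp add: line_bundles_def)
  then interpret L: equivariant_bundle X ?L by (rule bundleI)
  assume \<theta>: "\<And>g. g \<in> G \<Longrightarrow> \<theta> g = w u g"
  have sec: "L.nonvanishing_section (\<lambda>x. (x, 1))"
    unfolding L.nonvanishing_section_def by (simp add: regular_on_poly_fun[OF zariski_open_whole poly_funs.const])
  have "L.automorphy (\<lambda>x. (x, 1)) g x = w u g" if "g \<in> G" "x \<in> P" for g x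
    by (rule L.automorphy_eqI[OF sec that, of P snd]) (use that act_closed \<theta> in simp_all)
  then show "frame ?L u (\<lambda>x. (x, 1))" unfolding frame_def using sec by blast
qed

definition weight_class :: "'a \<Rightarrow> ('g, 'x, 'x \<times> complex) line_bundle set" where
  "weight_class u = {L \<in> line_bundles X. \<exists>s. frame L u s}"

text \<open>By \<open>isomorphic_frame\<close> and \<open>frames_isomorphic\<close> the weight is a
  complete invariant.\<close>

lemma iso_class_eq:
  assumes L: "L \<in> line_bundles X" and f: "frame L u s"
  shows "iso_class X L = weight_class u"
proof -
  have "bundles_isomorphic X L M \<longleftrightarrow> (\<exists>t. frame M u t)" if M: "M \<in> line_bundles X" for M
  proof
    assume "bundles_isomorphic X L M"
    then obtain F where "bundle_iso X L M F" by (auto simp: bundles_isomorphic_def)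
    then show "\<exists>t. frame M u t" using isomorphic_frame[OF L M _ f] by blast
  next
    assume "\<exists>t. frame M u t"
    then show "bundles_isomorphic X L M" using frames_isomorphic[OF L M f] by blast
  qed
  then show ?thesis unfolding iso_class_def weight_class_def by blast
qed

lemma twisted:
  assumes "u \<in> carrier A"
  shows "twisted_bundle (w u) \<in> line_bundles X" "frame (twisted_bundle (w u)) u (\<lambda>x. (x, 1))"
  using twisted_bundle_frame[OF poly_funs.coord[OF w_coord[OF assms]] w_mult[OF assms]
      w_nonzero[OF assms]] by simp_all

lemma Pic_carrier: "carrier (Pic X) = weight_class ` carrier A"
proof -
  have "iso_class X ` line_bundles X = weight_class ` carrier A"
  proof
    show "iso_class X ` line_bundles X \<subseteq> weight_class ` carrier A"
    proof
      fix K assume "K \<in> iso_class X ` line_bundles X"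
      then obtain L where L: "L \<in> line_bundles X" "K = iso_class X L" by blast
      obtain u s where u: "u \<in> carrier A" "frame L u s" using frame_exists[OF L(1)] .
      then show "K \<in> weight_class ` carrier A" using iso_class_eq[OF L(1) u(2)] L(2) by blast
    qed
    show "weight_class ` carrier A \<subseteq> iso_class X ` line_bundles X"
    proof
      fix K assume "K \<in> weight_class ` carrier A"
      then obtain u where u: "u \<in> carrier A" "K = weight_class u" by blast
      show "K \<in> iso_class X ` line_bundles X"
        unfolding u(2) iso_class_eq[OF twisted[OF u(1)], symmetric] using twisted[OF u(1)] by blast
    qed
  qed
  then show ?thesis by (simp add: Pic_def)
qed

lemma weight_class_inj: "inj_on weight_class (carrier A)"
proof (rule inj_onI)
  fix u v assume u: "u \<in> carrier A" and v: "v \<in> carrier A" and eq: "weight_class u = weight_class v"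
  have "twisted_bundle (w u) \<in> weight_class u"
    unfolding weight_class_def using twisted[OF u] by blast
  then have "twisted_bundle (w u) \<in> weight_class v" by (simp only: eq)
  then obtain t where "frame (twisted_bundle (w u)) v t" by (auto simp: weight_class_def)
  then show "u = v" using frame_unique[OF twisted(1)[OF u] twisted(2)[OF u] _ u v] by blast
qed

lemma Pic_one: "\<one>\<^bsub>Pic X\<^esub> = weight_class \<one>\<^bsub>A\<^esub>"
proof -
  interpret A: comm_group A by (rule A)
  have "w \<one>\<^bsub>A\<^esub> g = 1" if "g \<in> G" for g
    using w_hom[OF A.one_closed A.one_closed that] w_nonzero[OF A.one_closed that] by simp
  then have "twisted_bundle (\<lambda>_. 1) \<in> line_bundles X"
    "frame (twisted_bundle (\<lambda>_. 1)) \<one>\<^bsub>A\<^esub> (\<lambda>x. (x, 1))"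
    using twisted_bundle_frame[OF poly_funs.const[of 1]] by simp_all
  then show ?thesis by (simp add: Pic_def trivial_bundle_eq iso_class_eq)
qed

text \<open>Pairing two frames gives a section without zeros, as the pairing is nowhere degenerate;
  bilinearity and equivariance make the factors of automorphy multiply.\<close>

lemma tensor_frame:
  assumes "L \<in> line_bundles X" "M \<in> line_bundles X" "K \<in> line_bundles X"
    and T: "tensor_pairing X L M K T" and f: "frame L u s" "frame M v t"
    and uv: "u \<in> carrier A" "v \<in> carrier A"
  shows "frame K (u \<otimes>\<^bsub>A\<^esub> v) (\<lambda>x. T (s x) (t x))"
proof -
  interpret L: equivariant_bundle X L by (rule bundleI[OF assms(1)])
  interpret M: equivariant_bundle X M by (rule bundleI[OF assms(2)])
  interpret K: equivariant_bundle X K by (rule bundleI[OF assms(3)])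
  note s = frame_section[OF f(1)] and t = frame_section[OF f(2)]
  have T1: "T e e' \<in> total K" "proj K (T e e') = proj L e"
    if "e \<in> total L" "e' \<in> total M" "proj L e = proj M e'" for e e'
    using T that unfolding tensor_pairing_def by blast+
  have T2: "\<exists>f. reg (U \<inter> V \<inter> W) f \<and> (\<forall>x \<in> U \<inter> V \<inter> W. f x \<noteq> 0) \<and>
      (\<forall>e \<in> total L. \<forall>e' \<in> total M. proj L e = proj M e' \<and> proj L e \<in> U \<inter> V \<inter> W \<longrightarrow>
         \<chi> (T e e') = f (proj L e) * \<phi> e * \<psi> e')"
    if UVW: "(U, \<phi>) \<in> charts L" "(V, \<psi>) \<in> charts M" "(W, \<chi>) \<in> charts K" for U \<phi> V \<psi> W \<chi>
  proof -
    have "\<forall>(U, \<phi>) \<in> charts L. \<forall>(V, \<psi>) \<in> charts M. \<forall>(W, \<chi>) \<in> charts K.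
        \<exists>f. reg (U \<inter> V \<inter> W) f \<and> (\<forall>x \<in> U \<inter> V \<inter> W. f x \<noteq> 0) \<and>
            (\<forall>e \<in> total L. \<forall>e' \<in> total M. proj L e = proj M e' \<and> proj L e \<in> U \<inter> V \<inter> W \<longrightarrow>
               \<chi> (T e e') = f (proj L e) * \<phi> e * \<psi> e')"
      using T unfolding tensor_pairing_def by (elim conjE)
    from bspec[OF bspec[OF bspec[OF this UVW(1), unfolded prod.case] UVW(2), unfolded prod.case]
        UVW(3), unfolded prod.case]
    show ?thesis .
  qed
  have T3: "T (bundle_action L g e) (bundle_action M g e') = bundle_action K g (T e e')"
    if "g \<in> G" "e \<in> total L" "e' \<in> total M" "proj L e = proj M e'" for g e e'
    using T that unfolding tensor_pairing_def by blast
  have st: "s x \<in> total L" "t x \<in> total M" "proj L (s x) = x" "proj M (t x) = x" if "x \<in> P" for x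
    using L.section_total[OF s that] M.section_total[OF t that] by simp_all
  have loc: "\<exists>U \<phi> V \<psi> f. (U, \<phi>) \<in> charts L \<and> (V, \<psi>) \<in> charts M \<and> x \<in> U \<inter> V \<inter> W \<and>
      reg (U \<inter> V \<inter> W) f \<and> (\<forall>x \<in> U \<inter> V \<inter> W. f x \<noteq> 0) \<and>
      (\<forall>e \<in> total L. \<forall>e' \<in> total M. proj L e = proj M e' \<and> proj L e \<in> U \<inter> V \<inter> W \<longrightarrow>
         \<chi> (T e e') = f (proj L e) * \<phi> e * \<psi> e')"
    if W: "(W, \<chi>) \<in> charts K" "x \<in> W" for W \<chi> x
  proof -
    have x: "x \<in> P" using W K.chart_subset by blast
    obtain U \<phi> where U: "(U, \<phi>) \<in> charts L" "x \<in> U" using L.chart_exists[OF x] .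
    obtain V \<psi> where V: "(V, \<psi>) \<in> charts M" "x \<in> V" using M.chart_exists[OF x] .
    show ?thesis using T2[OF U(1) V(1) W(1)] U V W(2) by blast
  qed
  have sec: "K.nonvanishing_section (\<lambda>x. T (s x) (t x))" unfolding K.nonvanishing_section_def
  proof (intro conjI allI impI ballI)
    fix x assume x: "x \<in> P"
    show "T (s x) (t x) \<in> total K" "proj K (T (s x) (t x)) = x"
      using T1[OF st(1,2)[OF x]] st(3,4)[OF x] by simp_all
  next
    fix W \<chi> assume W: "(W, \<chi>) \<in> charts K"
    have eq: "\<chi> (T (s y) (t y)) = f y * \<phi> (s y) * \<psi> (t y)"
      if "\<forall>e \<in> total L. \<forall>e' \<in> total M. proj L e = proj M e' \<and> proj L e \<in> U \<inter> V \<inter> W \<longrightarrow>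
         \<chi> (T e e') = f (proj L e) * \<phi> e * \<psi> e'" "y \<in> U \<inter> V \<inter> W" for U V f \<phi> \<psi> y
    proof -
      have y: "y \<in> P" using that(2) K.chart_subset[OF W] by blast
      show ?thesis using bspec[OF bspec[OF that(1) st(1)[OF y]] st(2)[OF y]] st(3,4)[OF y] that(2) by simp
    qed
    show "reg W (\<lambda>x. \<chi> (T (s x) (t x)))"
    proof (rule regular_on_local)
      fix x assume x: "x \<in> W"
      obtain U \<phi> V \<psi> f where U: "(U, \<phi>) \<in> charts L" and V: "(V, \<psi>) \<in> charts M"
        and xUV: "x \<in> U \<inter> V \<inter> W" and f: "reg (U \<inter> V \<inter> W) f"
        "\<forall>e \<in> total L. \<forall>e' \<in> total M. proj L e = proj M e' \<and> proj L e \<in> U \<inter> V \<inter> W \<longrightarrow>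
         \<chi> (T e e') = f (proj L e) * \<phi> e * \<psi> e'" using loc[OF W x] by blast
      note sub = L.chart_subset[OF U] M.chart_subset[OF V]
      have "reg (((U \<inter> V \<inter> W) \<inter> U) \<inter> V) (\<lambda>y. f y * \<phi> (s y) * \<psi> (t y))"
        by (intro regular_on_mult f(1) L.section_chart[OF s U] M.section_chart[OF t V] sub)
          (use sub in blast)+
      moreover have "((U \<inter> V \<inter> W) \<inter> U) \<inter> V = U \<inter> V \<inter> W" by blast
      ultimately have "reg (U \<inter> V \<inter> W) (\<lambda>y. f y * \<phi> (s y) * \<psi> (t y))" by simp
      then have "reg (U \<inter> V \<inter> W) (\<lambda>x. \<chi> (T (s x) (t x)))"
        by (rule regular_on_cong) (use eq[OF f(2)] in simp)
      then show "\<exists>Y. x \<in> Y \<and> Y \<subseteq> W \<and> reg Y (\<lambda>x. \<chi> (T (s x) (t x)))"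
        using xUV by (intro exI[of _ "U \<inter> V \<inter> W"]) auto
    qed
    fix x assume x: "x \<in> W"
    obtain U \<phi> V \<psi> f where U: "(U, \<phi>) \<in> charts L" and V: "(V, \<psi>) \<in> charts M"
      and xUV: "x \<in> U \<inter> V \<inter> W" and f: "\<forall>x \<in> U \<inter> V \<inter> W. f x \<noteq> 0"
      "\<forall>e \<in> total L. \<forall>e' \<in> total M. proj L e = proj M e' \<and> proj L e \<in> U \<inter> V \<inter> W \<longrightarrow>
       \<chi> (T e e') = f (proj L e) * \<phi> e * \<psi> e'" using loc[OF W x] by blast
    show "\<chi> (T (s x) (t x)) \<noteq> 0"
      unfolding eq[OF f(2) xUV] using f(1) xUV L.section_chart(2)[OF s U] M.section_chart(2)[OF t V] by simp
  qed
  have "K.automorphy (\<lambda>x. T (s x) (t x)) g x = w (u \<otimes>\<^bsub>A\<^esub> v) g" if g: "g \<in> G" and x: "x \<in> P" for g x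
  proof -
    define y where "y = action X g x"
    have y: "y \<in> P" using act_closed[OF g x] by (simp add: y_def)
    obtain W \<chi> where W: "(W, \<chi>) \<in> charts K" "y \<in> W" using K.chart_exists[OF y] .
    obtain U \<phi> V \<psi> f where U: "(U, \<phi>) \<in> charts L" and V: "(V, \<psi>) \<in> charts M"
      and yUV: "y \<in> U \<inter> V \<inter> W" and
      Tf: "\<forall>e \<in> total L. \<forall>e' \<in> total M. proj L e = proj M e' \<and> proj L e \<in> U \<inter> V \<inter> W \<longrightarrow>
       \<chi> (T e e') = f (proj L e) * \<phi> e * \<psi> e'" using loc[OF W] by blast
    have yU: "y \<in> U" "y \<in> V" using yUV by auto
    have ba: "bundle_action L g (s x) = L.scaled s y (w u g)" "bundle_action M g (t x) = M.scaled t y (w v g)"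
      using L.automorphy[OF s g x] frame_automorphy[OF f(1) g x]
        M.automorphy[OF t g x] frame_automorphy[OF f(2) g x] by (simp_all add: y_def)
    have "\<chi> (bundle_action K g (T (s x) (t x))) = \<chi> (T (L.scaled s y (w u g)) (M.scaled t y (w v g)))"
      using T3[OF g st(1,2)[OF x]] st(3,4)[OF x] ba by simp
    also have "\<dots> = f y * \<phi> (L.scaled s y (w u g)) * \<psi> (M.scaled t y (w v g))"
      using bspec[OF bspec[OF Tf L.scaled_total[OF s y]] M.scaled_total[OF t y]]
        L.scaled_proj[OF s y] M.scaled_proj[OF t y] yUV by simp
    also have "\<dots> = w (u \<otimes>\<^bsub>A\<^esub> v) g * (f y * \<phi> (s y) * \<psi> (t y))"
      unfolding L.scaled_chart[OF s y U yU(1)] M.scaled_chart[OF t y V yU(2)] w_hom[OF uv g] by simp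
    also have "f y * \<phi> (s y) * \<psi> (t y) = \<chi> (T (s y) (t y))"
      using bspec[OF bspec[OF Tf st(1)[OF y]] st(2)[OF y]] st(3,4)[OF y] yUV by simp
    finally show ?thesis unfolding y_def by (rule K.automorphy_eqI[OF sec g x W[unfolded y_def]])
  qed
  then show ?thesis unfolding frame_def using sec by blast
qed

text \<open>A member of a product of classes has to arise from some pair of representatives, and the
  twisted bundles can serve as that pair: multiply their fibre coordinates and use the product as
  the coefficient of the frame of \<open>K\<close>.\<close>

lemma tensor_exists:
  assumes uv: "u \<in> carrier A" "v \<in> carrier A"
    and K: "K \<in> line_bundles X" and f: "frame K (u \<otimes>\<^bsub>A\<^esub> v) k"
  shows "\<exists>T. tensor_pairing X (twisted_bundle (w u)) (twisted_bundle (w v)) K T"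
proof -
  interpret K: equivariant_bundle X K by (rule bundleI[OF K])
  note k = frame_section[OF f]
  define T where "T e e' = K.scaled k (fst e) (snd e * snd e')" for e e' :: "'x \<times> complex"
  have "tensor_pairing X (twisted_bundle (w u)) (twisted_bundle (w v)) K T"
    unfolding tensor_pairing_def
  proof (intro conjI)
    show "\<forall>e\<in>total (twisted_bundle (w u)). \<forall>e'\<in>total (twisted_bundle (w v)).
        proj (twisted_bundle (w u)) e = proj (twisted_bundle (w v)) e' \<longrightarrow>
        T e e' \<in> total K \<and> proj K (T e e') = proj (twisted_bundle (w u)) e"
      unfolding T_def using K.scaled_total[OF k] K.scaled_proj[OF k] by auto
    have "\<exists>f. reg (P \<inter> P \<inter> W) f \<and> (\<forall>x\<in>P \<inter> P \<inter> W. f x \<noteq> 0) \<and>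
        (\<forall>e\<in>P \<times> UNIV. \<forall>e'\<in>P \<times> UNIV. fst e = fst e' \<and> fst e \<in> P \<inter> P \<inter> W \<longrightarrow>
          \<chi> (T e e') = f (fst e) * snd e * snd e')" if W: "(W, \<chi>) \<in> charts K" for W \<chi>
    proof (intro exI conjI)
      have "P \<inter> P \<inter> W = W" using K.chart_subset[OF W] by blast
      then show "reg (P \<inter> P \<inter> W) (\<lambda>x. \<chi> (k x))" using K.section_chart(1)[OF k W] by simp
      show "\<forall>x\<in>P \<inter> P \<inter> W. \<chi> (k x) \<noteq> 0" using K.section_chart(2)[OF k W] by blast
      show "\<forall>e\<in>P \<times> UNIV. \<forall>e'\<in>P \<times> UNIV. fst e = fst e' \<and> fst e \<in> P \<inter> P \<inter> W \<longrightarrow>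
          \<chi> (T e e') = \<chi> (k (fst e)) * snd e * snd e'"
        unfolding T_def using K.scaled_chart[OF k _ W] by simp
    qed
    then show "\<forall>(U, \<phi>)\<in>charts (twisted_bundle (w u)). \<forall>(V, \<psi>)\<in>charts (twisted_bundle (w v)).
        \<forall>(W, \<chi>)\<in>charts K. \<exists>f. reg (U \<inter> V \<inter> W) f \<and> (\<forall>x\<in>U \<inter> V \<inter> W. f x \<noteq> 0) \<and>
        (\<forall>e\<in>total (twisted_bundle (w u)). \<forall>e'\<in>total (twisted_bundle (w v)).
          proj (twisted_bundle (w u)) e = proj (twisted_bundle (w v)) e' \<and>
          proj (twisted_bundle (w u)) e \<in> U \<inter> V \<inter> W \<longrightarrow>
          \<chi> (T e e') = f (proj (twisted_bundle (w u)) e) * \<phi> e * \<psi> e')"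
      unfolding twisted_bundle_simps by (intro ballI) (simp only: singleton_iff prod.case split_paired_all, blast)
    show "\<forall>g\<in>G. \<forall>e\<in>total (twisted_bundle (w u)). \<forall>e'\<in>total (twisted_bundle (w v)).
        proj (twisted_bundle (w u)) e = proj (twisted_bundle (w v)) e' \<longrightarrow>
        T (bundle_action (twisted_bundle (w u)) g e) (bundle_action (twisted_bundle (w v)) g e') =
        bundle_action K g (T e e')"
    proof (intro ballI impI)
      fix g and e e' :: "'x \<times> complex"
      assume g: "g \<in> G" and e: "e \<in> total (twisted_bundle (w u))" "e' \<in> total (twisted_bundle (w v))"
        "proj (twisted_bundle (w u)) e = proj (twisted_bundle (w v)) e'"
      then obtain x c c' where x: "x \<in> P" "e = (x, c)" "e' = (x, c')" by (cases e; cases e') auto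
      show "T (bundle_action (twisted_bundle (w u)) g e) (bundle_action (twisted_bundle (w v)) g e') =
        bundle_action K g (T e e')"
        unfolding T_def x(2,3) twisted_bundle_simps(4)[OF x(1)] fst_conv snd_conv
          K.action_scaled[OF k g x(1)] frame_automorphy[OF f g x(1)] w_hom[OF uv g]
        by (simp add: mult_ac)
    qed
  qed
  then show ?thesis by blast
qed

lemma Pic_mult:
  assumes uv: "u \<in> carrier A" "v \<in> carrier A"
  shows "weight_class u \<otimes>\<^bsub>Pic X\<^esub> weight_class v = weight_class (u \<otimes>\<^bsub>A\<^esub> v)"
proof -
  have "{K \<in> line_bundles X. \<exists>L\<in>weight_class u. \<exists>M\<in>weight_class v. \<exists>T. tensor_pairing X L M K T} =
      weight_class (u \<otimes>\<^bsub>A\<^esub> v)"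
  proof (intro subset_antisym subsetI)
    fix K assume "K \<in> {K \<in> line_bundles X. \<exists>L\<in>weight_class u. \<exists>M\<in>weight_class v. \<exists>T. tensor_pairing X L M K T}"
    then obtain L M T s t where "K \<in> line_bundles X" "L \<in> line_bundles X" "M \<in> line_bundles X"
      "tensor_pairing X L M K T" "frame L u s" "frame M v t" unfolding weight_class_def by blast
    then show "K \<in> weight_class (u \<otimes>\<^bsub>A\<^esub> v)"
      unfolding weight_class_def using tensor_frame uv by blast
  next
    fix K assume "K \<in> weight_class (u \<otimes>\<^bsub>A\<^esub> v)"
    then obtain k where k: "K \<in> line_bundles X" "frame K (u \<otimes>\<^bsub>A\<^esub> v) k"
      unfolding weight_class_def by blast
    have "twisted_bundle (w u) \<in> weight_class u" "twisted_bundle (w v) \<in> weight_class v"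
      unfolding weight_class_def using twisted uv by blast+
    then show "K \<in> {K \<in> line_bundles X. \<exists>L\<in>weight_class u. \<exists>M\<in>weight_class v. \<exists>T. tensor_pairing X L M K T}"
      using tensor_exists[OF uv k] k(1) by blast
  qed
  then show ?thesis by (simp add: Pic_def)
qed

text \<open>The group axioms are not checked on bundles: \<open>weight_class\<close> is a
  homomorphism from \<open>A\<close> onto \<open>Pic X\<close>, so they are inherited from
  \<open>A\<close>.\<close>

theorem Pic_iso: "group (Pic X)" "Pic X \<cong> A"
proof -
  interpret A: comm_group A by (rule A)
  have h: "weight_class \<in> hom A (Pic X)"
    by (rule homI) (auto simp: Pic_carrier Pic_mult)
  have "group (Pic X \<lparr>carrier := weight_class ` carrier A, one := weight_class \<one>\<^bsub>A\<^esub>\<rparr>)"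
    by (rule A.hom_imp_img_group[OF h])
  moreover have "Pic X \<lparr>carrier := weight_class ` carrier A, one := weight_class \<one>\<^bsub>A\<^esub>\<rparr> = Pic X"
    by (simp flip: Pic_carrier Pic_one)
  ultimately show "group (Pic X)" by simp
  have "weight_class \<in> iso A (Pic X)"
    using h weight_class_inj by (simp add: iso_def bij_betw_def Pic_carrier)
  then show "Pic X \<cong> A" using A.iso_sym by (auto simp: is_iso_def)
qed

end

section \<open>The toric Deligne-Mumford stack\<close>

text \<open>\<open>J_ideal\<close> is a generated ideal. That the functions vanishing at a point
  form an ideal shows that it has the same zeros as its generators.\<close>

lemma vanishing_ideal:
  "ideal {f \<in> poly_funs C. f z = 0} (poly_fun_ring C)"
proof -
  interpret cring "poly_fun_ring C" by (rule cring_poly_fun_ring)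
  let ?R = "poly_fun_ring C"
  let ?I = "{f \<in> poly_funs C. f z = 0}"
  have carr: "carrier ?R = poly_funs C" by (simp add: poly_fun_ring_def)
  have mult: "(f \<otimes>\<^bsub>?R\<^esub> g) = (\<lambda>x. f x * g x)" for f g by (simp add: poly_fun_ring_def)
  have add: "(f \<oplus>\<^bsub>?R\<^esub> g) = (\<lambda>x. f x + g x)" for f g by (simp add: poly_fun_ring_def)
  show ?thesis
  proof (rule idealI)
    show "ring ?R" by (rule ring_axioms)
    show "subgroup ?I (add_monoid ?R)"
    proof (rule add.subgroupI)
      show "?I \<subseteq> carrier ?R" by (auto simp: carr)
      show "?I \<noteq> {}" using poly_funs.const[of 0 C] by force
      fix f g assume f: "f \<in> ?I" and g: "g \<in> ?I"
      show "f \<oplus>\<^bsub>?R\<^esub> g \<in> ?I" using f g by (auto simp: add poly_funs.add)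
      have fR: "f \<in> carrier ?R" using f by (simp add: carr)
      \<comment> \<open>The ring record has no negation to unfold; writing the negative as a product
        with -1 makes its value at \<open>z\<close> computable.\<close>
      have "\<ominus>\<^bsub>?R\<^esub> f = (\<ominus>\<^bsub>?R\<^esub> \<one>\<^bsub>?R\<^esub>) \<otimes>\<^bsub>?R\<^esub> f" using fR by (simp add: l_minus)
      then have "(\<ominus>\<^bsub>?R\<^esub> f) z = 0" using f by (simp add: mult)
      then show "\<ominus>\<^bsub>?R\<^esub> f \<in> ?I" using a_inv_closed[OF fR] by (simp add: carr)
    qed
  qed (auto simp: carr mult poly_funs.mult)
qed

lemma vanishing_locus_genideal:
  assumes "S \<subseteq> poly_funs C"
  shows "vanishing_locus X (Idl\<^bsub>poly_fun_ring C\<^esub> S) = vanishing_locus X S"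
proof -
  interpret cring "poly_fun_ring C" by (rule cring_poly_fun_ring)
  have "S \<subseteq> carrier (poly_fun_ring C)" using assms by (simp add: poly_fun_ring_def)
  then have "S \<subseteq> Idl\<^bsub>poly_fun_ring C\<^esub> S" by (rule genideal_self)
  moreover have "f z = 0" if z: "\<forall>g\<in>S. g z = 0" and f: "f \<in> Idl\<^bsub>poly_fun_ring C\<^esub> S" for f z
  proof -
    have "Idl\<^bsub>poly_fun_ring C\<^esub> S \<subseteq> {f \<in> poly_funs C. f z = 0}"
      by (rule genideal_minimal[OF vanishing_ideal]) (use assms z in blast)
    then show ?thesis using f by blast
  qed
  ultimately show ?thesis unfolding vanishing_locus_def by blast
qed

lemma poly_funs_prod:
  "finite I \<Longrightarrow> (\<And>i. i \<in> I \<Longrightarrow> f i \<in> poly_funs C) \<Longrightarrow> (\<lambda>z. \<Prod>i\<in>I. f i z) \<in> poly_funs C"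
proof (induction I rule: finite_induct)
  case (insert i I)
  then show ?case using poly_funs.mult[of "f i" C "\<lambda>z. \<Prod>i\<in>I. f i z"] by simp
qed (simp add: poly_funs.const)

text \<open>A product is nonzero exactly if its factors are, so membership in \<open>Z\<close>
  depends only on which coordinates vanish.\<close>

lemma Z_variety_iff:
  "z \<in> Z_variety N n \<Sigma> \<beta> \<longleftrightarrow> z \<in> affine_space n \<and>
    (\<exists>\<sigma>\<in>\<Sigma>. \<forall>i<n. \<not> stacky_ray N \<beta> i \<subseteq> \<sigma> \<longrightarrow> z i \<noteq> 0)"
  and Z_variety_open: "zariski_open (affine_space n) (affine_coords n) (Z_variety N n \<Sigma> \<beta>)"
proof -
  define S where
    "S = {\<lambda>z::nat \<Rightarrow> complex. \<Prod>i \<in> {i. i < n \<and> \<not> stacky_ray N \<beta> i \<subseteq> \<sigma>}. z i | \<sigma>. \<sigma> \<in> \<Sigma>}"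
  have S: "S \<subseteq> poly_funs (affine_coords n)"
  proof
    fix f assume "f \<in> S"
    then obtain \<sigma> where f: "f = (\<lambda>z. \<Prod>i \<in> {i. i < n \<and> \<not> stacky_ray N \<beta> i \<subseteq> \<sigma>}. z i)"
      unfolding S_def by blast
    show "f \<in> poly_funs (affine_coords n)" unfolding f
      by (rule poly_funs_prod) (auto intro: poly_funs.coord simp: affine_coords_def)
  qed
  have Z: "Z_variety N n \<Sigma> \<beta> = affine_space n - vanishing_locus (affine_space n) S"
    unfolding Z_variety_def J_ideal_def S_def[symmetric] vanishing_locus_genideal[OF S] ..
  show "zariski_open (affine_space n) (affine_coords n) (Z_variety N n \<Sigma> \<beta>)"
    unfolding zariski_open_def using S Z by blast
  have "z \<in> Z_variety N n \<Sigma> \<beta> \<longleftrightarrow> z \<in> affine_space n \<and> (\<exists>f\<in>S. f z \<noteq> 0)"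
    unfolding Z vanishing_locus_def by blast
  also have "(\<exists>f\<in>S. f z \<noteq> 0) \<longleftrightarrow> (\<exists>\<sigma>\<in>\<Sigma>. (\<Prod>i \<in> {i. i < n \<and> \<not> stacky_ray N \<beta> i \<subseteq> \<sigma>}. z i) \<noteq> 0)"
    unfolding S_def Setcompr_eq_image by (simp only: bex_simps)
  also have "\<dots> \<longleftrightarrow> (\<exists>\<sigma>\<in>\<Sigma>. \<forall>i<n. \<not> stacky_ray N \<beta> i \<subseteq> \<sigma> \<longrightarrow> z i \<noteq> 0)" by auto
  finally show "z \<in> Z_variety N n \<Sigma> \<beta> \<longleftrightarrow> z \<in> affine_space n \<and>
    (\<exists>\<sigma>\<in>\<Sigma>. \<forall>i<n. \<not> stacky_ray N \<beta> i \<subseteq> \<sigma> \<longrightarrow> z i \<noteq> 0)" .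
qed

text \<open>Every ray belongs to the fan, so the complement of \<open>Z\<close> has codimension at least two.\<close>

lemma Z_variety_codim:
  assumes fan: "stacky_fan N d n \<Sigma> \<beta>" and z: "z \<in> affine_space n"
    and one: "\<And>i j. i < n \<Longrightarrow> j < n \<Longrightarrow> z i = 0 \<Longrightarrow> z j = 0 \<Longrightarrow> i = j"
  shows "z \<in> Z_variety N n \<Sigma> \<beta>"
proof (cases "\<exists>i<n. z i = 0")
  case True
  then obtain i where i: "i < n" "z i = 0" by blast
  have "stacky_ray N \<beta> i \<in> fan_rays N \<Sigma>"
    using fan i(1) by (auto simp: stacky_fan_def bij_betw_def)
  then have "stacky_ray N \<beta> i \<in> \<Sigma>" by (simp add: fan_rays_def)
  \<comment> \<open>The ray of index \<open>i\<close> is itself taken as the cone, so the coordinate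
    \<open>i\<close> is allowed to vanish.\<close>
  moreover have "z j \<noteq> 0" if "j < n" "\<not> stacky_ray N \<beta> j \<subseteq> stacky_ray N \<beta> i" for j
    using one[OF that(1) i(1) _ i(2)] that(2) by auto
  ultimately show ?thesis unfolding Z_variety_iff using z by blast
next
  case False
  obtain \<sigma> where "\<sigma> \<in> \<Sigma>" using fan by (auto simp: stacky_fan_def simplicial_fan_def)
  then show ?thesis unfolding Z_variety_iff using z False by blast
qed

section \<open>The Gale dual and the stack\<close>

lemma comm_group_integer_group: "comm_group integer_group"
  by (rule group.group_comm_groupI[OF group_integer_group]) simp

lemma group_Zfree_DirProd: "group (Zfree n \<times>\<times> Zfree r)"
  by (rule DirProd_group) simp_all

lemma comm_group_dual: "group G \<Longrightarrow> comm_group (dual_group G)"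
  by (rule comm_group_hom_group[OF _ comm_group_integer_group])

lemma Zfree_add_closed: "x \<in> carrier (Zfree k) \<Longrightarrow> y \<in> carrier (Zfree k) \<Longrightarrow> x + y \<in> carrier (Zfree k)"
  using monoid.m_closed[OF group.is_monoid[OF group_free_Abelian_group]] by (simp only: mult_free_Abelian_group)

text \<open>\<open>BQ_dual_image\<close> is the image of the homomorphism dual to [B,Q], hence a
  subgroup of an abelian group.\<close>

lemma comm_group_gale_dual:
  assumes B: "B \<in> hom (Zfree n) (Zfree m)" and Q: "Q \<in> hom (Zfree r) (Zfree m)"
  shows "comm_group (gale_dual n r m B Q)"
proof -
  let ?H = "Zfree n \<times>\<times> Zfree r"
  interpret D: comm_group "dual_group ?H" by (rule comm_group_dual[OF group_Zfree_DirProd])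
  interpret M: comm_group "dual_group (Zfree m)" by (rule comm_group_dual) simp
  let ?h = "\<lambda>\<phi>. \<lambda>(x, y) \<in> carrier ?H. \<phi> (B x \<otimes>\<^bsub>Zfree m\<^esub> Q y)"
  have BQ: "B x + Q y \<in> carrier (Zfree m)" if "x \<in> carrier (Zfree n)" "y \<in> carrier (Zfree r)" for x y
    using that by (intro Zfree_add_closed hom_in_carrier[OF B] hom_in_carrier[OF Q])
  have BQ_add: "B (x + x') = B x + B x'" "Q (y + y') = Q y + Q y'"
    if "x \<in> carrier (Zfree n)" "x' \<in> carrier (Zfree n)" "y \<in> carrier (Zfree r)" "y' \<in> carrier (Zfree r)"
    for x x' y y'
    using hom_mult[OF B that(1,2)] hom_mult[OF Q that(3,4)] by simp_all
  have hom: "?h \<in> hom (dual_group (Zfree m)) (dual_group ?H)"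
  proof (rule homI)
    fix \<phi> assume \<phi>: "\<phi> \<in> carrier (dual_group (Zfree m))"
    then have add: "\<phi> (x + y) = \<phi> x + \<phi> y" if "x \<in> carrier (Zfree m)" "y \<in> carrier (Zfree m)" for x y
      using that by (simp add: hom_group_def hom_def)
    have "?h \<phi> \<in> hom ?H integer_group"
    proof (rule homI)
      fix p q assume "p \<in> carrier ?H" "q \<in> carrier ?H"
      then obtain x y x' y' where p: "p = (x, y)" "q = (x', y')"
        and c: "x \<in> carrier (Zfree n)" "x' \<in> carrier (Zfree n)" "y \<in> carrier (Zfree r)" "y' \<in> carrier (Zfree r)"
        by (cases p; cases q) (auto simp del: carrier_free_Abelian_group_iff)
      have "\<phi> (B (x + x') + Q (y + y')) = \<phi> ((B x + Q y) + (B x' + Q y'))"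
        unfolding BQ_add[OF c] by (simp add: algebra_simps)
      also have "\<dots> = \<phi> (B x + Q y) + \<phi> (B x' + Q y')"
        by (rule add[OF BQ[OF c(1,3)] BQ[OF c(2,4)]])
      finally show "?h \<phi> (p \<otimes>\<^bsub>?H\<^esub> q) = ?h \<phi> p \<otimes>\<^bsub>integer_group\<^esub> ?h \<phi> q"
        using c Zfree_add_closed[OF c(1,2)] Zfree_add_closed[OF c(3,4)]
        by (simp add: p del: carrier_free_Abelian_group_iff)
    qed simp
    then show "?h \<phi> \<in> carrier (dual_group ?H)" by (simp add: hom_group_def)
  next
    fix \<phi> \<psi> assume "\<phi> \<in> carrier (dual_group (Zfree m))" "\<psi> \<in> carrier (dual_group (Zfree m))"
    show "?h (\<phi> \<otimes>\<^bsub>dual_group (Zfree m)\<^esub> \<psi>) = ?h \<phi> \<otimes>\<^bsub>dual_group ?H\<^esub> ?h \<psi>"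
    proof
      fix p
      show "?h (\<phi> \<otimes>\<^bsub>dual_group (Zfree m)\<^esub> \<psi>) p = (?h \<phi> \<otimes>\<^bsub>dual_group ?H\<^esub> ?h \<psi>) p"
        using BQ[of "fst p" "snd p"]
        by (cases p) (simp add: hom_group_def restrict_def del: carrier_free_Abelian_group_iff)
    qed
  qed
  then interpret h: group_hom "dual_group (Zfree m)" "dual_group ?H" ?h by unfold_locales
  have "subgroup (?h ` carrier (dual_group (Zfree m))) (dual_group ?H)" by (rule h.img_is_subgroup)
  then show ?thesis unfolding gale_dual_def BQ_dual_image_def by (rule D.abelian_FactGroup)
qed

lemma gale_dual_map_dual_basis:
  "gale_dual_map n r m B Q (dual_basis n i) \<in> carrier (gale_dual n r m B Q)"
proof -
  let ?H = "Zfree n \<times>\<times> Zfree r"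
  let ?f = "\<lambda>(x, y) \<in> carrier ?H. dual_basis n i x"
  have "?f \<in> hom ?H integer_group"
  proof (rule homI)
    fix p q assume "p \<in> carrier ?H" "q \<in> carrier ?H"
    then obtain x y x' y' where p: "p = (x, y)" "q = (x', y')"
      and c: "x \<in> carrier (Zfree n)" "x' \<in> carrier (Zfree n)" "y \<in> carrier (Zfree r)" "y' \<in> carrier (Zfree r)"
      by (cases p; cases q) (auto simp del: carrier_free_Abelian_group_iff)
    show "?f (p \<otimes>\<^bsub>?H\<^esub> q) = ?f p \<otimes>\<^bsub>integer_group\<^esub> ?f q"
      using c Zfree_add_closed[OF c(1,2)] Zfree_add_closed[OF c(3,4)]
      by (simp add: p dual_basis_def lookup_add del: carrier_free_Abelian_group_iff)
  qed simp
  then have "?f \<in> carrier (dual_group ?H)" by (simp add: hom_group_def)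
  then show ?thesis unfolding gale_dual_def gale_dual_map_def carrier_FactGroup by blast
qed

text \<open>The weights are the evaluations of characters at elements of the Gale dual, and the base
  point is the unit of the torus.\<close>

lemma toric_stack_picard_variety:
  assumes fan: "stacky_fan N d n \<Sigma> \<beta>"
    and B: "B \<in> hom (Zfree n) (Zfree (d + r))" and Q: "Q \<in> hom (Zfree r) (Zfree (d + r))"
  shows "picard_variety (toric_stack N d n \<Sigma> \<beta> r B Q) (gale_dual n r (d + r) B Q)
    (\<lambda>u g. g u) (\<lambda>i\<in>{..<n}. 1)"
proof -
  let ?A = "gale_dual n r (d + r) B Q"
  let ?X = "toric_stack N d n \<Sigma> \<beta> r B Q"
  let ?G = "hom_group ?A complex_units"
  let ?Z = "Z_variety N n \<Sigma> \<beta>"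
  let ?v = "\<lambda>i. gale_dual_map n r (d + r) B Q (dual_basis n i)"
  have A: "comm_group ?A" by (rule comm_group_gale_dual[OF B Q])
  then have gA: "group ?A" by (rule comm_group.axioms)
  have sel: "points ?X = ?Z" "coords ?X = affine_coords n" "grp ?X = ?G" "grp_coords ?X = evaluations ?A"
    "action ?X = (\<lambda>g z. \<lambda>i \<in> {..<n}. g (?v i) * z i)"
    by (auto simp: toric_stack_def stack_group_def evaluations_def alpha_def fun_eq_iff)
  have G: "comm_group ?G" by (rule comm_group_hom_group[OF gA comm_group_complex_units])
  have v: "?v i \<in> carrier ?A" for i by (rule gale_dual_map_dual_basis)
  have Gmult: "(g \<otimes>\<^bsub>?G\<^esub> h) u = g u * h u" if "u \<in> carrier ?A" for g h u
    using that by (simp add: hom_group_def complex_units_def)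
  have Gone: "\<one>\<^bsub>?G\<^esub> u = 1" if "u \<in> carrier ?A" for u
    using that by (simp add: hom_group_def complex_units_def)
  have ZA: "z \<in> affine_space n" if "z \<in> ?Z" for z using that by (simp add: Z_variety_iff)
  interpret affine_open n ?Z by unfold_locales (rule Z_variety_open)
  show ?thesis
  proof (intro picard_variety.intro g_variety.intro picard_variety_axioms.intro; (unfold sel)?)
    show "group ?G" using G by (rule comm_group.axioms)
    \<comment> \<open>\<open>G\<close> rescales the coordinates by nonzero numbers and so keeps the
      set of vanishing coordinates.\<close>
    show "(\<lambda>i\<in>{..<n}. g (?v i) * z i) \<in> ?Z" if g: "g \<in> carrier ?G" and z: "z \<in> ?Z" for g z
      using z hom_group_complex_units(1)[OF g v] by (auto simp: Z_variety_iff affine_space_def)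
    show "(\<lambda>i\<in>{..<n}. \<one>\<^bsub>?G\<^esub> (?v i) * z i) = z" if "z \<in> ?Z" for z
      using ZA[OF that] by (auto simp: Gone[OF v] affine_space_def PiE_iff extensional_def)
    show "(\<lambda>i\<in>{..<n}. (g \<otimes>\<^bsub>?G\<^esub> h) (?v i) * z i) =
        (\<lambda>i\<in>{..<n}. g (?v i) * (\<lambda>i\<in>{..<n}. h (?v i) * z i) i)" for g h z
      by (auto simp: Gmult[OF v])
    show "(\<lambda>z. c (\<lambda>i\<in>{..<n}. g (?v i) * z i)) \<in> poly_funs (affine_coords n)"
      if "c \<in> affine_coords n" for g c
    proof -
      obtain i where i: "i < n" "c = (\<lambda>z. z i)" using \<open>c \<in> affine_coords n\<close> by (auto simp: affine_coords_def)
      have "(\<lambda>z. g (?v i) * z i) \<in> poly_funs (affine_coords n)"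
        by (rule poly_funs.mult[OF poly_funs.const poly_funs.coord])
          (use i in \<open>auto simp: affine_coords_def\<close>)
      then show ?thesis using i by simp
    qed
    show "(\<lambda>g. c (\<lambda>i\<in>{..<n}. g (?v i) * z i)) \<in> poly_funs (evaluations ?A)"
      if "c \<in> affine_coords n" for z c
    proof -
      obtain i where i: "i < n" "c = (\<lambda>z. z i)" using \<open>c \<in> affine_coords n\<close> by (auto simp: affine_coords_def)
      have "(\<lambda>g. g (?v i) * z i) \<in> poly_funs (evaluations ?A)"
        by (rule poly_funs.mult[OF poly_funs.coord poly_funs.const]) (use v in \<open>auto simp: evaluations_def\<close>)
      then show ?thesis using i by simp
    qed
    show "comm_group ?A" by (rule A)
    show "(\<lambda>i\<in>{..<n}. 1) \<in> ?Z" by (rule Z_variety_codim[OF fan]) (auto simp: affine_space_def)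
    show "\<exists>h. (\<forall>i\<in>I. regular_on ?Z (affine_coords n) (U i) (h i) \<and> (\<forall>x\<in>U i. h i x \<noteq> 0)) \<and>
        (\<forall>i\<in>I. \<forall>j\<in>I. \<forall>x\<in>U i \<inter> U j. h j x = f i j x * h i x)"
      if "\<And>i. i \<in> I \<Longrightarrow> zariski_open ?Z (affine_coords n) (U i)" "(\<Union>i\<in>I. U i) = ?Z"
        "\<And>i j. i \<in> I \<Longrightarrow> j \<in> I \<Longrightarrow> regular_on ?Z (affine_coords n) (U i \<inter> U j) (f i j)"
        "\<And>i j x. i \<in> I \<Longrightarrow> j \<in> I \<Longrightarrow> x \<in> U i \<inter> U j \<Longrightarrow> f i j x \<noteq> 0"
        "\<And>i j k x. i \<in> I \<Longrightarrow> j \<in> I \<Longrightarrow> k \<in> I \<Longrightarrow> x \<in> U i \<inter> U j \<inter> U k \<Longrightarrow> f i j x * f j k x = f i k x"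
      for I :: "((nat \<Rightarrow> complex) set \<times> ((nat \<Rightarrow> complex) \<times> complex \<Rightarrow> complex)) set" and U f
      by (rule cocycle_trivial) (fact that)+
    show "\<exists>c. \<forall>x\<in>?Z. f x = c"
      if "regular_on ?Z (affine_coords n) ?Z f" "\<And>x. x \<in> ?Z \<Longrightarrow> f x \<noteq> 0" for f
      by (rule nonvanishing_regular_constant[OF Z_variety_codim[OF fan] that])
    show "(\<lambda>g. g u) \<in> evaluations ?A" if "u \<in> carrier ?A" for u using that by (auto simp: evaluations_def)
    show "(g \<otimes>\<^bsub>?G\<^esub> h) u = g u * h u" if "u \<in> carrier ?A" for u g h by (rule Gmult[OF that])
    show "g u \<noteq> 0" if "u \<in> carrier ?A" "g \<in> carrier ?G" for u g
      using hom_group_complex_units(1)[OF that(2,1)] .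
    show "g (u \<otimes>\<^bsub>?A\<^esub> v) = g u * g v" if "u \<in> carrier ?A" "v \<in> carrier ?A" "g \<in> carrier ?G" for u v g
      using hom_group_complex_units(2)[OF that(3,1,2)] .
    show "u = v" if "u \<in> carrier ?A" "v \<in> carrier ?A" "\<And>g. g \<in> carrier ?G \<Longrightarrow> g u = g v" for u v
      using hom_group_separates[OF A that(1,2)] that(3) by blast
    show "\<exists>u\<in>carrier ?A. \<forall>g\<in>carrier ?G. \<chi> g = g u"
      if "\<And>g h. g \<in> carrier ?G \<Longrightarrow> h \<in> carrier ?G \<Longrightarrow> \<chi> (g \<otimes>\<^bsub>?G\<^esub> h) = \<chi> g * \<chi> h"
        "\<And>g. g \<in> carrier ?G \<Longrightarrow> \<chi> g \<noteq> 0" "regular_on (carrier ?G) (evaluations ?A) W \<chi>"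
        "\<one>\<^bsub>?G\<^esub> \<in> W" "W \<subseteq> carrier ?G" for \<chi> W
      using regular_character[OF A that] .
  qed
qed

theorem proposition3p1:
  fixes N :: "('a, 'm) monoid_scheme"
    and d n r :: nat
    and \<Sigma> :: "('a \<times> rat \<Rightarrow>\<^sub>0 int) set set set"
    and \<beta> p :: "(nat \<Rightarrow>\<^sub>0 int) \<Rightarrow> 'a"
    and B Q :: "(nat \<Rightarrow>\<^sub>0 int) \<Rightarrow> (nat \<Rightarrow>\<^sub>0 int)"
  assumes "stacky_fan N d n \<Sigma> \<beta>"
    and "free_resolution N d r Q p"
    and "is_lift n (d + r) p \<beta> B"
  shows "group (Pic (toric_stack N d n \<Sigma> \<beta> r B Q)) \<and>
         Pic (toric_stack N d n \<Sigma> \<beta> r B Q) \<cong> gale_dual n r (d + r) B Q"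
proof -
  interpret picard_variety "toric_stack N d n \<Sigma> \<beta> r B Q" "gale_dual n r (d + r) B Q"
    "\<lambda>u g. g u" "\<lambda>i\<in>{..<n}. 1"
    using assms by (intro toric_stack_picard_variety) (simp_all add: free_resolution_def is_lift_def)
  show ?thesis using Pic_iso by blast
qed

end
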